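(* Let $\alpha,\beta>0$ and use the coordinates $(x,y,\theta)$ on $\mathrm{SL}(2,\mathbb{R})$ and the objects $\lambda_i,L^i,\Phi'$ defined in the context. (1) The metric on the group $\mathrm{SL}(2,\mathbb{R})$, invariant under the action of $\mathrm{SL}(2,\mathbb{R})$ on itself by left multiplication, is $$\mathrm{d}s^2_{\mathrm{SL}(2,\mathbb{R})}(x,y,\theta)=\lambda_1^2+\lambda_2^2+\lambda_3^2=\alpha\frac{\mathrm{d}x^2+\mathrm{d}y^2}{y^2}+\beta\Big(\frac{\mathrm{d}x}{y}+2\mathrm{d}\theta\Big)^2=\frac{(\alpha+\beta)\mathrm{d}x^2+\alpha\,\mathrm{d}y^2}{y^2}+4\beta\,\mathrm{d}\theta^2+4\frac{\beta}{y}\mathrm{d}x\,\mathrm{d}\theta;$$ its matrix $g_{\mathrm{SL}(2,\mathbb{R})}$ has nonzero entries (up to symmetry) $g_{xx}=\frac{\alpha+\beta}{y^2}$, $g_{yy}=\frac{\alpha}{y^2}$, $g_{\theta\theta}=4\beta$, $g_{x\theta}=\frac{2\beta}{y}$. (2) The invariant vector fields $L^1,L^2,L^3$ are orthonormal with respect to this metric. (3) The Killing vector fields associated to this metric, solutions of the Killing equations $X^\mu\partial_\mu g_{\lambda\chi}+g_{\mu\chi}\partial_\lambda X^\mu+g_{\lambda\mu}\partial_\chi X^\mu=0$ for $g=g_{\mathrm{SL}(2,\mathbb{R})}$, $X=X^1\partial_x+X^2\partial_y+X^3\partial_\theta$, are given by $$v^*=\sqrt\alpha\big[(1-x^2+y^2)\partial_x-2xy\,\partial_y-y\,\partial_\theta\big],\quad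 h_1^*=4\sqrt\alpha\,(x\partial_x+y\partial_y),\quad w^*=\sqrt\beta\big[(1+x^2-y^2)\partial_x+2xy\,\partial_y+y\,\partial_\theta\big].$$ (4) $(L^3,\lambda_3,\Phi')$ defines an almost contact structure on $\mathrm{SL}(2,\mathbb{R})$. $\lambda_3$ is the contact structure for $\mathrm{SL}(2,\mathbb{R})$, $L^3$ is the Reeb vector, and the contact distribution is $\mathcal{D}=\operatorname{Ker}\lambda_3=\big\langle\partial_x-\frac1{2y}\partial_\theta,\ \partial_y\big\rangle$. $(\mathrm{SL}(2,\mathbb{R}),\mathcal{D},\mathrm{d}s^2_{\mathcal{D}})$, with $\mathrm{d}s^2_{\mathcal D}=(\lambda_1^2+\lambda_2^2)|_{\mathcal D}$, is a sub-Riemannian manifold, and $$\mathrm{d}s^2_{\mathrm{SL}(2,\mathbb{R})}(x,y,\theta)=\mathrm{d}s^2_{\mathcal{X}_1}+\lambda_3^2,\qquad \mathrm{d}s^2_{\mathcal{X}_1}=\lambda_1^2+\lambda_2^2=\alpha\frac{\mathrm{d}x^2+\mathrm{d}y^2}{y^2},$$ where $\mathrm{d}s^2_{\mathcal{X}_1}$ is the (Beltrami) Kähler metric on the Siegel upper half-plane $\mathcal{X}_1=\{(x,y)\in\mathbb{R}^2:\ y>0\}$. The invariant vector fields $l^1_0=\frac{y}{\sqrt\alpha}\partial_x$ and $l^2_0=\frac{y}{\sqrt\alpha}\partial_y$ are orthonormal with respect to $\mathrm{d}s^2_{\mathcal{X}_1}$. (5) The manifold $\mathrm{SL}(2,\mathbb{R})$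 admits the homogeneous contact metric structure $(\lambda_3,L^3,\Phi',g_{\mathrm{SL}(2,\mathbb{R})})$. The group $\mathrm{SL}(2,\mathbb{R})$ has the K-contact structure associated with $\xi=L^3$, and it is a Sasaki manifold with the Riemann cone $(C(\mathrm{SL}(2,\mathbb{R})),\omega,\bar g)$ with respect to the metric $g_{\mathrm{SL}(2,\mathbb{R})}$, where $$\bar g(r,x,y,\theta)=\mathrm{d}r^2+r^2g_{\mathrm{SL}(2,\mathbb{R})}(x,y,\theta),\qquad \omega=\mathrm{d}(r^2\lambda_3).$$
   Context: Coordinates $(x,y,\theta)$, $x\in\mathbb{R}$, $y>0$, on $\mathrm{SL}(2,\mathbb{R})$ are given by the Iwasawa decomposition $M=\begin{pmatrix}1&x\\0&1\end{pmatrix}\begin{pmatrix}y^{1/2}&0\\0&y^{-1/2}\end{pmatrix}\begin{pmatrix}\cos\theta&\sin\theta\\-\sin\theta&\cos\theta\end{pmatrix}$. Left multiplication by $M=\begin{pmatrix}a&b\\c&d\end{pmatrix}$ sends $(x',y',\theta')$ to $(x_1,y_1,\theta_1)$ with, for $\Lambda=(cx'+d)^2+(cy')^2$: $x_1+\mathrm{i}y_1=\frac{(ax'+b)(cx'+d)+acy'^2+\mathrm{i}y'}{\Lambda}$, $\sin\theta_1=\frac{(cx'+d)\sin\theta'-cy'\cos\theta'}{\sqrt\Lambda}$, $\cos\theta_1=\frac{cy'\sin\theta'+(cx'+d)\cos\theta'}{\sqrt\Lambda}$. One-forms: $\lambda_1=\frac{\sqrt\alpha}{y}(\cos2\theta\,\mathrm{d}x+\sin2\theta\,\mathrm{d}y)$,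 $\lambda_2=\frac{\sqrt\alpha}{y}(-\sin2\theta\,\mathrm{d}x+\cos2\theta\,\mathrm{d}y)$, $\lambda_3=\sqrt\beta\big(\frac{\mathrm{d}x}{y}+2\mathrm{d}\theta\big)$. Vector fields: $L^1=\frac1{\sqrt\alpha}\big(y\cos2\theta\,\partial_x+y\sin2\theta\,\partial_y-\frac12\cos2\theta\,\partial_\theta\big)$, $L^2=\frac1{\sqrt\alpha}\big(-y\sin2\theta\,\partial_x+y\cos2\theta\,\partial_y+\frac12\sin2\theta\,\partial_\theta\big)$, $L^3=\frac1{2\sqrt\beta}\partial_\theta$. The $(1,1)$-tensor $\Phi'$ is $\Phi'=-\partial_y\otimes\mathrm{d}x+\big(\partial_x-\frac1{2y}\partial_\theta\big)\otimes\mathrm{d}y$. It is the rescaling $\Phi'=\frac{2\alpha}{\sqrt\beta}\Phi$ of the tensor $\Phi$ defined by $g_{ih}\Phi^h_j=\hat\Phi_{ij}$ ($g=g_{\mathrm{SL}(2,\mathbb{R})}$), where the only nonzero components of $\hat\Phi$ are $\hat\Phi_{xy}=-\hat\Phi_{yx}=\frac{\sqrt\beta}{2y^2}$, so that $\mathrm{d}\lambda_3=\hat\Phi_{ij}\,\mathrm{d}x^i\wedge\mathrm{d}x^j=\sqrt\beta\,\frac{\mathrm{d}x\wedge\mathrm{d}y}{y^2}$. Definitions. An almost contact structure $(\Phi,\xi,\eta)$ on a $(2n+1)$-dimensional manifold $M$ consists of a $(1,1)$-tensor $\Phi$, a vector field $\xi$ (Reeb or characteristic vector field) and a one-form $\eta$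 with $\eta(\xi)=1$ and $\Phi^2X=-X+\eta(X)\xi$. A contact form is a one-form $\eta$ with $\eta\wedge(\mathrm{d}\eta)^n\neq0$; its contact distribution is $\operatorname{Ker}\eta$. A contact metric structure $(\eta,\xi,\Phi,g)$ consists of a contact form $\eta$, an almost contact structure $(\Phi,\xi,\eta)$ and a Riemannian metric $g$ with $g(\xi,X)=\eta(X)$, $g(\Phi X,\Phi Y)=g(X,Y)-\eta(X)\eta(Y)$ and $\mathrm{d}\eta(X,Y)=g(X,\Phi Y)$. It is homogeneous if a connected Lie group acts transitively and effectively on $M$ by diffeomorphisms leaving $\eta$ invariant. It is K-contact if $\xi$ is a Killing vector field of $g$. The Riemannian cone of $(M,g)$ is $C(M)=M\times\mathbb{R}^+$ with metric $\bar g=\mathrm{d}r^2+r^2g$; on it one has the almost complex structure $\bar\Phi Y=\Phi Y+\eta(Y)\Psi$ for $Y\in TM$, $\bar\Phi\Psi=-\xi$, $\Psi=r\partial_r$, and the two-form $\omega=\mathrm{d}(r^2\eta)$. The structure is normal if $\bar\Phi$ is integrable; a normal contact metric structure is called Sasakian (Sasaki manifold). A sub-Riemannian manifold is a manifold with a non-integrable (bracket-generating) distribution and a positive definite metric on that distribution.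
   Formalization: (3): all Killing fields are spanned by v*, h1*, w* and also L^3. (4): l_0^1, l_0^2 are invariant under z->az+b (a>0) only. (5): with d carrying the factor 1/2, contact metric, K-contact and Sasaki hold iff 2α=√β; in general dλ_3 is represented by Φ=(√β/2α)Φ'. *)

theory Defs
  imports "HOL-Analysis.Analysis"
begin

section \<open>Smooth maps and tensor fields on an open set of a Euclidean space\<close>

text \<open>
  Tensor fields are given by their expression in global coordinates on an open set \<open>S\<close>:
  a vector field is a map \<open>p \<mapsto> X p\<close>, a one-form a map \<open>p \<mapsto> (v \<mapsto> \<eta> p v)\<close>, and so on.
  Only the values on \<open>S\<close> matter.
\<close>

primrec Ck_on :: "nat \<Rightarrow> 'a::euclidean_space set \<Rightarrow> ('a \<Rightarrow> 'b::real_normed_vector) \<Rightarrow> bool" where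
  "Ck_on 0 S f \<longleftrightarrow> continuous_on S f"
| "Ck_on (Suc k) S f \<longleftrightarrow>
     (\<forall>p\<in>S. f differentiable (at p)) \<and> (\<forall>v. Ck_on k S (\<lambda>p. frechet_derivative f (at p) v))"

definition smooth_on :: "'a::euclidean_space set \<Rightarrow> ('a \<Rightarrow> 'b::real_normed_vector) \<Rightarrow> bool" where
  "smooth_on S f \<longleftrightarrow> (\<forall>k. Ck_on k S f)"

definition one_form :: "'a::euclidean_space set \<Rightarrow> ('a \<Rightarrow> 'a \<Rightarrow> real) \<Rightarrow> bool" where
  "one_form S \<eta> \<longleftrightarrow> (\<forall>p\<in>S. linear (\<eta> p)) \<and> (\<forall>v. smooth_on S (\<lambda>p. \<eta> p v))"

definition tensor_field_1_1 :: "'a::euclidean_space set \<Rightarrow> ('a \<Rightarrow> 'a \<Rightarrow> 'a) \<Rightarrow> bool" where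
  "tensor_field_1_1 S \<Phi> \<longleftrightarrow> (\<forall>p\<in>S. linear (\<Phi> p)) \<and> (\<forall>v. smooth_on S (\<lambda>p. \<Phi> p v))"

definition riemannian_metric :: "'a::euclidean_space set \<Rightarrow> ('a \<Rightarrow> 'a \<Rightarrow> 'a \<Rightarrow> real) \<Rightarrow> bool" where
  "riemannian_metric S g \<longleftrightarrow>
     (\<forall>p\<in>S. bilinear (g p) \<and> (\<forall>u v. g p u v = g p v u) \<and> (\<forall>v. v \<noteq> 0 \<longrightarrow> g p v v > 0)) \<and>
     (\<forall>u v. smooth_on S (\<lambda>p. g p u v))"

definition orthonormal_fields ::
    "'a set \<Rightarrow> ('a \<Rightarrow> 'a \<Rightarrow> 'a \<Rightarrow> real) \<Rightarrow> ('a \<Rightarrow> 'a) list \<Rightarrow> bool" where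
  "orthonormal_fields S g Xs \<longleftrightarrow>
     (\<forall>p\<in>S. \<forall>i<length Xs. \<forall>j<length Xs. g p ((Xs ! i) p) ((Xs ! j) p) = (if i = j then 1 else 0))"

definition lie_bracket ::
    "('a::euclidean_space \<Rightarrow> 'a) \<Rightarrow> ('a \<Rightarrow> 'a) \<Rightarrow> 'a \<Rightarrow> 'a" where
  "lie_bracket X Y p =
     frechet_derivative Y (at p) (X p) - frechet_derivative X (at p) (Y p)"

text \<open>
  Convention (Kobayashi--Nomizu, Blair): \<open>(a \<and> b)(u,v) = (a(u) b(v) - a(v) b(u)) / 2\<close>, and accordingly
  \<open>2 d\<eta>(X,Y) = X \<eta>(Y) - Y \<eta>(X) - \<eta>[X,Y]\<close>.  With it, \<open>\<Sum> \<Phi>\<^sub>i\<^sub>j dx\<^sup>i \<and> dx\<^sup>j\<close> for an antisymmetric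
  \<open>\<Phi>\<^sub>i\<^sub>j\<close> takes the value \<open>\<Sum> \<Phi>\<^sub>i\<^sub>j u\<^sup>i v\<^sup>j\<close> on \<open>(u,v)\<close>.
\<close>

definition wedge11 :: "('a \<Rightarrow> real) \<Rightarrow> ('a \<Rightarrow> real) \<Rightarrow> 'a \<Rightarrow> 'a \<Rightarrow> real" where
  "wedge11 a b u v = (a u * b v - a v * b u) / 2"

definition ext_d :: "('a::euclidean_space \<Rightarrow> 'a \<Rightarrow> real) \<Rightarrow> 'a \<Rightarrow> 'a \<Rightarrow> 'a \<Rightarrow> real" where
  "ext_d \<eta> p u v =
     (frechet_derivative (\<lambda>q. \<eta> q v) (at p) u - frechet_derivative (\<lambda>q. \<eta> q u) (at p) v) / 2"

definition closed_two_form :: "'a::euclidean_space set \<Rightarrow> ('a \<Rightarrow> 'a \<Rightarrow> 'a \<Rightarrow> real) \<Rightarrow> bool" where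
  "closed_two_form S \<sigma> \<longleftrightarrow> (\<forall>p\<in>S. \<forall>u v w.
     frechet_derivative (\<lambda>q. \<sigma> q v w) (at p) u + frechet_derivative (\<lambda>q. \<sigma> q w u) (at p) v
     + frechet_derivative (\<lambda>q. \<sigma> q u v) (at p) w = 0)"

definition nondegenerate :: "'a::euclidean_space set \<Rightarrow> ('a \<Rightarrow> 'a \<Rightarrow> 'a \<Rightarrow> real) \<Rightarrow> bool" where
  "nondegenerate S \<sigma> \<longleftrightarrow> (\<forall>p\<in>S. \<forall>u. (\<forall>v. \<sigma> p u v = 0) \<longrightarrow> u = 0)"

section \<open>Killing vector fields\<close>

definition partial_deriv :: "'n::finite \<Rightarrow> (real^'n \<Rightarrow> real) \<Rightarrow> real^'n \<Rightarrow> real" where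
  "partial_deriv i f p = frechet_derivative f (at p) (axis i 1)"

definition metric_matrix :: "(real^'n \<Rightarrow> real^'n \<Rightarrow> real^'n \<Rightarrow> real) \<Rightarrow> real^'n \<Rightarrow> real^'n^'n" where
  "metric_matrix g p = (\<chi> i j. g p (axis i 1) (axis j 1))"

definition killing_field ::
    "(real^'n) set \<Rightarrow> (real^'n \<Rightarrow> real^'n \<Rightarrow> real^'n \<Rightarrow> real) \<Rightarrow> (real^'n \<Rightarrow> real^'n) \<Rightarrow> bool" where
  "killing_field S g X \<longleftrightarrow> smooth_on S X \<and>
     (\<forall>p\<in>S. \<forall>l c.
        (\<Sum>m\<in>UNIV. X p $ m * partial_deriv m (\<lambda>q. metric_matrix g q $ l $ c) p
            + metric_matrix g p $ m $ c * partial_deriv l (\<lambda>q. X q $ m) p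
            + metric_matrix g p $ l $ m * partial_deriv c (\<lambda>q. X q $ m) p) = 0)"

section \<open>Complex and Kaehler structures\<close>

text \<open>
  Integrability of an almost complex structure: around every point there are local coordinates
  \<open>f\<^sub>0, \<dots>, f\<^sub>m\<^sub>-\<^sub>1\<close> with values in the complex numbers, \<open>2m\<close> being the dimension, whose differentials are
  complex linear with respect to \<open>J\<close>.  By the inverse function theorem, the last two conditions
  make \<open>(f\<^sub>0, \<dots>, f\<^sub>m\<^sub>-\<^sub>1)\<close> a diffeomorphism onto an open set of the complex \<open>m\<close>-space.
\<close>

definition almost_complex :: "'a::euclidean_space set \<Rightarrow> ('a \<Rightarrow> 'a \<Rightarrow> 'a) \<Rightarrow> bool" where
  "almost_complex S J \<longleftrightarrow> tensor_field_1_1 S J \<and> (\<forall>p\<in>S. \<forall>v. J p (J p v) = - v)"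

definition integrable_complex :: "'a::euclidean_space set \<Rightarrow> ('a \<Rightarrow> 'a \<Rightarrow> 'a) \<Rightarrow> bool" where
  "integrable_complex S J \<longleftrightarrow> almost_complex S J \<and>
     (\<forall>p\<in>S. \<exists>V (f :: nat \<Rightarrow> 'a \<Rightarrow> complex). let m = DIM('a) div 2 in
        open V \<and> p \<in> V \<and> V \<subseteq> S \<and>
        (\<forall>k<m. smooth_on V (f k)) \<and>
        (\<forall>k<m. \<forall>q\<in>V. \<forall>v. frechet_derivative (f k) (at q) (J q v)
                           = \<i> * frechet_derivative (f k) (at q) v) \<and>
        (\<forall>q\<in>V. \<forall>v. (\<forall>k<m. frechet_derivative (f k) (at q) v = 0) \<longrightarrow> v = 0) \<and>
        (\<forall>q\<in>V. \<forall>q'\<in>V. (\<forall>k<m. f k q = f k q') \<longrightarrow> q = q'))"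

definition kaehler_metric ::
    "'a::euclidean_space set \<Rightarrow> ('a \<Rightarrow> 'a \<Rightarrow> 'a) \<Rightarrow> ('a \<Rightarrow> 'a \<Rightarrow> 'a \<Rightarrow> real) \<Rightarrow> bool" where
  "kaehler_metric S J g \<longleftrightarrow> integrable_complex S J \<and> riemannian_metric S g \<and>
     (\<forall>p\<in>S. \<forall>u v. g p (J p u) (J p v) = g p u v) \<and>
     closed_two_form S (\<lambda>p u v. g p u (J p v))"

section \<open>Contact structures\<close>

definition almost_contact_structure ::
    "'a::euclidean_space set \<Rightarrow> ('a \<Rightarrow> 'a \<Rightarrow> 'a) \<Rightarrow> ('a \<Rightarrow> 'a) \<Rightarrow> ('a \<Rightarrow> 'a \<Rightarrow> real) \<Rightarrow> bool" where
  "almost_contact_structure S \<Phi> \<xi> \<eta> \<longleftrightarrow> odd DIM('a) \<and>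
     tensor_field_1_1 S \<Phi> \<and> smooth_on S \<xi> \<and> one_form S \<eta> \<and>
     (\<forall>p\<in>S. \<eta> p (\<xi> p) = 1 \<and> (\<forall>v. \<Phi> p (\<Phi> p v) = - v + \<eta> p v *\<^sub>R \<xi> p))"

text \<open>The value of \<open>\<eta> \<and> (d\<eta>)\<^sup>n\<close>, up to a nonzero constant factor, on \<open>v\<^sub>0, \<dots>, v\<^sub>2\<^sub>n\<close>.\<close>

definition contact_volume ::
    "nat \<Rightarrow> ('a::euclidean_space \<Rightarrow> 'a \<Rightarrow> real) \<Rightarrow> 'a \<Rightarrow> (nat \<Rightarrow> 'a) \<Rightarrow> real" where
  "contact_volume n \<eta> p v =
     (\<Sum>\<sigma> | \<sigma> permutes {..2 * n}. of_int (sign \<sigma>) * \<eta> p (v (\<sigma> 0)) *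
        (\<Prod>i<n. ext_d \<eta> p (v (\<sigma> (2 * i + 1))) (v (\<sigma> (2 * i + 2)))))"

definition contact_form :: "'a::euclidean_space set \<Rightarrow> ('a \<Rightarrow> 'a \<Rightarrow> real) \<Rightarrow> bool" where
  "contact_form S \<eta> \<longleftrightarrow> one_form S \<eta> \<and>
     (\<exists>n. DIM('a) = 2 * n + 1 \<and> (\<forall>p\<in>S. \<exists>v. contact_volume n \<eta> p v \<noteq> 0))"

definition contact_distribution :: "('a \<Rightarrow> 'a \<Rightarrow> real) \<Rightarrow> 'a \<Rightarrow> 'a set" where
  "contact_distribution \<eta> p = {v. \<eta> p v = 0}"

definition reeb_field ::
    "'a::euclidean_space set \<Rightarrow> ('a \<Rightarrow> 'a \<Rightarrow> real) \<Rightarrow> ('a \<Rightarrow> 'a) \<Rightarrow> bool" where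
  "reeb_field S \<eta> \<xi> \<longleftrightarrow> smooth_on S \<xi> \<and>
     (\<forall>p\<in>S. \<eta> p (\<xi> p) = 1 \<and> (\<forall>v. ext_d \<eta> p (\<xi> p) v = 0))"

definition contact_metric_structure ::
    "'a::euclidean_space set \<Rightarrow> ('a \<Rightarrow> 'a \<Rightarrow> real) \<Rightarrow> ('a \<Rightarrow> 'a) \<Rightarrow> ('a \<Rightarrow> 'a \<Rightarrow> 'a) \<Rightarrow>
     ('a \<Rightarrow> 'a \<Rightarrow> 'a \<Rightarrow> real) \<Rightarrow> bool" where
  "contact_metric_structure S \<eta> \<xi> \<Phi> g \<longleftrightarrow>
     contact_form S \<eta> \<and> almost_contact_structure S \<Phi> \<xi> \<eta> \<and> riemannian_metric S g \<and>
     (\<forall>p\<in>S. (\<forall>u. g p (\<xi> p) u = \<eta> p u) \<and>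
        (\<forall>u v. g p (\<Phi> p u) (\<Phi> p v) = g p u v - \<eta> p u * \<eta> p v) \<and>
        (\<forall>u v. ext_d \<eta> p u v = g p u (\<Phi> p v)))"

text \<open>
  The same, except that it is the rescaled tensor \<open>\<Phi> / \<kappa>\<close> that represents \<open>d\<eta>\<close> with respect to \<open>g\<close>,
  while \<open>\<Phi>\<close> satisfies all the other axioms.  For \<open>\<kappa> = 1\<close> this is a contact metric structure.
\<close>

definition rescaled_contact_metric_structure ::
    "real \<Rightarrow> 'a::euclidean_space set \<Rightarrow> ('a \<Rightarrow> 'a \<Rightarrow> real) \<Rightarrow> ('a \<Rightarrow> 'a) \<Rightarrow> ('a \<Rightarrow> 'a \<Rightarrow> 'a) \<Rightarrow>
     ('a \<Rightarrow> 'a \<Rightarrow> 'a \<Rightarrow> real) \<Rightarrow> bool" where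
  "rescaled_contact_metric_structure \<kappa> S \<eta> \<xi> \<Phi> g \<longleftrightarrow>
     contact_form S \<eta> \<and> almost_contact_structure S \<Phi> \<xi> \<eta> \<and> riemannian_metric S g \<and>
     (\<forall>p\<in>S. (\<forall>u. g p (\<xi> p) u = \<eta> p u) \<and>
        (\<forall>u v. g p (\<Phi> p u) (\<Phi> p v) = g p u v - \<eta> p u * \<eta> p v) \<and>
        (\<forall>u v. ext_d \<eta> p u v = g p u ((1 / \<kappa>) *\<^sub>R \<Phi> p v)))"

definition K_contact ::
    "(real^'n) set \<Rightarrow> (real^'n \<Rightarrow> real^'n \<Rightarrow> real) \<Rightarrow> (real^'n \<Rightarrow> real^'n) \<Rightarrow>
     (real^'n \<Rightarrow> real^'n \<Rightarrow> real^'n) \<Rightarrow> (real^'n \<Rightarrow> real^'n \<Rightarrow> real^'n \<Rightarrow> real) \<Rightarrow> bool" where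
  "K_contact S \<eta> \<xi> \<Phi> g \<longleftrightarrow> contact_metric_structure S \<eta> \<xi> \<Phi> g \<and> killing_field S g \<xi>"

text \<open>
  The cone over \<open>S\<close>, with points \<open>(r, p)\<close> and tangent vectors \<open>(a, w)\<close>.  Since
  \<open>\<Psi> = r \<partial>\<^sub>r\<close>, one has \<open>(a, w) = w + (a / r) \<Psi>\<close>, which gives the formula for \<open>cone_acs\<close>.
\<close>

definition riem_cone :: "'a set \<Rightarrow> (real \<times> 'a) set" where
  "riem_cone S = {0<..} \<times> S"

definition cone_metric ::
    "('a \<Rightarrow> 'a \<Rightarrow> 'a \<Rightarrow> real) \<Rightarrow> real \<times> 'a \<Rightarrow> real \<times> 'a \<Rightarrow> real \<times> 'a \<Rightarrow> real" where
  "cone_metric g c u v = fst u * fst v + (fst c)\<^sup>2 * g (snd c) (snd u) (snd v)"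

definition cone_acs ::
    "('a::euclidean_space \<Rightarrow> 'a \<Rightarrow> 'a) \<Rightarrow> ('a \<Rightarrow> 'a) \<Rightarrow> ('a \<Rightarrow> 'a \<Rightarrow> real) \<Rightarrow>
     real \<times> 'a \<Rightarrow> real \<times> 'a \<Rightarrow> real \<times> 'a" where
  "cone_acs \<Phi> \<xi> \<eta> = (\<lambda>(r, p) (a, w). (r * \<eta> p w, \<Phi> p w - (a / r) *\<^sub>R \<xi> p))"

definition cone_form ::
    "('a::euclidean_space \<Rightarrow> 'a \<Rightarrow> real) \<Rightarrow> real \<times> 'a \<Rightarrow> real \<times> 'a \<Rightarrow> real \<times> 'a \<Rightarrow> real" where
  "cone_form \<eta> = ext_d (\<lambda>c v. (fst c)\<^sup>2 * \<eta> (snd c) (snd v))"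

definition normal_structure ::
    "'a::euclidean_space set \<Rightarrow> ('a \<Rightarrow> 'a \<Rightarrow> 'a) \<Rightarrow> ('a \<Rightarrow> 'a) \<Rightarrow> ('a \<Rightarrow> 'a \<Rightarrow> real) \<Rightarrow> bool" where
  "normal_structure S \<Phi> \<xi> \<eta> \<longleftrightarrow> integrable_complex (riem_cone S) (cone_acs \<Phi> \<xi> \<eta>)"

definition sasakian ::
    "'a::euclidean_space set \<Rightarrow> ('a \<Rightarrow> 'a \<Rightarrow> real) \<Rightarrow> ('a \<Rightarrow> 'a) \<Rightarrow> ('a \<Rightarrow> 'a \<Rightarrow> 'a) \<Rightarrow>
     ('a \<Rightarrow> 'a \<Rightarrow> 'a \<Rightarrow> real) \<Rightarrow> bool" where
  "sasakian S \<eta> \<xi> \<Phi> g \<longleftrightarrow> contact_metric_structure S \<eta> \<xi> \<Phi> g \<and> normal_structure S \<Phi> \<xi> \<eta>"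

section \<open>Sub-Riemannian manifolds\<close>

text \<open>The iterated brackets of the smooth sections of a distribution \<open>D\<close>.\<close>

inductive_set bracket_closure ::
    "'a::euclidean_space set \<Rightarrow> ('a \<Rightarrow> 'a set) \<Rightarrow> ('a \<Rightarrow> 'a) set" for S D where
  base: "smooth_on S X \<Longrightarrow> (\<And>p. p \<in> S \<Longrightarrow> X p \<in> D p) \<Longrightarrow> X \<in> bracket_closure S D"
| bracket: "X \<in> bracket_closure S D \<Longrightarrow> Y \<in> bracket_closure S D \<Longrightarrow>
            lie_bracket X Y \<in> bracket_closure S D"

definition bracket_generating :: "'a::euclidean_space set \<Rightarrow> ('a \<Rightarrow> 'a set) \<Rightarrow> bool" where
  "bracket_generating S D \<longleftrightarrow> (\<forall>p\<in>S. span ((\<lambda>X. X p) ` bracket_closure S D) = UNIV)"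

definition distribution :: "'a::euclidean_space set \<Rightarrow> ('a \<Rightarrow> 'a set) \<Rightarrow> bool" where
  "distribution S D \<longleftrightarrow>
     (\<exists>k. \<forall>p\<in>S. subspace (D p) \<and> dim (D p) = k) \<and>
     (\<forall>p\<in>S. \<forall>v\<in>D p. \<exists>V X. open V \<and> p \<in> V \<and> V \<subseteq> S \<and> smooth_on V X \<and>
        (\<forall>q\<in>V. X q \<in> D q) \<and> X p = v)"

definition sub_riemannian ::
    "'a::euclidean_space set \<Rightarrow> ('a \<Rightarrow> 'a set) \<Rightarrow> ('a \<Rightarrow> 'a \<Rightarrow> 'a \<Rightarrow> real) \<Rightarrow> bool" where
  "sub_riemannian S D g \<longleftrightarrow> distribution S D \<and> bracket_generating S D \<and>
     (\<forall>p\<in>S. \<forall>u\<in>D p. \<forall>v\<in>D p. \<forall>w\<in>D p. \<forall>a b.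
        g p u v = g p v u \<and> g p (a *\<^sub>R u + b *\<^sub>R v) w = a * g p u w + b * g p v w \<and>
        (u \<noteq> 0 \<longrightarrow> g p u u > 0)) \<and>
     (\<forall>V X Y. open V \<and> V \<subseteq> S \<and> smooth_on V X \<and> smooth_on V Y \<and>
        (\<forall>q\<in>V. X q \<in> D q \<and> Y q \<in> D q) \<longrightarrow> smooth_on V (\<lambda>q. g q (X q) (Y q)))"

section \<open>The group SL(2,R) in Iwasawa coordinates\<close>

definition SL2R :: "(real^2^2) set" where
  "SL2R = {M. det M = 1}"

text \<open>
  The coordinates \<open>(x, y, \<theta>)\<close> are the components \<open>$ 1\<close>, \<open>$ 2\<close>, \<open>$ 3\<close>.  The angle is a real
  number rather than a class modulo \<open>2 \<pi>\<close>, so \<open>iwasawa\<close> maps the coordinate domain onto \<open>SL2R\<close> as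
  a covering (\<open>iwasawa_image\<close>, \<open>iwasawa_eq_iff\<close>).
\<close>

definition iw_dom :: "(real^3) set" where
  "iw_dom = {p. p $ 2 > 0}"

definition iwasawa :: "real^3 \<Rightarrow> real^2^2" where
  "iwasawa p =
     (vector [vector [1, p $ 1], vector [0, 1]] :: real^2^2) **
     (vector [vector [sqrt (p $ 2), 0], vector [0, 1 / sqrt (p $ 2)]] :: real^2^2) **
     vector [vector [cos (p $ 3), sin (p $ 3)], vector [- sin (p $ 3), cos (p $ 3)]]"

lemma iwasawa_entries:
  "iwasawa p $ 1 $ 1 = sqrt (p $ 2) * cos (p $ 3) - p $ 1 / sqrt (p $ 2) * sin (p $ 3)"
  "iwasawa p $ 1 $ 2 = sqrt (p $ 2) * sin (p $ 3) + p $ 1 / sqrt (p $ 2) * cos (p $ 3)"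
  "iwasawa p $ 2 $ 1 = - sin (p $ 3) / sqrt (p $ 2)"
  "iwasawa p $ 2 $ 2 = cos (p $ 3) / sqrt (p $ 2)"
  by (simp_all add: iwasawa_def matrix_matrix_mult_def sum_2)

lemma iwasawa_in_SL2R:
  assumes "p \<in> iw_dom"
  shows "iwasawa p \<in> SL2R"
proof -
  have "p $ 2 > 0"
    using assms by (simp add: iw_dom_def)
  then have s: "sqrt (p $ 2) \<noteq> 0"
    by simp
  have "(s * c - x / s * t) * (c / s) - (s * t + x / s * c) * (- t / s) = t\<^sup>2 + c\<^sup>2"
    if "s \<noteq> 0" for s c x t :: real
    using that by (simp add: field_simps power2_eq_square)
  from this[OF s] have "det (iwasawa p) = (sin (p $ 3))\<^sup>2 + (cos (p $ 3))\<^sup>2"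
    unfolding det_2 iwasawa_entries .
  then show ?thesis
    by (simp add: SL2R_def)
qed

lemma iwasawa_eq_matrix_iff:
  fixes M :: "real^2^2"
  assumes M: "M \<in> SL2R" and q: "q \<in> iw_dom"
  defines "L \<equiv> (M $ 2 $ 1)\<^sup>2 + (M $ 2 $ 2)\<^sup>2"
  shows "iwasawa q = M \<longleftrightarrow>
    q $ 1 = (M $ 1 $ 1 * M $ 2 $ 1 + M $ 1 $ 2 * M $ 2 $ 2) / L \<and> q $ 2 = 1 / L \<and>
    sin (q $ 3) = - (M $ 2 $ 1) / sqrt L \<and> cos (q $ 3) = M $ 2 $ 2 / sqrt L"
proof -
  have det: "M $ 1 $ 1 * M $ 2 $ 2 - M $ 1 $ 2 * M $ 2 $ 1 = 1"
    using M by (simp add: SL2R_def det_2)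
  have y: "q $ 2 > 0"
    using q by (simp add: iw_dom_def)
  have "M $ 2 $ 1 \<noteq> 0 \<or> M $ 2 $ 2 \<noteq> 0"
    using det by auto
  then have L: "L > 0"
    unfolding L_def by (metis sum_power2_gt_zero_iff)
  show ?thesis
  proof
    assume "iwasawa q = M"
    then have e: "M $ 1 $ 1 = sqrt (q $ 2) * cos (q $ 3) - q $ 1 / sqrt (q $ 2) * sin (q $ 3)"
      "M $ 1 $ 2 = sqrt (q $ 2) * sin (q $ 3) + q $ 1 / sqrt (q $ 2) * cos (q $ 3)"
      "M $ 2 $ 1 = - sin (q $ 3) / sqrt (q $ 2)"
      "M $ 2 $ 2 = cos (q $ 3) / sqrt (q $ 2)"
      using iwasawa_entries[of q] by simp_all
    have "L = ((sin (q $ 3))\<^sup>2 + (cos (q $ 3))\<^sup>2) / q $ 2"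
      unfolding L_def e using y by (simp add: power_divide add_divide_distrib del: sin_cos_squared_add)
    then have Ly: "L = 1 / q $ 2"
      by (simp only: sin_cos_squared_add)
    have "(s * c - x / s * t) * (- t / s) + (s * t + x / s * c) * (c / s) = x * (t\<^sup>2 + c\<^sup>2) / s\<^sup>2"
      if "s \<noteq> 0" for s c x t :: real
      using that by (simp add: field_simps power2_eq_square)
    from this[of "sqrt (q $ 2)"] y
    have "M $ 1 $ 1 * M $ 2 $ 1 + M $ 1 $ 2 * M $ 2 $ 2
        = q $ 1 * ((sin (q $ 3))\<^sup>2 + (cos (q $ 3))\<^sup>2) / (sqrt (q $ 2))\<^sup>2"
      unfolding e by (metis real_sqrt_gt_zero less_irrefl)
    also have "\<dots> = q $ 1 * L"
      using y by (simp add: Ly)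
    finally have "q $ 1 = (M $ 1 $ 1 * M $ 2 $ 1 + M $ 1 $ 2 * M $ 2 $ 2) / L"
      using L by simp
    then show "q $ 1 = (M $ 1 $ 1 * M $ 2 $ 1 + M $ 1 $ 2 * M $ 2 $ 2) / L \<and> q $ 2 = 1 / L \<and>
      sin (q $ 3) = - (M $ 2 $ 1) / sqrt L \<and> cos (q $ 3) = M $ 2 $ 2 / sqrt L"
      using y by (simp add: Ly e real_sqrt_divide)
  next
    assume a: "q $ 1 = (M $ 1 $ 1 * M $ 2 $ 1 + M $ 1 $ 2 * M $ 2 $ 2) / L \<and> q $ 2 = 1 / L \<and>
      sin (q $ 3) = - (M $ 2 $ 1) / sqrt L \<and> cos (q $ 3) = M $ 2 $ 2 / sqrt L"
    have sq: "sqrt (q $ 2) = 1 / sqrt L"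
      using a by (simp add: real_sqrt_divide)
    have sL: "sqrt L > 0" "sqrt L * sqrt L = L"
      using L by simp_all
    have R: "1 / r * (m / r) - X / L / (1 / r) * (- n / r) = (m + X * n) / L"
      "1 / r * (- n / r) + X / L / (1 / r) * (m / r) = (- n + X * m) / L"
      if "r > 0" "r * r = L" for r m n X :: real
      using that(1) unfolding that(2)[symmetric] by (simp_all add: field_simps)
    have "iwasawa q $ 1 $ 1 = (M $ 2 $ 2 + (M $ 1 $ 1 * M $ 2 $ 1 + M $ 1 $ 2 * M $ 2 $ 2) * M $ 2 $ 1) / L"
      unfolding iwasawa_entries sq using a R(1)[OF sL] by simp
    also have "M $ 2 $ 2 + (M $ 1 $ 1 * M $ 2 $ 1 + M $ 1 $ 2 * M $ 2 $ 2) * M $ 2 $ 1 = M $ 1 $ 1 * L"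
      using det unfolding L_def by algebra
    finally have 11: "iwasawa q $ 1 $ 1 = M $ 1 $ 1"
      using L by simp
    have "iwasawa q $ 1 $ 2 = (- M $ 2 $ 1 + (M $ 1 $ 1 * M $ 2 $ 1 + M $ 1 $ 2 * M $ 2 $ 2) * M $ 2 $ 2) / L"
      unfolding iwasawa_entries sq using a R(2)[OF sL] by simp
    also have "- M $ 2 $ 1 + (M $ 1 $ 1 * M $ 2 $ 1 + M $ 1 $ 2 * M $ 2 $ 2) * M $ 2 $ 2 = M $ 1 $ 2 * L"
      using det unfolding L_def by algebra
    finally have 12: "iwasawa q $ 1 $ 2 = M $ 1 $ 2"
      using L by simp
    have 2: "iwasawa q $ 2 $ 1 = M $ 2 $ 1" "iwasawa q $ 2 $ 2 = M $ 2 $ 2"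
      unfolding iwasawa_entries sq using a sL by simp_all
    show "iwasawa q = M"
      using 11 12 2 by (simp add: vec_eq_iff forall_2)
  qed
qed

lemma iwasawa_image: "iwasawa ` iw_dom = SL2R"
proof
  show "iwasawa ` iw_dom \<subseteq> SL2R"
    using iwasawa_in_SL2R by blast
next
  show "SL2R \<subseteq> iwasawa ` iw_dom"
  proof
    fix M :: "real^2^2"
    assume M: "M \<in> SL2R"
    define L where "L = (M $ 2 $ 1)\<^sup>2 + (M $ 2 $ 2)\<^sup>2"
    have "M $ 2 $ 1 \<noteq> 0 \<or> M $ 2 $ 2 \<noteq> 0"
      using M by (auto simp: SL2R_def det_2)
    then have L: "L > 0"
      unfolding L_def by (metis sum_power2_gt_zero_iff)
    have "(M $ 2 $ 2 / sqrt L)\<^sup>2 + (- (M $ 2 $ 1) / sqrt L)\<^sup>2 = L / L"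
      using L unfolding L_def by (simp add: power_divide flip: add_divide_distrib)
    then obtain t where t: "M $ 2 $ 2 / sqrt L = cos t" "- (M $ 2 $ 1) / sqrt L = sin t"
      using L sincos_total_2pi by (metis divide_self less_irrefl)
    define q :: "real^3" where
      "q = vector [(M $ 1 $ 1 * M $ 2 $ 1 + M $ 1 $ 2 * M $ 2 $ 2) / L, 1 / L, t]"
    have q: "q \<in> iw_dom"
      using L by (simp add: q_def iw_dom_def)
    have "iwasawa q = M"
      unfolding iwasawa_eq_matrix_iff[OF M q] using t by (simp add: q_def L_def)
    with q show "M \<in> iwasawa ` iw_dom"
      by blast
  qed
qed

lemma iwasawa_eq_iff:
  assumes "p \<in> iw_dom" "q \<in> iw_dom"
  shows "iwasawa q = iwasawa p \<longleftrightarrow>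
    q $ 1 = p $ 1 \<and> q $ 2 = p $ 2 \<and> (\<exists>k::int. q $ 3 = p $ 3 + 2 * pi * k)"
proof -
  have "sin (q $ 3) = sin (p $ 3) \<and> cos (q $ 3) = cos (p $ 3) \<longleftrightarrow>
      (\<exists>k::int. q $ 3 = p $ 3 + 2 * pi * k)"
    by (subst sin_cos_eq_iff) (simp add: mult_ac)
  then show ?thesis
    unfolding iwasawa_eq_matrix_iff[OF iwasawa_in_SL2R[OF assms(1)] assms(2)]
    using iwasawa_eq_matrix_iff[OF iwasawa_in_SL2R[OF assms(1)] assms(1)]
    by auto
qed

text \<open>Left multiplication in these coordinates.\<close>

lemma left_mult_coordinates:
  fixes A :: "real^2^2"
  assumes A: "A \<in> SL2R" and p: "p \<in> iw_dom" and q: "q \<in> iw_dom"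
  defines "a \<equiv> A $ 1 $ 1" and "b \<equiv> A $ 1 $ 2" and "c \<equiv> A $ 2 $ 1" and "d \<equiv> A $ 2 $ 2"
  defines "x \<equiv> p $ 1" and "y \<equiv> p $ 2" and "t \<equiv> p $ 3"
  defines "L \<equiv> (c * x + d)\<^sup>2 + (c * y)\<^sup>2"
  shows "iwasawa q = A ** iwasawa p \<longleftrightarrow>
    q $ 1 = ((a * x + b) * (c * x + d) + a * c * y\<^sup>2) / L \<and> q $ 2 = y / L \<and>
    sin (q $ 3) = ((c * x + d) * sin t - c * y * cos t) / sqrt L \<and>
    cos (q $ 3) = (c * y * sin t + (c * x + d) * cos t) / sqrt L"
proof -
  define N where "N = A ** iwasawa p"
  define s where "s = sqrt y"
  have y: "y > 0"
    using p by (simp add: iw_dom_def y_def)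
  then have s: "s > 0" "y = s * s"
    by (simp_all add: s_def)
  have N: "N \<in> SL2R"
    using A iwasawa_in_SL2R[OF p] by (simp add: N_def SL2R_def det_mul)
  have sc: "sin t * sin t + cos t * cos t = 1"
    using sin_cos_squared_add[of t] by (simp add: power2_eq_square)
  have e: "N $ 1 $ 1 = (a * y * cos t - (a * x + b) * sin t) / s"
    "N $ 1 $ 2 = (a * y * sin t + (a * x + b) * cos t) / s"
    "N $ 2 $ 1 = (c * y * cos t - (c * x + d) * sin t) / s"
    "N $ 2 $ 2 = (c * y * sin t + (c * x + d) * cos t) / s"
    using s(1) unfolding N_def matrix_matrix_mult_def
    by (simp_all add: sum_2 iwasawa_entries a_def[symmetric] b_def[symmetric] c_def[symmetric]
        d_def[symmetric] x_def[symmetric] y_def[symmetric] t_def[symmetric] s_def[symmetric])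
      (simp_all add: s(2) field_simps)
  have "(c * y * cos t - (c * x + d) * sin t)\<^sup>2 + (c * y * sin t + (c * x + d) * cos t)\<^sup>2 = L"
    unfolding L_def using sc by algebra
  then have "(N $ 2 $ 1)\<^sup>2 + (N $ 2 $ 2)\<^sup>2 = L / s\<^sup>2"
    unfolding e power_divide by (simp only: add_divide_distrib[symmetric])
  then have L: "(N $ 2 $ 1)\<^sup>2 + (N $ 2 $ 2)\<^sup>2 = L / y"
    by (simp add: s(2) power2_eq_square)
  have "(a * y * cos t - (a * x + b) * sin t) * (c * y * cos t - (c * x + d) * sin t)
      + (a * y * sin t + (a * x + b) * cos t) * (c * y * sin t + (c * x + d) * cos t)
      = (a * x + b) * (c * x + d) + a * c * y\<^sup>2"
    using sc by algebra
  then have "N $ 1 $ 1 * N $ 2 $ 1 + N $ 1 $ 2 * N $ 2 $ 2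
      = ((a * x + b) * (c * x + d) + a * c * y\<^sup>2) / (s * s)"
    unfolding e times_divide_times_eq by (simp only: add_divide_distrib[symmetric])
  then have X: "N $ 1 $ 1 * N $ 2 $ 1 + N $ 1 $ 2 * N $ 2 $ 2
      = ((a * x + b) * (c * x + d) + a * c * y\<^sup>2) / y"
    by (simp only: s(2))
  show ?thesis
    unfolding N_def[symmetric] iwasawa_eq_matrix_iff[OF N q] L X unfolding e
    using y s(1) by (simp add: real_sqrt_divide s_def[symmetric] minus_divide_left)
qed

text \<open>
  \<open>tangent_map f p v q w\<close>: the map \<open>f\<close> sends the point with coordinates \<open>p\<close> to the point with
  coordinates \<open>q\<close>, and its differential sends the tangent vector with components \<open>v\<close> to the one
  with components \<open>w\<close>.
\<close>

definition tangent_map ::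
    "(real^2^2 \<Rightarrow> real^2^2) \<Rightarrow> real^3 \<Rightarrow> real^3 \<Rightarrow> real^3 \<Rightarrow> real^3 \<Rightarrow> bool" where
  "tangent_map f p v q w \<longleftrightarrow> p \<in> iw_dom \<and> q \<in> iw_dom \<and> iwasawa q = f (iwasawa p) \<and>
     frechet_derivative iwasawa (at q) w =
     frechet_derivative f (at (iwasawa p)) (frechet_derivative iwasawa (at p) v)"

definition preserves_form :: "(real^2^2 \<Rightarrow> real^2^2) \<Rightarrow> (real^3 \<Rightarrow> real^3 \<Rightarrow> real) \<Rightarrow> bool" where
  "preserves_form f \<eta> \<longleftrightarrow> (\<forall>p v q w. tangent_map f p v q w \<longrightarrow> \<eta> q w = \<eta> p v)"

definition left_invariant_metric :: "(real^3 \<Rightarrow> real^3 \<Rightarrow> real^3 \<Rightarrow> real) \<Rightarrow> bool" where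
  "left_invariant_metric g \<longleftrightarrow> (\<forall>A\<in>SL2R. \<forall>p u v q u' v'.
     tangent_map ((**) A) p u q u' \<and> tangent_map ((**) A) p v q v' \<longrightarrow> g q u' v' = g p u v)"

definition left_invariant_field :: "(real^3 \<Rightarrow> real^3) \<Rightarrow> bool" where
  "left_invariant_field X \<longleftrightarrow> (\<forall>A\<in>SL2R. \<forall>p\<in>iw_dom. \<forall>q\<in>iw_dom.
     iwasawa q = A ** iwasawa p \<longrightarrow> tangent_map ((**) A) p (X p) q (X q))"

text \<open>
  The vector field \<open>X\<close> is the infinitesimal generator of the action of the one-parameter subgroup
  \<open>exp (t B)\<close> by left multiplication: its value at \<open>M\<close> is \<open>B M\<close>.
\<close>

definition generated_by :: "real^2^2 \<Rightarrow> (real^3 \<Rightarrow> real^3) \<Rightarrow> bool" where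
  "generated_by B X \<longleftrightarrow>
     (\<forall>p\<in>iw_dom. frechet_derivative iwasawa (at p) (X p) = B ** iwasawa p)"

text \<open>Closed subgroups of the general linear group; by Cartan's theorem these are Lie groups.\<close>

definition matrix_lie_group :: "(real^'n^'n) set \<Rightarrow> bool" where
  "matrix_lie_group G \<longleftrightarrow> mat 1 \<in> G \<and> (\<forall>A\<in>G. \<forall>B\<in>G. A ** B \<in> G) \<and>
     (\<forall>A\<in>G. invertible A \<and> matrix_inv A \<in> G) \<and>
     closedin (top_of_set {A. invertible A}) G"

text \<open>
  The connected Lie group \<open>G\<close> acts smoothly, transitively and effectively on \<open>SL2R\<close>, leaving \<open>\<eta>\<close>
  invariant.
\<close>

definition homogeneous_contact ::
    "(real^'n^'n) set \<Rightarrow> (real^'n^'n \<Rightarrow> real^2^2 \<Rightarrow> real^2^2) \<Rightarrow> (real^3 \<Rightarrow> real^3 \<Rightarrow> real) \<Rightarrow> bool" where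
  "homogeneous_contact G act \<eta> \<longleftrightarrow>
     matrix_lie_group G \<and> connected G \<and>
     smooth_on UNIV (\<lambda>(A, M). act A M) \<and>
     (\<forall>A\<in>G. \<forall>M\<in>SL2R. act A M \<in> SL2R) \<and>
     (\<forall>M\<in>SL2R. act (mat 1) M = M) \<and>
     (\<forall>A\<in>G. \<forall>B\<in>G. \<forall>M\<in>SL2R. act (A ** B) M = act A (act B M)) \<and>
     (\<forall>M\<in>SL2R. \<forall>N\<in>SL2R. \<exists>A\<in>G. act A M = N) \<and>
     (\<forall>A\<in>G. (\<forall>M\<in>SL2R. act A M = M) \<longrightarrow> A = mat 1) \<and>
     (\<forall>A\<in>G. preserves_form (act A) \<eta>)"

section \<open>The invariant one-forms, vector fields and tensors\<close>

definition lam1 :: "real \<Rightarrow> real^3 \<Rightarrow> real^3 \<Rightarrow> real" where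
  "lam1 \<alpha> p v = sqrt \<alpha> / p $ 2 * (cos (2 * p $ 3) * v $ 1 + sin (2 * p $ 3) * v $ 2)"

definition lam2 :: "real \<Rightarrow> real^3 \<Rightarrow> real^3 \<Rightarrow> real" where
  "lam2 \<alpha> p v = sqrt \<alpha> / p $ 2 * (- sin (2 * p $ 3) * v $ 1 + cos (2 * p $ 3) * v $ 2)"

definition lam3 :: "real \<Rightarrow> real^3 \<Rightarrow> real^3 \<Rightarrow> real" where
  "lam3 \<beta> p v = sqrt \<beta> * (v $ 1 / p $ 2 + 2 * v $ 3)"

definition L1 :: "real \<Rightarrow> real^3 \<Rightarrow> real^3" where
  "L1 \<alpha> p = (1 / sqrt \<alpha>) *\<^sub>R
     vector [p $ 2 * cos (2 * p $ 3), p $ 2 * sin (2 * p $ 3), - cos (2 * p $ 3) / 2]"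

definition L2 :: "real \<Rightarrow> real^3 \<Rightarrow> real^3" where
  "L2 \<alpha> p = (1 / sqrt \<alpha>) *\<^sub>R
     vector [- (p $ 2 * sin (2 * p $ 3)), p $ 2 * cos (2 * p $ 3), sin (2 * p $ 3) / 2]"

definition L3 :: "real \<Rightarrow> real^3 \<Rightarrow> real^3" where
  "L3 \<beta> p = (1 / (2 * sqrt \<beta>)) *\<^sub>R vector [0, 0, 1]"

definition Phi' :: "real^3 \<Rightarrow> real^3 \<Rightarrow> real^3" where
  "Phi' p v = v $ 1 *\<^sub>R vector [0, -1, 0] + v $ 2 *\<^sub>R vector [1, 0, - 1 / (2 * p $ 2)]"

definition gSL :: "real \<Rightarrow> real \<Rightarrow> real^3 \<Rightarrow> real^3 \<Rightarrow> real^3 \<Rightarrow> real" where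
  "gSL \<alpha> \<beta> p u v = lam1 \<alpha> p u * lam1 \<alpha> p v + lam2 \<alpha> p u * lam2 \<alpha> p v + lam3 \<beta> p u * lam3 \<beta> p v"

definition vstar :: "real \<Rightarrow> real^3 \<Rightarrow> real^3" where
  "vstar \<alpha> p = sqrt \<alpha> *\<^sub>R vector [1 - (p $ 1)\<^sup>2 + (p $ 2)\<^sup>2, - (2 * p $ 1 * p $ 2), - (p $ 2)]"

definition hstar :: "real \<Rightarrow> real^3 \<Rightarrow> real^3" where
  "hstar \<alpha> p = (4 * sqrt \<alpha>) *\<^sub>R vector [p $ 1, p $ 2, 0]"

definition wstar :: "real \<Rightarrow> real^3 \<Rightarrow> real^3" where
  "wstar \<beta> p = sqrt \<beta> *\<^sub>R vector [1 + (p $ 1)\<^sup>2 - (p $ 2)\<^sup>2, 2 * p $ 1 * p $ 2, p $ 2]"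

section \<open>The Siegel upper half-plane\<close>

definition X1 :: "(real^2) set" where
  "X1 = {z. z $ 2 > 0}"

definition gX1 :: "real \<Rightarrow> real^2 \<Rightarrow> real^2 \<Rightarrow> real^2 \<Rightarrow> real" where
  "gX1 \<alpha> z u v = \<alpha> * (u $ 1 * v $ 1 + u $ 2 * v $ 2) / (z $ 2)\<^sup>2"

definition J_X1 :: "real^2 \<Rightarrow> real^2 \<Rightarrow> real^2" where
  "J_X1 z v = vector [- (v $ 2), v $ 1]"

text \<open>The projection \<open>(x, y, \<theta>) \<mapsto> (x, y)\<close>, which is linear and so is its own differential.\<close>

definition proj_X1 :: "real^3 \<Rightarrow> real^2" where
  "proj_X1 p = vector [p $ 1, p $ 2]"

definition l01 :: "real \<Rightarrow> real^2 \<Rightarrow> real^2" where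
  "l01 \<alpha> z = (z $ 2 / sqrt \<alpha>) *\<^sub>R vector [1, 0]"

definition l02 :: "real \<Rightarrow> real^2 \<Rightarrow> real^2" where
  "l02 \<alpha> z = (z $ 2 / sqrt \<alpha>) *\<^sub>R vector [0, 1]"

text \<open>
  No nonzero vector field on the half-plane is invariant under all of SL(2,R).  The fields above are
  invariant under the upper triangular matrices, which act simply transitively, modulo sign, by
  \<open>z \<mapsto> a z + b\<close> with \<open>a > 0\<close>.
\<close>

definition affine_X1 :: "real \<Rightarrow> real \<Rightarrow> real^2 \<Rightarrow> real^2" where
  "affine_X1 a b z = vector [a * z $ 1 + b, a * z $ 2]"

definition affine_invariant_field :: "(real^2 \<Rightarrow> real^2) \<Rightarrow> bool" where
  "affine_invariant_field X \<longleftrightarrow> (\<forall>a b. a > 0 \<longrightarrow>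
     (\<forall>z\<in>X1. frechet_derivative (affine_X1 a b) (at z) (X z) = X (affine_X1 a b z)))"

end

theory Submission
  imports Defs
begin

text \<open>
  Everything about left invariance comes from the Maurer-Cartan form: with \<open>M = iwasawa p\<close>, the
  differential of \<open>iwasawa\<close> is \<open>v \<mapsto> M ** maurer_cartan p v\<close>, and \<open>lam1\<close>, \<open>lam2\<close>, \<open>lam3\<close> are linear
  combinations, with constant coefficients, of the entries of \<open>maurer_cartan p v\<close>
  (\<open>iwasawa_has_derivative\<close>, \<open>lam_eq_maurer_cartan\<close>).  Since \<open>M\<inverse> dM\<close> does not change when \<open>M\<close> is
  multiplied from the left by a constant matrix, the one-forms, the metric and the dual frame are
  left invariant, and left translations act transitively and preserve \<open>lam3\<close>.  Conversely,
  \<open>M ** maurer_cartan p X = B ** M\<close> is the equation for the generator of \<open>exp (t B)\<close>; solving it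
  for all traceless \<open>B\<close> gives the span of \<open>vstar\<close>, \<open>hstar\<close>, \<open>wstar\<close> (\<open>generated_by_star\<close>).

  The metric also admits the Killing field \<open>L3\<close>, because right multiplication by rotations rotates
  \<open>lam1\<close>, \<open>lam2\<close> and fixes \<open>lam3\<close>.  That there is no further one is an overdetermined system of
  first order equations for the components \<open>a\<close>, \<open>b\<close>, \<open>c\<close> of the field in the frame
  \<open>y \<partial>\<^sub>x - \<partial>\<^sub>\<theta> / 2\<close>, \<open>y \<partial>\<^sub>y\<close>, \<open>\<partial>\<^sub>\<theta> / 2\<close>.  It forces \<open>b\<close> not to depend on \<open>y\<close> and \<open>c\<close> not to depend on
  \<open>\<theta>\<close>; separating the variables then leaves four constants of integration
  (\<open>killing_system_solution\<close>).  The step that excludes further solutions is the division by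
  \<open>\<alpha> / \<beta> + 1\<close>, which is nonzero because both constants are positive.

  The contact statements are computations in the same frame: \<open>d lam3\<close> and \<open>g(\<cdot>, Phi' \<cdot>)\<close> are both
  constant multiples of the hyperbolic area form \<open>dx \<and> dy / y\<^sup>2\<close>, and the bracket of the two
  horizontal fields is vertical.  The two multiples agree up to the factor \<open>2 \<alpha> / sqrt \<beta>\<close>, which is
  why the contact metric axioms hold literally only if \<open>2 \<alpha> = sqrt \<beta>\<close>.

  Normality is integrability on the cone, which has the explicit global holomorphic coordinates
  \<open>y + i x\<close> and \<open>2 sqrt \<beta> \<theta> + i (ln r + sqrt \<beta> ln y)\<close> (\<open>normal_SL2R\<close>).  Together with the identity
  between \<open>d(r\<^sup>2 lam3)\<close> and the cone metric, valid for every contact metric structure, this makes the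
  cone Kaehler when \<open>2 \<alpha> = sqrt \<beta>\<close>.
\<close>

section \<open>Smooth maps\<close>

lemma frechet_derivative_eq:
  "(f has_derivative f') (at p) \<Longrightarrow> frechet_derivative f (at p) = f'"
  by (rule frechet_derivative_at[symmetric])

lemma frechet_derivative_eq_on_open:
  assumes "(g has_derivative g') (at p)" "open S" "p \<in> S" "\<And>q. q \<in> S \<Longrightarrow> g q = f q"
  shows "frechet_derivative f (at p) = g'"
  using has_derivative_transform_within_open[OF assms] by (rule frechet_derivative_eq)

text \<open>
  The Frechet derivative is a choice among the derivatives, and on an open set both maps have the
  same ones.
\<close>

lemma frechet_derivative_cong_open:
  assumes "open S" "p \<in> S" "\<And>q. q \<in> S \<Longrightarrow> f q = g q"
  shows "frechet_derivative f (at p) = frechet_derivative g (at p)"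
proof -
  have "(f has_derivative f') (at p) \<longleftrightarrow> (g has_derivative f') (at p)" for f'
    using has_derivative_transform_within_open[OF _ assms(1,2)] assms(3) by metis
  then show ?thesis by (simp add: frechet_derivative_def)
qed

text \<open>
  The derivatives in \<open>Ck_on\<close> are taken in the whole space, so openness of \<open>S\<close> is what makes them
  depend on the values on \<open>S\<close> only.
\<close>

lemma Ck_on_cong:
  assumes "open S" "\<And>p. p \<in> S \<Longrightarrow> f p = g p" "Ck_on k S f"
  shows "Ck_on k S g"
  using assms(2,3)
proof (induction k arbitrary: f g)
  case 0
  then show ?case by (simp cong: continuous_on_cong)
next
  case (Suc k)
  have d: "(g has_derivative frechet_derivative f (at p)) (at p)" if "p \<in> S" for p
    using Suc.prems that assms(1)
    by (metis Ck_on.simps(2) frechet_derivative_works has_derivative_transform_within_open)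
  have "Ck_on k S (\<lambda>p. frechet_derivative g (at p) v)" for v
    using Suc.IH[of "\<lambda>p. frechet_derivative f (at p) v"] Suc.prems frechet_derivative_eq[OF d]
    by simp
  with d show ?case by (auto simp: differentiable_def)
qed

lemma Ck_on_Suc_imp: "Ck_on (Suc k) S f \<Longrightarrow> Ck_on k S f"
proof (induction k arbitrary: f)
  case 0
  then show ?case
    by (auto simp: continuous_on_eq_continuous_at differentiable_imp_continuous_within
        continuous_at_imp_continuous_on)
qed (simp del: Ck_on.simps(1))

text \<open>
  The induction step of all the closure properties below: any formula for the derivative on \<open>S\<close> may
  replace \<open>frechet_derivative\<close>.
\<close>

lemma Ck_on_SucI:
  assumes "open S" "\<And>p. p \<in> S \<Longrightarrow> (f has_derivative f' p) (at p)"
    and "\<And>v. Ck_on k S (\<lambda>p. f' p v)"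
  shows "Ck_on (Suc k) S f"
proof -
  have "Ck_on k S (\<lambda>p. frechet_derivative f (at p) v)" for v
    using assms(3)[of v] by (rule Ck_on_cong[OF assms(1), rotated]) (simp add: frechet_derivative_eq[OF assms(2)])
  with assms(2) show ?thesis by (auto simp: differentiable_def)
qed

lemma Ck_on_Suc_has_derivative:
  "Ck_on (Suc k) S f \<Longrightarrow> p \<in> S \<Longrightarrow> (f has_derivative frechet_derivative f (at p)) (at p)"
  by (simp add: frechet_derivative_works)

lemma Ck_on_add:
  assumes "open S"
  shows "Ck_on k S f \<Longrightarrow> Ck_on k S g \<Longrightarrow> Ck_on k S (\<lambda>p. f p + g p)"
proof (induction k arbitrary: f g)
  case 0
  then show ?case by (simp add: continuous_on_add)
next
  case (Suc k)
  show ?case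
    by (rule Ck_on_SucI[OF assms has_derivative_add[OF Ck_on_Suc_has_derivative[OF Suc.prems(1)]
            Ck_on_Suc_has_derivative[OF Suc.prems(2)]]]) (use Suc in auto)
qed

lemma Ck_on_bounded_linear:
  assumes "open S" "bounded_linear L"
  shows "Ck_on k S f \<Longrightarrow> Ck_on k S (\<lambda>p. L (f p))"
proof (induction k arbitrary: f)
  case 0
  then show ?case by (simp add: bounded_linear.continuous_on[OF assms(2)])
next
  case (Suc k)
  show ?case
    by (rule Ck_on_SucI[OF assms(1) bounded_linear.has_derivative[OF assms(2)
            Ck_on_Suc_has_derivative[OF Suc.prems]]]) (use Suc in auto)
qed

lemma Ck_on_bounded_bilinear:
  assumes "open S" "bounded_bilinear h"
  shows "Ck_on k S f \<Longrightarrow> Ck_on k S g \<Longrightarrow> Ck_on k S (\<lambda>p. h (f p) (g p))"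
proof (induction k arbitrary: f g)
  case 0
  then show ?case by (simp add: bounded_bilinear.continuous_on[OF assms(2)])
next
  case (Suc k)
  show ?case
    by (rule Ck_on_SucI[OF assms(1) bounded_bilinear.FDERIV[OF assms(2)
            Ck_on_Suc_has_derivative[OF Suc.prems(1)] Ck_on_Suc_has_derivative[OF Suc.prems(2)]]])
      (assumption | (intro Ck_on_add[OF assms(1)] Suc.IH Suc.prems[THEN Ck_on_Suc_imp];
        use Suc.prems in simp))+
qed

lemma Ck_on_const: "Ck_on k S (\<lambda>p. c)"
  by (induction k arbitrary: c) simp_all

lemma smooth_on_const [simp]: "smooth_on S (\<lambda>p. c)"
  by (simp add: smooth_on_def Ck_on_const)

lemma smooth_on_cong:
  "open S \<Longrightarrow> (\<And>p. p \<in> S \<Longrightarrow> f p = g p) \<Longrightarrow> smooth_on S f \<Longrightarrow> smooth_on S g"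
  unfolding smooth_on_def using Ck_on_cong by blast

lemma smooth_on_linear:
  assumes "bounded_linear L"
  shows "smooth_on S L"
proof -
  have "Ck_on k S L" for k
  proof (cases k)
    case 0
    then show ?thesis by (simp add: linear_continuous_on[OF assms])
  next
    case (Suc k)
    have "frechet_derivative L (at p) = L" "L differentiable at p" for p
      using bounded_linear_imp_has_derivative[OF assms]
      by (auto simp: differentiable_def intro: frechet_derivative_eq)
    with Suc show ?thesis
      by (simp add: Ck_on_const)
  qed
  then show ?thesis by (simp add: smooth_on_def)
qed

lemma smooth_on_add:
  "open S \<Longrightarrow> smooth_on S f \<Longrightarrow> smooth_on S g \<Longrightarrow> smooth_on S (\<lambda>p. f p + g p)"
  by (simp add: smooth_on_def Ck_on_add)

lemma smooth_on_bounded_linear: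
  "bounded_linear L \<Longrightarrow> open S \<Longrightarrow> smooth_on S f \<Longrightarrow> smooth_on S (\<lambda>p. L (f p))"
  by (simp add: smooth_on_def Ck_on_bounded_linear)

lemma smooth_on_bounded_bilinear:
  "bounded_bilinear h \<Longrightarrow> open S \<Longrightarrow> smooth_on S f \<Longrightarrow> smooth_on S g \<Longrightarrow>
    smooth_on S (\<lambda>p. h (f p) (g p))"
  by (simp add: smooth_on_def Ck_on_bounded_bilinear)

lemmas smooth_on_mult = smooth_on_bounded_bilinear[OF bounded_bilinear_mult]
lemmas smooth_on_scaleR = smooth_on_bounded_bilinear[OF bounded_bilinear_scaleR]
lemmas smooth_on_minus = smooth_on_bounded_linear[OF bounded_linear_minus[OF bounded_linear_ident]]
lemmas smooth_on_vec_nth = smooth_on_bounded_linear[OF bounded_linear_vec_nth]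

lemma smooth_on_diff:
  "open S \<Longrightarrow> smooth_on S f \<Longrightarrow> smooth_on S g \<Longrightarrow> smooth_on S (\<lambda>p. f p - g p)"
  using smooth_on_add[of S f "\<lambda>p. - g p"] smooth_on_minus by auto

lemma smooth_on_sum:
  "open S \<Longrightarrow> (\<And>i. i \<in> I \<Longrightarrow> smooth_on S (f i)) \<Longrightarrow> smooth_on S (\<lambda>p. \<Sum>i\<in>I. f i p)"
  by (induction I rule: infinite_finite_induct) (auto intro: smooth_on_add)

lemma smooth_on_power:
  fixes f :: "_ \<Rightarrow> 'b::real_normed_algebra_1"
  shows "open S \<Longrightarrow> smooth_on S f \<Longrightarrow> smooth_on S (\<lambda>p. f p ^ n)"
  by (induction n) (auto intro: smooth_on_mult)

text \<open>
  The derivative of \<open>1 / f\<close> is a polynomial in \<open>1 / f\<close> and the derivative of \<open>f\<close>, so \<open>1 / f\<close> is as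
  often differentiable as \<open>f\<close>.
\<close>

lemma smooth_on_inverse:
  fixes f :: "_ \<Rightarrow> real"
  assumes "open S" "smooth_on S f" "\<And>p. p \<in> S \<Longrightarrow> f p \<noteq> 0"
  shows "smooth_on S (\<lambda>p. inverse (f p))"
proof -
  have "Ck_on k S (\<lambda>p. inverse (f p))" for k
  proof (induction k)
    case 0
    then show ?case
      using assms(2,3) by (auto simp: smooth_on_def intro!: continuous_on_inverse dest: spec[of _ 0])
  next
    case (Suc k)
    have f: "Ck_on (Suc k) S f"
      using assms(2) by (simp add: smooth_on_def del: Ck_on.simps)
    show ?case
      by (rule Ck_on_SucI[OF assms(1) Deriv.has_derivative_inverse[OF assms(3) Ck_on_Suc_has_derivative[OF f]]])
        (assumption | (intro Ck_on_bounded_linear[OF assms(1) bounded_linear_minus[OF bounded_linear_ident]]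
          Ck_on_bounded_bilinear[OF assms(1) bounded_bilinear_mult] Suc;
          use f in simp))+
  qed
  then show ?thesis by (simp add: smooth_on_def)
qed

lemma smooth_on_divide:
  fixes f g :: "_ \<Rightarrow> real"
  shows "open S \<Longrightarrow> smooth_on S f \<Longrightarrow> smooth_on S g \<Longrightarrow> (\<And>p. p \<in> S \<Longrightarrow> g p \<noteq> 0) \<Longrightarrow>
    smooth_on S (\<lambda>p. f p / g p)"
  unfolding divide_inverse by (intro smooth_on_mult smooth_on_inverse)

text \<open>
  Proved together, since each is the derivative of the other up to sign.
\<close>

lemma smooth_on_sin_cos:
  fixes f :: "_ \<Rightarrow> real"
  assumes "open S" "smooth_on S f"
  shows "smooth_on S (\<lambda>p. sin (f p))" and "smooth_on S (\<lambda>p. cos (f p))"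
proof -
  have "Ck_on k S (\<lambda>p. sin (f p)) \<and> Ck_on k S (\<lambda>p. cos (f p))" for k
  proof (induction k)
    case 0
    then show ?case
      using assms(2) by (auto simp: smooth_on_def intro!: continuous_intros dest: spec[of _ 0])
  next
    case (Suc k)
    have f: "Ck_on (Suc k) S f"
      using assms(2) by (simp add: smooth_on_def del: Ck_on.simps)
    note d = Ck_on_Suc_has_derivative[OF f]
    have "Ck_on (Suc k) S (\<lambda>p. sin (f p))"
      by (rule Ck_on_SucI[OF assms(1) has_derivative_sin[OF d]])
        (assumption | (intro Ck_on_bounded_bilinear[OF assms(1) bounded_bilinear_mult] Suc[THEN conjunct2];
          use f in simp))+
    moreover have "Ck_on (Suc k) S (\<lambda>p. cos (f p))"
      by (rule Ck_on_SucI[OF assms(1) has_derivative_cos[OF d]])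
        (assumption | (intro Ck_on_bounded_bilinear[OF assms(1) bounded_bilinear_mult]
          Ck_on_bounded_linear[OF assms(1) bounded_linear_minus[OF bounded_linear_ident]]
          Suc[THEN conjunct1];
          use f in simp))+
    ultimately show ?case by blast
  qed
  then show "smooth_on S (\<lambda>p. sin (f p))" and "smooth_on S (\<lambda>p. cos (f p))"
    by (simp_all add: smooth_on_def)
qed

lemma smooth_on_ln:
  fixes f :: "_ \<Rightarrow> real"
  assumes "open S" "smooth_on S f" "\<And>p. p \<in> S \<Longrightarrow> f p > 0"
  shows "smooth_on S (\<lambda>p. ln (f p))"
proof -
  have ne: "f p \<noteq> 0" if "p \<in> S" for p
    using assms(3)[OF that] by simp
  have "Ck_on k S (\<lambda>p. ln (f p))" for k
  proof (cases k)
    case 0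
    then show ?thesis
      using assms(2) ne by (auto simp: smooth_on_def intro!: continuous_on_ln dest: spec[of _ 0])
  next
    case (Suc k)
    have f: "Ck_on (Suc k) S f"
      using assms(2) by (simp add: smooth_on_def del: Ck_on.simps)
    have i: "Ck_on k S (\<lambda>p. inverse (f p))"
      using smooth_on_inverse[OF assms(1,2) ne] by (simp add: smooth_on_def)
    have "Ck_on (Suc k) S (\<lambda>p. ln (f p))"
      by (rule Ck_on_SucI[OF assms(1) has_derivative_ln[OF assms(3) Ck_on_Suc_has_derivative[OF f]]])
        (assumption | (intro Ck_on_bounded_bilinear[OF assms(1) bounded_bilinear_mult] i;
          use f in simp))+
    with Suc show ?thesis by blast
  qed
  then show ?thesis by (simp add: smooth_on_def)
qed

lemma bounded_linear_axis: "bounded_linear (\<lambda>a::'b::real_normed_vector. axis i a :: 'b^'n)"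
  by (rule bounded_linear_intro[where K = 1])
    (auto simp: axis_def vec_eq_iff norm_vec_def L2_set_def power2_eq_square if_distrib[of norm]
      if_distrib[of "\<lambda>a. a * a"] cong: if_cong)

lemma smooth_on_vec:
  fixes f :: "_ \<Rightarrow> 'b::real_normed_vector^'n"
  assumes "open S" "\<And>i. smooth_on S (\<lambda>p. f p $ i)"
  shows "smooth_on S f"
proof -
  have "f p = (\<Sum>i\<in>UNIV. axis i (f p $ i))" for p
    by (simp add: vec_eq_iff axis_def if_distrib cong: if_cong)
  then have "f = (\<lambda>p. \<Sum>i\<in>UNIV. axis i (f p $ i))" by blast
  moreover have "smooth_on S \<dots>"
    by (intro smooth_on_sum smooth_on_bounded_linear[OF bounded_linear_axis] assms)
  ultimately show ?thesis by simp
qed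

lemma smooth_on_Pair:
  assumes "open S" "smooth_on S f" "smooth_on S g"
  shows "smooth_on S (\<lambda>p. (f p, g p))"
proof -
  have "bounded_linear (\<lambda>a. (a, 0))" "bounded_linear (\<lambda>a. (0, a))"
    by (intro bounded_linear_Pair bounded_linear_ident bounded_linear_zero)+
  from smooth_on_add[OF assms(1) smooth_on_bounded_linear[OF this(1) assms(1,2)]
      smooth_on_bounded_linear[OF this(2) assms(1,3)]]
  show ?thesis by simp
qed

lemmas smooth_on_intros =
  smooth_on_const smooth_on_linear[OF bounded_linear_vec_nth] smooth_on_linear[OF bounded_linear_fst]
  smooth_on_linear[OF bounded_linear_snd] smooth_on_linear[OF bounded_linear_ident]
  smooth_on_add smooth_on_diff smooth_on_minus smooth_on_mult
  smooth_on_scaleR smooth_on_power smooth_on_divide smooth_on_sin_cos smooth_on_ln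
  smooth_on_Pair

lemma smooth_on_Complex:
  assumes "open S" "smooth_on S f" "smooth_on S g"
  shows "smooth_on S (\<lambda>p. Complex (f p) (g p))"
proof -
  have "Complex a b = a *\<^sub>R 1 + b *\<^sub>R \<i>" for a b
    by (simp add: complex_eq_iff)
  then show ?thesis
    using assms by (simp add: smooth_on_intros)
qed

lemma smooth_on_vector_3:
  fixes f g h :: "_ \<Rightarrow> real"
  assumes "open S" "smooth_on S f" "smooth_on S g" "smooth_on S h"
  shows "smooth_on S (\<lambda>p. vector [f p, g p, h p] :: real^3)"
proof (rule smooth_on_vec[OF assms(1)])
  show "smooth_on S (\<lambda>p. (vector [f p, g p, h p] :: real^3) $ i)" for i
    using exhaust_3[of i] assms by auto
qed

lemma smooth_on_compose_linear:
  assumes "bounded_linear L" "open T" "\<And>c. c \<in> T \<Longrightarrow> L c \<in> S" "smooth_on S f"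
  shows "smooth_on T (\<lambda>c. f (L c))"
proof -
  have "Ck_on k S f \<Longrightarrow> Ck_on k T (\<lambda>c. f (L c))" for k
  proof (induction k arbitrary: f)
    case 0
    then show ?case
      using assms(3) by (auto intro!: continuous_on_compose2[OF _ linear_continuous_on[OF assms(1)]])
  next
    case (Suc k)
    have "((\<lambda>c. f (L c)) has_derivative (\<lambda>v. frechet_derivative f (at (L c)) (L v))) (at c)"
      if "c \<in> T" for c
      by (rule has_derivative_compose[OF bounded_linear_imp_has_derivative[OF assms(1)]
            Ck_on_Suc_has_derivative[OF Suc.prems assms(3)[OF that]]])
    then show ?case
      by (rule Ck_on_SucI[OF assms(2)]) (use Suc in auto)
  qed
  with assms(4) show ?thesis by (simp add: smooth_on_def)
qed

lemma has_derivative_vecI: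
  fixes f :: "'a::real_normed_vector \<Rightarrow> 'b::real_normed_vector^'n"
  assumes "\<And>i. ((\<lambda>p. f p $ i) has_derivative (\<lambda>v. f' v $ i)) F"
  shows "(f has_derivative f') F"
proof -
  have e: "x = (\<Sum>i\<in>UNIV. axis i (x $ i))" for x :: "'b^'n"
    by (simp add: vec_eq_iff axis_def if_distrib cong: if_cong)
  have "((\<lambda>p. \<Sum>i\<in>UNIV. axis i (f p $ i) :: 'b^'n) has_derivative (\<lambda>v. \<Sum>i\<in>UNIV. axis i (f' v $ i))) F"
    by (intro has_derivative_sum bounded_linear.has_derivative[OF bounded_linear_axis] assms)
  then show ?thesis
    by (simp flip: e)
qed

lemmas has_derivative_nth [derivative_intros] =
  bounded_linear.has_derivative[OF bounded_linear_vec_nth]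

lemma has_derivative_Complex:
  assumes "(f has_derivative f') F" "(g has_derivative g') F"
  shows "((\<lambda>p. Complex (f p) (g p)) has_derivative (\<lambda>v. Complex (f' v) (g' v))) F"
proof -
  have "Complex a b = a *\<^sub>R 1 + b *\<^sub>R \<i>" for a b
    by (simp add: complex_eq_iff)
  then show ?thesis
    using assms by (simp add: has_derivative_add has_derivative_scaleR_left)
qed

section \<open>The Maurer-Cartan form in Iwasawa coordinates\<close>

lemma iw_domD: "p \<in> iw_dom \<Longrightarrow> p $ 2 > 0"
  by (simp add: iw_dom_def)

lemma open_iw_dom: "open iw_dom"
  unfolding iw_dom_def
  by (intro open_Collect_less continuous_intros)

text \<open>
  The matrix \<open>M\<inverse> dM\<close> for \<open>M = N A K\<close> in Iwasawa coordinates.  It equals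
  \<open>K\<inverse> (A\<inverse> (N\<inverse> dN) A + A\<inverse> dA) K + K\<inverse> dK\<close>, where the bracket has the rows
  \<open>(dy / 2y, dx / y)\<close> and \<open>(0, - dy / 2y)\<close>.  Conjugation by \<open>K\<close> rotates the symmetric part by \<open>2 \<theta>\<close>,
  which gives \<open>P\<close> and \<open>Q\<close>, and fixes the antisymmetric part, which together with \<open>K\<inverse> dK\<close> gives \<open>R\<close>.
\<close>

definition maurer_cartan :: "real^3 \<Rightarrow> real^3 \<Rightarrow> real^2^2" where
  "maurer_cartan p v =
     (let P = (cos (2 * p $ 3) * v $ 2 - sin (2 * p $ 3) * v $ 1) / (2 * p $ 2);
          Q = (cos (2 * p $ 3) * v $ 1 + sin (2 * p $ 3) * v $ 2) / (2 * p $ 2);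
          R = v $ 1 / (2 * p $ 2) + v $ 3
      in vector [vector [P, Q + R], vector [Q - R, - P]])"

lemma matrix_2_eqI:
  fixes M N :: "real^2^2"
  assumes "M $ 1 $ 1 = N $ 1 $ 1" "M $ 1 $ 2 = N $ 1 $ 2" "M $ 2 $ 1 = N $ 2 $ 1" "M $ 2 $ 2 = N $ 2 $ 2"
  shows "M = N"
  using assms by (simp add: vec_eq_iff forall_2)

lemma vec_3_eqI: "u $ 1 = v $ 1 \<Longrightarrow> u $ 2 = v $ 2 \<Longrightarrow> u $ 3 = v $ 3 \<Longrightarrow> u = (v :: 'a^3)"
  by (simp add: vec_eq_iff forall_3)

lemma matrix_mult_2:
  fixes M N :: "real^2^2"
  shows "(M ** N) $ i $ j = M $ i $ 1 * N $ 1 $ j + M $ i $ 2 * N $ 2 $ j"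
  by (simp add: matrix_matrix_mult_def sum_2)

lemma iwasawa_has_derivative:
  assumes p: "p \<in> iw_dom"
  shows "(iwasawa has_derivative (\<lambda>v. iwasawa p ** maurer_cartan p v)) (at p)"
proof -
  define s r c t X where "s = sqrt (p $ 2)" and "r = inverse s" and "c = cos (p $ 3)"
    and "t = sin (p $ 3)" and "X = p $ 1 * r"
  \<comment> \<open>In terms of \<open>s\<close>, \<open>X\<close>, \<open>a\<close> and \<open>b\<close> no denominators occur, and polynomial arithmetic suffices.\<close>
  define a b where "a v = v $ 1 / (2 * p $ 2)" and "b v = v $ 2 / (2 * p $ 2)" for v :: "real^3"
  have y: "p $ 2 > 0" and s: "s \<noteq> 0" and sp: "s > 0" and ys: "p $ 2 = s * s"
    using iw_domD[OF p] by (simp_all add: s_def)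
  have ct: "t * t = 1 - c * c"
    using sin_cos_squared_add[of "p $ 3"] by (simp add: c_def t_def power2_eq_square)
  have dbl: "cos (2 * p $ 3) = 2 * (c * c) - 1" "sin (2 * p $ 3) = 2 * t * c"
    by (simp_all add: cos_double_cos sin_double c_def t_def power2_eq_square)
  have d_s: "((\<lambda>p. sqrt (p $ 2)) has_derivative (\<lambda>v. s * b v)) (at p)"
    by (rule derivative_eq_intros refl y)+ (use sp in \<open>simp add: b_def ys field_simps\<close>)
  have d_r: "((\<lambda>p. inverse (sqrt (p $ 2))) has_derivative (\<lambda>v. - (r * b v))) (at p)"
    using s by (rule_tac has_derivative_eq_rhs[OF Deriv.has_derivative_inverse[OF _ d_s]])
      (auto simp: s_def r_def)
  have d_x: "((\<lambda>p. p $ 1) has_derivative (\<lambda>v. 2 * (s * s) * a v)) (at p)"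
    by (rule derivative_eq_intros refl)+ (use s ys in \<open>simp add: a_def field_simps\<close>)
  have d_X: "((\<lambda>p. p $ 1 * inverse (sqrt (p $ 2))) has_derivative (\<lambda>v. 2 * s * a v - X * b v)) (at p)"
    by (rule has_derivative_eq_rhs[OF has_derivative_mult[OF d_x d_r]])
      (use s in \<open>auto simp: X_def r_def fun_eq_iff algebra_simps simp flip: s_def\<close>)
  have d_t: "((\<lambda>p. sin (p $ 3)) has_derivative (\<lambda>v. c * v $ 3)) (at p)"
    by (rule derivative_eq_intros refl)+ (simp add: c_def mult.commute)
  have d_c: "((\<lambda>p. cos (p $ 3)) has_derivative (\<lambda>v. - (t * v $ 3))) (at p)"
    by (rule derivative_eq_intros refl)+ (simp add: t_def mult.commute)
  note d = has_derivative_mult has_derivative_add has_derivative_diff has_derivative_minus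
    d_s d_r d_X d_t d_c
  define P Q R where "P v = (2 * (c * c) - 1) * b v - 2 * t * c * a v"
    and "Q v = (2 * (c * c) - 1) * a v + 2 * t * c * b v" and "R v = a v + v $ 3" for v
  have mc: "maurer_cartan p v = vector [vector [P v, Q v + R v], vector [Q v - R v, - P v]]" for v
    by (simp add: maurer_cartan_def Let_def dbl P_def Q_def R_def a_def b_def
        diff_divide_distrib add_divide_distrib)
  note e = matrix_mult_2 mc vector_2 iwasawa_entries divide_inverse
  note f = s_def[symmetric] r_def[symmetric] c_def[symmetric] t_def[symmetric] X_def[symmetric]
  have "((\<lambda>p. iwasawa p $ i $ j) has_derivative (\<lambda>v. (iwasawa p ** maurer_cartan p v) $ i $ j)) (at p)" for i j
  proof -
    have "((\<lambda>p. iwasawa p $ 1 $ 1) has_derivative (\<lambda>v. (iwasawa p ** maurer_cartan p v) $ 1 $ 1)) (at p)"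
      unfolding e
      by (rule has_derivative_eq_rhs, (rule d)+, unfold f P_def Q_def R_def, rule ext) (use ct in algebra)
    moreover have "((\<lambda>p. iwasawa p $ 1 $ 2) has_derivative (\<lambda>v. (iwasawa p ** maurer_cartan p v) $ 1 $ 2)) (at p)"
      unfolding e
      by (rule has_derivative_eq_rhs, (rule d)+, unfold f P_def Q_def R_def, rule ext) (use ct in algebra)
    moreover have "((\<lambda>p. iwasawa p $ 2 $ 1) has_derivative (\<lambda>v. (iwasawa p ** maurer_cartan p v) $ 2 $ 1)) (at p)"
      unfolding e
      by (rule has_derivative_eq_rhs, (rule d)+, unfold f P_def Q_def R_def, rule ext) (use ct in algebra)
    moreover have "((\<lambda>p. iwasawa p $ 2 $ 2) has_derivative (\<lambda>v. (iwasawa p ** maurer_cartan p v) $ 2 $ 2)) (at p)"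
      unfolding e
      by (rule has_derivative_eq_rhs, (rule d)+, unfold f P_def Q_def R_def, rule ext) (use ct in algebra)
    ultimately show ?thesis
      using exhaust_2[of i] exhaust_2[of j] by auto
  qed
  then show ?thesis
    by (intro has_derivative_vecI)
qed

lemmas frechet_iwasawa = frechet_derivative_eq[OF iwasawa_has_derivative]

lemma iwasawa_left_cancel:
  assumes "p \<in> iw_dom" "iwasawa p ** M = iwasawa p ** N"
  shows "M = N"
proof -
  have "invertible (iwasawa p)"
    using iwasawa_in_SL2R[OF assms(1)] by (simp add: SL2R_def invertible_det_nz)
  then obtain B where "B ** iwasawa p = mat 1"
    by (auto simp: invertible_def)
  then show ?thesis
    by (metis assms(2) matrix_mul_assoc matrix_mul_lid)
qed

lemma lam_eq_maurer_cartan: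
  assumes "p \<in> iw_dom"
  shows "lam1 \<alpha> p v = sqrt \<alpha> * (maurer_cartan p v $ 1 $ 2 + maurer_cartan p v $ 2 $ 1)"
    and "lam2 \<alpha> p v = sqrt \<alpha> * (2 * maurer_cartan p v $ 1 $ 1)"
    and "lam3 \<beta> p v = sqrt \<beta> * (maurer_cartan p v $ 1 $ 2 - maurer_cartan p v $ 2 $ 1)"
  using iw_domD[OF assms]
  by (simp_all add: lam1_def lam2_def lam3_def maurer_cartan_def Let_def field_simps)

lemma lam_inject:
  assumes "p \<in> iw_dom" "lam1 1 p v = lam1 1 p w" "lam2 1 p v = lam2 1 p w" "lam3 1 p v = lam3 1 p w"
  shows "v = w"
proof -
  define c s where "c = cos (2 * p $ 3)" and "s = sin (2 * p $ 3)"
  have cs: "c * c + s * s = 1"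
    using sin_cos_squared_add[of "2 * p $ 3"] by (simp add: c_def s_def power2_eq_square)
  have e: "c * v $ 1 + s * v $ 2 = c * w $ 1 + s * w $ 2"
    "c * v $ 2 - s * v $ 1 = c * w $ 2 - s * w $ 1"
    "v $ 1 / p $ 2 + 2 * v $ 3 = w $ 1 / p $ 2 + 2 * w $ 3"
    using assms(2-4) iw_domD[OF assms(1)]
    by (simp_all add: lam1_def lam2_def lam3_def c_def s_def)
  have "v $ 1 = w $ 1" "v $ 2 = w $ 2"
    using e(1,2) cs by algebra+
  with e(3) show ?thesis
    by (intro vec_3_eqI) simp_all
qed

lemma maurer_cartan_inject:
  assumes "p \<in> iw_dom" "maurer_cartan p v = maurer_cartan p w"
  shows "v = w"
  by (rule lam_inject[OF assms(1)]) (simp_all add: lam_eq_maurer_cartan assms)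

section \<open>Left invariance\<close>

lemma bounded_bilinear_matrix_mult_2: "bounded_bilinear ((**) :: real^2^2 \<Rightarrow> real^2^2 \<Rightarrow> real^2^2)"
  unfolding bilinear_conv_bounded_bilinear[symmetric] bilinear_def linear_iff
  by (simp add: vec_eq_iff matrix_mult_2 algebra_simps)

lemma frechet_matrix_mult: "frechet_derivative ((**) (A :: real^2^2)) (at (M :: real^2^2)) = (**) A"
  by (rule frechet_derivative_eq[OF bounded_linear_imp_has_derivative[OF
      bounded_bilinear.bounded_linear_right[OF bounded_bilinear_matrix_mult_2]]])

text \<open>
  Left translation by \<open>A\<close> fixes the Maurer-Cartan form: \<open>(A M)\<inverse> d(A M) = M\<inverse> dM\<close>.
\<close>

lemma tangent_map_mult_iff:
  "tangent_map ((**) A) p v q w \<longleftrightarrow>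
    p \<in> iw_dom \<and> q \<in> iw_dom \<and> iwasawa q = A ** iwasawa p \<and> maurer_cartan q w = maurer_cartan p v"
proof -
  have "iwasawa q ** maurer_cartan q w = A ** (iwasawa p ** maurer_cartan p v) \<longleftrightarrow>
      maurer_cartan q w = maurer_cartan p v"
    if "q \<in> iw_dom" "iwasawa q = A ** iwasawa p"
    using iwasawa_left_cancel[OF that(1)] by (auto simp: matrix_mul_assoc simp flip: that(2))
  then show ?thesis
    unfolding tangent_map_def frechet_matrix_mult by (auto simp: frechet_iwasawa)
qed

lemma tangent_map_lam:
  assumes "tangent_map ((**) A) p v q w"
  shows "lam1 \<alpha> q w = lam1 \<alpha> p v" "lam2 \<alpha> q w = lam2 \<alpha> p v" "lam3 \<beta> q w = lam3 \<beta> p v"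
  using assms by (auto simp: tangent_map_mult_iff lam_eq_maurer_cartan)

lemma left_invariant_gSL: "left_invariant_metric (gSL \<alpha> \<beta>)"
  unfolding left_invariant_metric_def gSL_def
proof (intro ballI allI impI, elim conjE)
  fix A :: "real^2^2" and p u v q u' v'
  assume t: "tangent_map ((**) A) p u q u'" "tangent_map ((**) A) p v q v'"
  show "lam1 \<alpha> q u' * lam1 \<alpha> q v' + lam2 \<alpha> q u' * lam2 \<alpha> q v' + lam3 \<beta> q u' * lam3 \<beta> q v' =
      lam1 \<alpha> p u * lam1 \<alpha> p v + lam2 \<alpha> p u * lam2 \<alpha> p v + lam3 \<beta> p u * lam3 \<beta> p v"
    by (simp add: tangent_map_lam[OF t(1)] tangent_map_lam[OF t(2)])
qed

lemma lam_L:
  assumes "\<alpha> > 0" "\<beta> > 0" "p \<in> iw_dom"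
  shows "lam1 \<alpha> p (L1 \<alpha> p) = 1" "lam2 \<alpha> p (L1 \<alpha> p) = 0" "lam3 \<beta> p (L1 \<alpha> p) = 0"
    and "lam1 \<alpha> p (L2 \<alpha> p) = 0" "lam2 \<alpha> p (L2 \<alpha> p) = 1" "lam3 \<beta> p (L2 \<alpha> p) = 0"
    and "lam1 \<alpha> p (L3 \<beta> p) = 0" "lam2 \<alpha> p (L3 \<beta> p) = 0" "lam3 \<beta> p (L3 \<beta> p) = 1"
proof -
  note y = iw_domD[OF assms(3)]
  have "lam1 \<alpha> p (L1 \<alpha> p) = (cos (2 * p $ 3))\<^sup>2 + (sin (2 * p $ 3))\<^sup>2"
    "lam2 \<alpha> p (L2 \<alpha> p) = (sin (2 * p $ 3))\<^sup>2 + (cos (2 * p $ 3))\<^sup>2"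
    using assms(1) y
    by (simp_all add: lam1_def lam2_def L1_def L2_def power2_eq_square field_simps 
        del: sin_cos_squared_add sin_cos_squared_add2 sin_cos_squared_add3)
  then show "lam1 \<alpha> p (L1 \<alpha> p) = 1" "lam2 \<alpha> p (L2 \<alpha> p) = 1"
    by simp_all
  show "lam1 \<alpha> p (L2 \<alpha> p) = 0" "lam2 \<alpha> p (L1 \<alpha> p) = 0"
    by (simp_all add: lam1_def lam2_def L1_def L2_def)
  show "lam1 \<alpha> p (L3 \<beta> p) = 0" "lam2 \<alpha> p (L3 \<beta> p) = 0" "lam3 \<beta> p (L3 \<beta> p) = 1"
    "lam3 \<beta> p (L1 \<alpha> p) = 0" "lam3 \<beta> p (L2 \<alpha> p) = 0"
    using assms iw_domD[OF assms(3)]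
    by (simp_all add: lam1_def lam2_def lam3_def L1_def L2_def L3_def field_simps)
qed

text \<open>
  A field with constant components in an invariant coframe is invariant.
\<close>

lemma left_invariant_fieldI:
  assumes "\<And>p. p \<in> iw_dom \<Longrightarrow> lam1 1 p (X p) = k1"
    and "\<And>p. p \<in> iw_dom \<Longrightarrow> lam2 1 p (X p) = k2"
    and "\<And>p. p \<in> iw_dom \<Longrightarrow> lam3 1 p (X p) = k3"
  shows "left_invariant_field X"
proof -
  have "maurer_cartan q (X q) = maurer_cartan p (X p)" if "p \<in> iw_dom" "q \<in> iw_dom" for p q
  proof -
    have "lam1 1 q (X q) = lam1 1 p (X p)" "lam2 1 q (X q) = lam2 1 p (X p)"
      "lam3 1 q (X q) = lam3 1 p (X p)"
      using assms that by auto
    then have "maurer_cartan q (X q) $ 1 $ 2 + maurer_cartan q (X q) $ 2 $ 1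
        = maurer_cartan p (X p) $ 1 $ 2 + maurer_cartan p (X p) $ 2 $ 1"
      "maurer_cartan q (X q) $ 1 $ 1 = maurer_cartan p (X p) $ 1 $ 1"
      "maurer_cartan q (X q) $ 1 $ 2 - maurer_cartan q (X q) $ 2 $ 1
        = maurer_cartan p (X p) $ 1 $ 2 - maurer_cartan p (X p) $ 2 $ 1"
      using that by (simp_all add: lam_eq_maurer_cartan)
    moreover have "maurer_cartan p v $ 2 $ 2 = - maurer_cartan p v $ 1 $ 1" for p v
      by (simp add: maurer_cartan_def Let_def)
    ultimately show ?thesis
      by (intro matrix_2_eqI) simp_all
  qed
  then show ?thesis
    unfolding left_invariant_field_def tangent_map_mult_iff by blast
qed

lemma lam_scale:
  "\<alpha> > 0 \<Longrightarrow> lam1 1 p v = lam1 \<alpha> p v / sqrt \<alpha>"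
  "\<alpha> > 0 \<Longrightarrow> lam2 1 p v = lam2 \<alpha> p v / sqrt \<alpha>"
  "\<alpha> > 0 \<Longrightarrow> lam3 1 p v = lam3 \<alpha> p v / sqrt \<alpha>"
  by (simp_all add: lam1_def lam2_def lam3_def)

lemma left_invariant_L123:
  assumes "\<alpha> > 0" "\<beta> > 0"
  shows "left_invariant_field (L1 \<alpha>)" "left_invariant_field (L2 \<alpha>)" "left_invariant_field (L3 \<beta>)"
  by (rule left_invariant_fieldI, unfold lam_scale(1,2)[OF assms(1)] lam_scale(3)[OF assms(2)];
      simp add: lam_L[OF assms])+

section \<open>Generators of the left translations\<close>

lemma generated_by_iff:
  "generated_by B X \<longleftrightarrow> (\<forall>p\<in>iw_dom. iwasawa p ** maurer_cartan p (X p) = B ** iwasawa p)"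
  by (simp add: generated_by_def frechet_iwasawa)

text \<open>
  \<open>iwasawa\<close> is an immersion, so a generator is determined by its matrix.
\<close>

lemma generated_by_unique:
  "generated_by B X \<Longrightarrow> generated_by B Y \<Longrightarrow> p \<in> iw_dom \<Longrightarrow> X p = Y p"
  unfolding generated_by_iff by (metis iwasawa_left_cancel maurer_cartan_inject)

text \<open>
  Under \<open>exp (t B)\<close> with \<open>B\<close> of rows \<open>(u, v)\<close>, \<open>(w, - u)\<close>, the point \<open>z = x + i y\<close> moves with velocity
  \<open>v + 2 u z - w z\<^sup>2\<close>.  The half-plane components of \<open>vstar\<close>, \<open>hstar\<close>, \<open>wstar\<close> are
  \<open>sqrt \<alpha> (1 - z\<^sup>2)\<close>, \<open>4 sqrt \<alpha> z\<close> and \<open>sqrt \<beta> (1 + z\<^sup>2)\<close>, from which the entries are read off.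
\<close>

definition star_generator :: "real \<Rightarrow> real \<Rightarrow> real \<Rightarrow> real \<Rightarrow> real \<Rightarrow> real^2^2" where
  "star_generator \<alpha> \<beta> a b c =
     vector [vector [2 * sqrt \<alpha> * b, sqrt \<alpha> * a + sqrt \<beta> * c],
             vector [sqrt \<alpha> * a - sqrt \<beta> * c, - (2 * sqrt \<alpha> * b)]]"

text \<open>
  Both sides of \<open>N A K (M\<inverse> dM) = B N A K\<close> have the factor \<open>K\<close> on the right once \<open>K (M\<inverse> dM) K\<inverse>\<close> is
  computed.  Removing it leaves the four entries \<open>g1\<close> to \<open>g4\<close>, in which \<open>\<theta>\<close> no longer occurs.
\<close>

lemma generated_by_star:
  "generated_by (star_generator \<alpha> \<beta> a b c)
     (\<lambda>p. a *\<^sub>R vstar \<alpha> p + b *\<^sub>R hstar \<alpha> p + c *\<^sub>R wstar \<beta> p)"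
  unfolding generated_by_iff
proof
  fix p assume p: "p \<in> iw_dom"
  define s r k t X where "s = sqrt (p $ 2)" and "r = inverse s" and "k = cos (p $ 3)"
    and "t = sin (p $ 3)" and "X = p $ 1 * r"
  have s: "s \<noteq> 0" and ys: "p $ 2 = s * s"
    using iw_domD[OF p] by (simp_all add: s_def)
  have sr: "s * r = 1" and x: "p $ 1 = X * s"
    using s by (simp_all add: r_def X_def)
  have kt: "t * t = 1 - k * k"
    using sin_cos_squared_add[of "p $ 3"] by (simp add: k_def t_def power2_eq_square)
  have dbl: "cos (2 * p $ 3) = 2 * (k * k) - 1" "sin (2 * p $ 3) = 2 * t * k"
    by (simp_all add: cos_double_cos sin_double k_def t_def power2_eq_square)
  define a' b' c' where "a' = a * sqrt \<alpha>" and "b' = b * sqrt \<alpha>" and "c' = c * sqrt \<beta>"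
  define V where "V = a *\<^sub>R vstar \<alpha> p + b *\<^sub>R hstar \<alpha> p + c *\<^sub>R wstar \<beta> p"
  define A2 A B where "A2 = a' * (r * r - X * X + s * s) + 4 * b' * X * r + c' * (r * r + X * X - s * s)"
    and "A = A2 / 2" and "B = 2 * b' + (c' - a') * (X * s)"
  have "V $ 1 = a' * (1 - (X * s)\<^sup>2 + (s * s)\<^sup>2) + 4 * b' * (X * s) + c' * (1 + (X * s)\<^sup>2 - (s * s)\<^sup>2)"
    "V $ 2 = - (a' * (2 * (X * s) * (s * s))) + 4 * b' * (s * s) + c' * (2 * (X * s) * (s * s))"
    "V $ 3 = (c' - a') * (s * s)"
    by (simp_all add: V_def vstar_def hstar_def wstar_def a'_def b'_def c'_def x ys algebra_simps)
  then have "V $ 1 = (s * s) * A2" "V $ 2 = 2 * (s * s) * B" and V3: "V $ 3 = (c' - a') * (s * s)"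
    using sr unfolding A2_def B_def by algebra+
  then have V: "V $ 1 / (2 * p $ 2) = A" "V $ 2 / (2 * p $ 2) = B" "V $ 3 = (c' - a') * (s * s)"
    using s by (simp_all add: A_def ys field_simps)
  define v P Q R where "v = (c' - a') * (s * s)" and "P = (2 * (k * k) - 1) * B - 2 * t * k * A"
    and "Q = (2 * (k * k) - 1) * A + 2 * t * k * B" and "R = A + v"
  have mc: "maurer_cartan p V = vector [vector [P, Q + R], vector [Q - R, - P]]"
    by (simp add: maurer_cartan_def Let_def dbl P_def Q_def R_def V v_def
        diff_divide_distrib add_divide_distrib flip: V(1,2))
  have gen: "star_generator \<alpha> \<beta> a b c = vector [vector [2 * b', a' + c'], vector [a' - c', - (2 * b')]]"
    by (simp add: star_generator_def a'_def b'_def c'_def mult_ac)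
  have g1: "s * B - X * v = 2 * b' * s"
    unfolding B_def v_def by algebra
  have "s * A2 = a' * (r - X * X * s + s * s * s) + 4 * b' * X + c' * (r + X * X * s - s * s * s)"
    unfolding A2_def using sr by algebra
  then have g2: "s * (2 * A + v) - X * B = 2 * b' * X + (a' + c') * r"
    unfolding A_def B_def v_def by (simp add: algebra_simps)
  have g3: "r * v = (c' - a') * s" and g4: "r * B = 2 * b' * r + (c' - a') * X"
    unfolding B_def v_def using sr by algebra+
  have e1: "(s * k - X * t) * P + (s * t + X * k) * (Q - R)
      = k * (s * B - X * v) - t * (s * (2 * A + v) - X * B)"
    "(s * k - X * t) * (Q + R) + (s * t + X * k) * - P
      = t * (s * B - X * v) + k * (s * (2 * A + v) - X * B)"
    "- t * r * P + k * r * (Q - R) = t * (r * B) - k * (r * v)"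
    "- t * r * (Q + R) + k * r * - P = - (t * (r * v)) - k * (r * B)"
    unfolding P_def Q_def R_def using kt by algebra+
  note e = matrix_mult_2 mc vector_2 iwasawa_entries divide_inverse gen
  note f = s_def[symmetric] r_def[symmetric] k_def[symmetric] t_def[symmetric] X_def[symmetric]
  show "iwasawa p ** maurer_cartan p (a *\<^sub>R vstar \<alpha> p + b *\<^sub>R hstar \<alpha> p + c *\<^sub>R wstar \<beta> p) =
      star_generator \<alpha> \<beta> a b c ** iwasawa p"
    unfolding V_def[symmetric]
    by (rule matrix_2_eqI; unfold e; unfold f e1 g1 g2 g3 g4) (simp_all add: algebra_simps)
qed

text \<open>
  The matrices \<open>star_generator \<alpha> \<beta> a b c\<close> are exactly the traceless ones, since \<open>\<alpha>\<close> and \<open>\<beta>\<close> are nonzero.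
\<close>

lemma traceless_generator_iff:
  assumes "\<alpha> > 0" "\<beta> > 0"
  shows "(\<exists>B. trace B = 0 \<and> generated_by B X) \<longleftrightarrow>
    (\<exists>a b c. \<forall>p\<in>iw_dom. X p = a *\<^sub>R vstar \<alpha> p + b *\<^sub>R hstar \<alpha> p + c *\<^sub>R wstar \<beta> p)"
proof
  assume "\<exists>B. trace B = 0 \<and> generated_by B X"
  then obtain B where B: "trace B = 0" "generated_by B X" by blast
  define a b c where "a = (B $ 1 $ 2 + B $ 2 $ 1) / (2 * sqrt \<alpha>)"
    and "b = B $ 1 $ 1 / (2 * sqrt \<alpha>)" and "c = (B $ 1 $ 2 - B $ 2 $ 1) / (2 * sqrt \<beta>)"
  have "B = star_generator \<alpha> \<beta> a b c"
    using B(1) assms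
    by (intro matrix_2_eqI) (simp_all add: star_generator_def a_def b_def c_def trace_def sum_2 field_simps)
  then show "\<exists>a b c. \<forall>p\<in>iw_dom. X p = a *\<^sub>R vstar \<alpha> p + b *\<^sub>R hstar \<alpha> p + c *\<^sub>R wstar \<beta> p"
    using generated_by_unique[OF B(2)] generated_by_star by blast
next
  assume "\<exists>a b c. \<forall>p\<in>iw_dom. X p = a *\<^sub>R vstar \<alpha> p + b *\<^sub>R hstar \<alpha> p + c *\<^sub>R wstar \<beta> p"
  then obtain a b c where "\<forall>p\<in>iw_dom. X p = a *\<^sub>R vstar \<alpha> p + b *\<^sub>R hstar \<alpha> p + c *\<^sub>R wstar \<beta> p"
    by blast
  then have "generated_by (star_generator \<alpha> \<beta> a b c) X"
    using generated_by_star[of \<alpha> \<beta> a b c] by (simp add: generated_by_iff)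
  moreover have "trace (star_generator \<alpha> \<beta> a b c) = 0"
    by (simp add: star_generator_def trace_def sum_2)
  ultimately show "\<exists>B. trace B = 0 \<and> generated_by B X"
    by blast
qed

section \<open>Homogeneity\<close>

lemma matrix_inv_left:
  fixes A :: "real^'n^'n"
  shows "invertible A \<Longrightarrow> matrix_inv A ** A = mat 1"
  unfolding invertible_def matrix_inv_def by (metis (mono_tags, lifting) someI_ex)

lemma homogeneous_lam3: "homogeneous_contact SL2R (**) (lam3 \<beta>)"
  unfolding homogeneous_contact_def
proof (intro conjI ballI impI)
  have inv: "invertible A" "matrix_inv A \<in> SL2R" if "A \<in> SL2R" for A
  proof -
    show i: "invertible A"
      using that by (simp add: SL2R_def invertible_det_nz)
    have "det (matrix_inv A) * det A = 1"
      using i by (metis det_I det_mul matrix_inv_left)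
    with that show "matrix_inv A \<in> SL2R"
      by (simp add: SL2R_def)
  qed
  have mult: "A ** B \<in> SL2R" if "A \<in> SL2R" "B \<in> SL2R" for A B
    using that by (simp add: SL2R_def det_mul)
  have one: "mat 1 \<in> SL2R"
    by (simp add: SL2R_def)
  have "closed SL2R"
    unfolding SL2R_def det_2 by (intro closed_Collect_eq continuous_intros)
  then have "closedin (top_of_set {A. invertible A}) SL2R"
    using inv(1) by (intro closed_subset) auto
  then show "matrix_lie_group SL2R"
    using inv mult one by (simp add: matrix_lie_group_def)
  \<comment> \<open>\<open>SL2R\<close> is the continuous image of a half-space, hence connected.\<close>
  have half_space: "iw_dom = {p. axis 2 1 \<bullet> p > 0}"
    by (simp add: iw_dom_def inner_axis')
  have "convex iw_dom"
    unfolding half_space by (rule convex_halfspace_gt)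
  moreover have "continuous_on iw_dom iwasawa"
    by (intro has_derivative_continuous_on[OF has_derivative_at_withinI[OF iwasawa_has_derivative]])
  ultimately show "connected SL2R"
    unfolding iwasawa_image[symmetric] by (intro connected_continuous_image convex_connected)
  have "smooth_on UNIV (\<lambda>q :: (real^2^2) \<times> (real^2^2). fst q ** snd q)"
    by (intro smooth_on_bounded_bilinear[OF bounded_bilinear_matrix_mult_2] smooth_on_intros open_UNIV)
  then show "smooth_on UNIV (\<lambda>(A :: real^2^2, M :: real^2^2). A ** M)"
    by (simp add: case_prod_unfold)
  show "A ** M \<in> SL2R" if "A \<in> SL2R" "M \<in> SL2R" for A M
    using mult that .
  show "mat 1 ** M = M" for M :: "real^2^2"
    by (rule matrix_mul_lid)
  show "(A ** B) ** M = A ** (B ** M)" for A B M :: "real^2^2"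
    by (simp add: matrix_mul_assoc)
  show "\<exists>A\<in>SL2R. A ** M = N" if "M \<in> SL2R" "N \<in> SL2R" for M N
    using inv[OF that(1)] mult[OF that(2)]
    by (intro bexI[of _ "N ** matrix_inv M"]) (simp_all add: matrix_inv_left flip: matrix_mul_assoc)
  show "A = mat 1" if "\<forall>M\<in>SL2R. A ** M = M" for A
    using that one by (metis matrix_mul_rid)
  show "preserves_form ((**) A) (lam3 \<beta>)" for A
    by (auto simp: preserves_form_def tangent_map_lam)
qed

section \<open>The metric in coordinates\<close>

text \<open>
  The pair \<open>(lam1, lam2)\<close> is \<open>(dx, dy)\<close> rotated by \<open>- 2 \<theta>\<close> and scaled, so the angle cancels in the sum of
  squares.
\<close>

lemma gSL_eq:
  assumes "\<alpha> \<ge> 0" "\<beta> \<ge> 0" "p \<in> iw_dom"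
  shows "gSL \<alpha> \<beta> p u v = \<alpha> * (u $ 1 * v $ 1 + u $ 2 * v $ 2) / (p $ 2)\<^sup>2
    + \<beta> * (u $ 1 / p $ 2 + 2 * u $ 3) * (v $ 1 / p $ 2 + 2 * v $ 3)"
proof -
  define c s where "c = cos (2 * p $ 3)" and "s = sin (2 * p $ 3)"
  have cs: "c * c + s * s = 1"
    using sin_cos_squared_add2[of "2 * p $ 3"] by (simp add: c_def s_def power2_eq_square)
  define k where "k = sqrt \<alpha> / p $ 2"
  have k: "k * k = \<alpha> / (p $ 2)\<^sup>2" and b: "sqrt \<beta> * sqrt \<beta> = \<beta>"
    using assms(1,2) by (simp_all add: k_def power2_eq_square)
  have "lam1 \<alpha> p u * lam1 \<alpha> p v + lam2 \<alpha> p u * lam2 \<alpha> p v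
      = k * k * ((c * u $ 1 + s * u $ 2) * (c * v $ 1 + s * v $ 2)
        + (c * u $ 2 - s * u $ 1) * (c * v $ 2 - s * v $ 1))"
    by (simp add: lam1_def lam2_def algebra_simps flip: c_def s_def k_def)
  also have "(c * u $ 1 + s * u $ 2) * (c * v $ 1 + s * v $ 2)
        + (c * u $ 2 - s * u $ 1) * (c * v $ 2 - s * v $ 1) = u $ 1 * v $ 1 + u $ 2 * v $ 2"
    using cs by algebra
  finally have "lam1 \<alpha> p u * lam1 \<alpha> p v + lam2 \<alpha> p u * lam2 \<alpha> p v
      = \<alpha> * (u $ 1 * v $ 1 + u $ 2 * v $ 2) / (p $ 2)\<^sup>2"
    by (simp add: k)
  moreover have "lam3 \<beta> p u * lam3 \<beta> p v
      = (sqrt \<beta> * sqrt \<beta>) * (u $ 1 / p $ 2 + 2 * u $ 3) * (v $ 1 / p $ 2 + 2 * v $ 3)"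
    unfolding lam3_def by (simp only: mult_ac)
  ultimately show ?thesis
    by (simp only: gSL_def b)
qed

lemma metric_matrix_gSL:
  assumes "\<alpha> \<ge> 0" "\<beta> \<ge> 0" "p \<in> iw_dom"
  shows "metric_matrix (gSL \<alpha> \<beta>) p =
    vector [vector [(\<alpha> + \<beta>) / (p $ 2)\<^sup>2, 0, 2 * \<beta> / p $ 2],
            vector [0, \<alpha> / (p $ 2)\<^sup>2, 0],
            vector [2 * \<beta> / p $ 2, 0, 4 * \<beta>]]"
  using iw_domD[OF assms(3)]
  by (simp add: vec_eq_iff forall_3 metric_matrix_def gSL_eq[OF assms] axis_def
      power2_eq_square add_divide_distrib)

lemma linear_lam: "linear (lam1 \<alpha> p)" "linear (lam2 \<alpha> p)" "linear (lam3 \<beta> p)"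
  by (auto simp: linear_iff lam1_def lam2_def lam3_def algebra_simps add_divide_distrib)

lemma smooth_on_lam:
  "smooth_on iw_dom (\<lambda>p. lam1 \<alpha> p v)" "smooth_on iw_dom (\<lambda>p. lam2 \<alpha> p v)" "smooth_on iw_dom (\<lambda>p. lam3 \<beta> p v)"
  unfolding lam1_def lam2_def lam3_def
  by (intro smooth_on_intros open_iw_dom; use iw_domD in force)+

lemma riemannian_gSL:
  assumes "\<alpha> > 0" "\<beta> > 0"
  shows "riemannian_metric iw_dom (gSL \<alpha> \<beta>)"
  unfolding riemannian_metric_def
proof (intro conjI ballI allI impI)
  fix p u v :: "real^3"
  show "bilinear (gSL \<alpha> \<beta> p)"
    unfolding bilinear_def linear_iff gSL_def
    by (auto simp: linear_add[OF linear_lam(1)] linear_add[OF linear_lam(2)] linear_add[OF linear_lam(3)]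
        linear_cmul[OF linear_lam(1)] linear_cmul[OF linear_lam(2)] linear_cmul[OF linear_lam(3)] algebra_simps)
  show "gSL \<alpha> \<beta> p u v = gSL \<alpha> \<beta> p v u"
    by (simp add: gSL_def mult.commute)
next
  fix p v :: "real^3" assume p: "p \<in> iw_dom" and v: "v \<noteq> 0"
  show "gSL \<alpha> \<beta> p v v > 0"
  proof (rule ccontr)
    assume "\<not> gSL \<alpha> \<beta> p v v > 0"
    then have "(lam1 \<alpha> p v)\<^sup>2 + (lam2 \<alpha> p v)\<^sup>2 + (lam3 \<beta> p v)\<^sup>2 \<le> 0"
      by (simp add: gSL_def power2_eq_square)
    then have "lam1 \<alpha> p v = 0" "lam2 \<alpha> p v = 0" "lam3 \<beta> p v = 0"
      by (smt (verit) zero_le_power2 zero_eq_power2)+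
    then have "lam1 1 p v = lam1 1 p 0" "lam2 1 p v = lam2 1 p 0" "lam3 1 p v = lam3 1 p 0"
      using assms by (simp_all add: lam_scale(1,2)[of \<alpha>] lam_scale(3)[of \<beta>] linear_0 linear_lam)
    then have "v = 0"
      using lam_inject[OF p] by blast
    with v show False by simp
  qed
next
  show "smooth_on iw_dom (\<lambda>p. gSL \<alpha> \<beta> p u v)" for u v
    unfolding gSL_def by (intro smooth_on_intros smooth_on_lam open_iw_dom)
qed

lemma orthonormal_L123:
  assumes "\<alpha> > 0" "\<beta> > 0"
  shows "orthonormal_fields iw_dom (gSL \<alpha> \<beta>) [L1 \<alpha>, L2 \<alpha>, L3 \<beta>]"
  by (auto simp: orthonormal_fields_def gSL_def lam_L[OF assms] less_Suc_eq numeral_3_eq_3)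

section \<open>Killing fields\<close>

lemma DERIV_zero_const_pos:
  fixes f :: "real \<Rightarrow> real"
  assumes "\<And>y. y > 0 \<Longrightarrow> (f has_real_derivative 0) (at y)" "y > 0"
  shows "f y = f 1"
  by (rule DERIV_isconst3[of 0 "y + 2"]) (use assms in auto)

text \<open>
  The Killing equations of \<open>X = a e\<^sub>1 + b e\<^sub>2 + c e\<^sub>3\<close> for the orthogonal frame
  \<open>e\<^sub>1 = y \<partial>\<^sub>x - \<partial>\<^sub>\<theta> / 2\<close>, \<open>e\<^sub>2 = y \<partial>\<^sub>y\<close>, \<open>e\<^sub>3 = \<partial>\<^sub>\<theta> / 2\<close>, whose squared lengths are \<open>\<alpha>\<close>, \<open>\<alpha>\<close>, \<open>\<beta>\<close>; here
  \<open>k = \<alpha> / \<beta>\<close>.  The frame is adapted to the fibration over the half-plane: two of the equations say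
  that \<open>b = b(x, \<theta>)\<close> and \<open>c = c(x, y)\<close>.  By \<open>e23\<close>, \<open>a\<^sub>\<theta>\<close> does not depend on \<open>y\<close>, so \<open>e13\<close> equates
  \<open>y c\<^sub>x\<close>, a function of \<open>(x, y)\<close>, with one of \<open>(x, \<theta>)\<close>, and both equal some \<open>G(x)\<close>, and \<open>c = H(x) / y + h(y)\<close> with \<open>H' = G\<close>.  With \<open>e23\<close> this gives
  \<open>a = H / y - y h' - (k / 2) b\<^sub>\<theta>\<close>, and comparing powers of \<open>y\<close> in \<open>e11\<close> kills the dependence on \<open>\<theta>\<close>.
  What remains are ordinary differential equations for \<open>H\<close> and \<open>h\<close>.

  Second derivatives such as \<open>b\<^sub>\<theta>\<^sub>\<theta>\<close> exist because the equations express \<open>b\<^sub>\<theta>\<close> and \<open>h'\<close> through functions known to be differentiable.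
\<close>

lemma killing_system_solution:
  fixes a b c :: "real \<Rightarrow> real \<Rightarrow> real \<Rightarrow> real" and k :: real
  assumes k: "k > 0"
    and dax: "\<And>x y t. y > 0 \<Longrightarrow> ((\<lambda>x. a x y t) has_real_derivative ax x y t) (at x)"
    and day: "\<And>x y t. y > 0 \<Longrightarrow> ((\<lambda>y. a x y t) has_real_derivative ay x y t) (at y)"
    and dat: "\<And>x y t. y > 0 \<Longrightarrow> ((\<lambda>t. a x y t) has_real_derivative at' x y t) (at t)"
    and dbx: "\<And>x y t. y > 0 \<Longrightarrow> ((\<lambda>x. b x y t) has_real_derivative bx x y t) (at x)"
    and dby: "\<And>x y t. y > 0 \<Longrightarrow> ((\<lambda>y. b x y t) has_real_derivative 0) (at y)"
    and dbt: "\<And>x y t. y > 0 \<Longrightarrow> ((\<lambda>t. b x y t) has_real_derivative bt x y t) (at t)"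
    and dcx: "\<And>x y t. y > 0 \<Longrightarrow> ((\<lambda>x. c x y t) has_real_derivative cx x y t) (at x)"
    and dcy: "\<And>x y t. y > 0 \<Longrightarrow> ((\<lambda>y. c x y t) has_real_derivative cy x y t) (at y)"
    and dct: "\<And>x y t. y > 0 \<Longrightarrow> ((\<lambda>t. c x y t) has_real_derivative 0) (at t)"
    and e11: "\<And>x y t. y > 0 \<Longrightarrow> y * ax x y t - at' x y t / 2 = b x y t"
    and e12: "\<And>x y t. y > 0 \<Longrightarrow> y * bx x y t - bt x y t / 2 + y * ay x y t + a x y t = 0"
    and e13: "\<And>x y t. y > 0 \<Longrightarrow> y * cx x y t - b x y t + k * at' x y t / 2 = 0"
    and e23: "\<And>x y t. y > 0 \<Longrightarrow> y * cy x y t + a x y t + k * bt x y t / 2 = 0"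
  obtains p q r d where
    "\<And>x y t. y > 0 \<Longrightarrow> a x y t = (p * x + q * x\<^sup>2 / 2 + r) / y - q * y / 2"
    "\<And>x y t. y > 0 \<Longrightarrow> b x y t = p + q * x"
    "\<And>x y t. y > 0 \<Longrightarrow> c x y t = (p * x + q * x\<^sup>2 / 2 + r) / y + q * y / 2 + d"
proof -
  have b1: "b x y t = b x 1 t" if "y > 0" for x y t
    using DERIV_zero_const_pos[OF dby that] .
  have c0: "c x y t = c x y 0" if "y > 0" for x y t
    using DERIV_isconst_all[of "\<lambda>t. c x y t" t 0] dct[OF that] by blast
  have bt1: "bt x y t = bt x 1 t" if "y > 0" for x y t
    using dbt[OF that, of x t] dbt[of 1 x t] unfolding b1[OF that] by (simp add: DERIV_unique)
  have cx0: "cx x y t = cx x y 0" if "y > 0" for x y t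
    using dcx[OF that, of t x] dcx[OF that, of 0 x] unfolding c0[OF that, of _ t] by (simp add: DERIV_unique)
  have cy0: "cy x y t = cy x y 0" if y: "y > 0" for x y t
  proof -
    have "((\<lambda>y. c x y 0) has_real_derivative cy x y t) (at y)"
      by (rule has_field_derivative_transform_within_open[OF dcy[OF y, of x t], of "{0<..}"])
        (use y c0[of _ x t] in auto)
    with dcy[OF y, of x 0] show ?thesis by (simp add: DERIV_unique)
  qed
  have a_eq: "a x y t = - (y * cy x y 0) - k / 2 * bt x 1 t" if y: "y > 0" for x y t
    using e23[OF y, of x t] unfolding cy0[OF y, of x t] bt1[OF y, of x t] by simp
  \<comment> \<open>\<open>a\<close> is differentiable in \<open>t\<close>, so \<open>b\<^sub>t\<close> is.\<close>
  have dbtt: "((\<lambda>t. bt x 1 t) has_real_derivative - (2 / k) * at' x y t) (at t)" if y: "y > 0" for x y t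
  proof -
    have "bt x 1 t = - (2 / k) * (a x y t + y * cy x y 0)" for t
      using k unfolding a_eq[OF y] by (simp add: field_simps)
    moreover have "((\<lambda>t. - (2 / k) * (a x y t + y * cy x y 0)) has_real_derivative - (2 / k) * at' x y t) (at t)"
      by (rule derivative_eq_intros dat[OF y] refl less_imp_neq[OF y, symmetric])+ simp
    ultimately show ?thesis by simp
  qed
  have at1: "at' x y t = at' x 1 t" if "y > 0" for x y t
    using DERIV_unique[OF dbtt[OF that, of x t] dbtt[of 1 x t]] k by simp
  \<comment> \<open>\<open>y c\<^sub>x\<close> does not depend on \<open>\<theta>\<close>, and \<open>b - k a\<^sub>\<theta> / 2\<close> does not depend on \<open>y\<close>.\<close>
  define G where "G x = cx x 1 0" for x
  have G: "b x 1 t - k * at' x 1 t / 2 = G x" for x t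
    using e13[of 1 x t] cx0[of 1 x t] by (simp add: G_def)
  have cxG: "y * cx x y t = G x" if "y > 0" for x y t
    using e13[OF that, of x t] G[of x t] b1[OF that, of x t] at1[OF that, of x t] by simp
  define H h h' where "H x = c x 1 0 - c 0 1 0" and "h y = c 0 y 0" and "h' y = cy 0 y 0" for x y
  have dH: "(H has_real_derivative G x) (at x)" for x
    using DERIV_diff[OF dcx[of 1 0 x] DERIV_const[of "c 0 1 0"]] by (simp add: H_def[abs_def] G_def)
  have c_eq: "c x y t = H x / y + h y" if y: "y > 0" for x y t
  proof -
    have "((\<lambda>x. c x y 0 - H x / y) has_real_derivative 0) (at x)" for x
      by (rule derivative_eq_intros dcx[OF y] dH refl less_imp_neq[OF y, symmetric])+
        (use y cxG[OF y, of x 0] in \<open>simp add: field_simps\<close>)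
    then have "c x y 0 - H x / y = c 0 y 0 - H 0 / y"
      by (intro DERIV_isconst_all[of "\<lambda>x. c x y 0 - H x / y"]) blast
    with c0[OF y, of x t] show ?thesis by (simp add: h_def H_def)
  qed
  have dh: "(h has_real_derivative h' y) (at y)" if "y > 0" for y
    unfolding h_def h'_def by (rule dcy[OF that])
  have cy_eq: "cy x y 0 = - H x / y\<^sup>2 + h' y" if y: "y > 0" for x y
  proof -
    have "((\<lambda>y. H x / y + h y) has_real_derivative - H x / y\<^sup>2 + h' y) (at y)"
      by (rule derivative_eq_intros dh[OF y] refl less_imp_neq[OF y, symmetric])+ (use y in \<open>simp_all add: power2_eq_square\<close>)
    then have "((\<lambda>y. c x y 0) has_real_derivative - H x / y\<^sup>2 + h' y) (at y)"
      by (rule has_field_derivative_transform_within_open[of _ _ _ "{0<..}"]) (use y c_eq in auto)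
    with dcy[OF y, of x 0] show ?thesis by (simp add: DERIV_unique)
  qed
  have a_eq2: "a x y t = H x / y - y * h' y - k / 2 * bt x 1 t" if y: "y > 0" for x y t
    using y unfolding a_eq[OF y] cy_eq[OF y] by (simp add: field_simps power2_eq_square)
  have dbtx: "((\<lambda>x. bt x 1 t) has_real_derivative (2 / k) * (G x / y - ax x y t)) (at x)" if y: "y > 0" for x y t
  proof -
    have "bt x 1 t = (2 / k) * (H x / y - y * h' y - a x y t)" for x
      using k unfolding a_eq2[OF y] by simp
    moreover have "((\<lambda>x. (2 / k) * (H x / y - y * h' y - a x y t)) has_real_derivative
        (2 / k) * (G x / y - ax x y t)) (at x)"
      by (rule derivative_eq_intros dax[OF y] dH refl less_imp_neq[OF y, symmetric])+ simp
    ultimately show ?thesis by simp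
  qed
  \<comment> \<open>In \<open>e11\<close> the coefficient of \<open>y\<close> and the constant term vanish separately; the latter, compared
    with \<open>G\<close>, is \<open>(k + 1) a\<^sub>\<theta> = 0\<close>.\<close>
  have at0: "at' x 1 t = 0" and Gb: "G x = b x 1 t" for x t
  proof -
    define m where "m = G x - ax x 1 t"
    have "G x / y - ax x y t = m" if "y > 0" for y
      using DERIV_unique[OF dbtx[OF that, of t x] dbtx[of 1 t x]] k by (simp add: m_def)
    then have "y * ax x y t = G x - y * m" if "y > 0" for y
      using that by (fastforce simp: field_simps)
    then have "G x - y * m - at' x 1 t / 2 = b x 1 t" if "y > 0" for y
      using e11[OF that, of x t] that by (simp add: at1[OF that] b1[OF that])
    from this[of 1] this[of 2] have e: "G x - at' x 1 t / 2 = b x 1 t"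
      by simp
    with G[of x t] have "(k + 1) * at' x 1 t = 0"
      by (simp add: algebra_simps)
    with k show "at' x 1 t = 0" by simp
    with e show "G x = b x 1 t" by simp
  qed
  have bt0: "bt x 1 t = 0" for x t
    using dbt[of 1 x t] unfolding Gb[symmetric] by (simp add: DERIV_unique)
  have H0: "H 0 = 0" by (simp add: H_def)
  define h'' where "h'' y = - ((ay 0 y 0 * y - a 0 y 0) / y\<^sup>2)" for y
  have dh': "(h' has_real_derivative h'' y) (at y)" if y: "y > 0" for y
  proof -
    have "((\<lambda>y. - (a 0 y 0 / y)) has_real_derivative h'' y) (at y)"
      unfolding h''_def
      by (rule derivative_eq_intros day[OF y] refl less_imp_neq[OF y, symmetric])+ (use y in \<open>simp_all add: power2_eq_square\<close>)
    then show ?thesis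
      by (rule has_field_derivative_transform_within_open[of _ _ _ "{0<..}"])
        (use y in \<open>auto simp: a_eq2 bt0 H0\<close>)
  qed
  have ay_eq: "ay x y t = - H x / y\<^sup>2 - h' y - y * h'' y" if y: "y > 0" for x y t
  proof -
    have "((\<lambda>y. H x / y - y * h' y) has_real_derivative - H x / y\<^sup>2 - h' y - y * h'' y) (at y)"
      by (rule derivative_eq_intros dh'[OF y] refl less_imp_neq[OF y, symmetric])+ (use y in \<open>simp_all add: power2_eq_square\<close>)
    then have "((\<lambda>y. a x y t) has_real_derivative - H x / y\<^sup>2 - h' y - y * h'' y) (at y)"
      by (rule has_field_derivative_transform_within_open[of _ _ _ "{0<..}"])
        (use y in \<open>auto simp: a_eq2 bt0\<close>)
    with day[OF y, of x t] show ?thesis by (simp add: DERIV_unique)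
  qed
  have bx_eq: "bx x y t = 2 * h' y + y * h'' y" if y: "y > 0" for x y t
  proof -
    have "y * ay x y t = - H x / y - y * h' y - y * (y * h'' y)"
      using y by (simp add: ay_eq power2_eq_square right_diff_distrib)
    then have "y * bx x y t = y * (2 * h' y + y * h'' y)"
      using e12[OF y, of x t] y
      by (simp add: a_eq2 bt0 bt1[OF y] distrib_left)
    with y show ?thesis by simp
  qed
  \<comment> \<open>\<open>b\<^sub>x\<close> is a function of \<open>x\<close> equal to a function of \<open>y\<close>, hence a constant.\<close>
  define q where "q = 2 * h' 1 + h'' 1"
  have q1: "bx x 1 t = q" for x t
    using bx_eq[of 1 x t] by (simp add: q_def)
  have q2: "2 * h' y + y * h'' y = q" if "y > 0" for y
  proof -
    have "bx 0 y 0 = bx 0 1 0"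
      using dbx[OF that, of 0 0] dbx[of 1 0 0] unfolding b1[OF that] by (simp add: DERIV_unique)
    then show ?thesis using bx_eq[OF that, of 0 0] q1 by simp
  qed
  define p where "p = b 0 1 0"
  have b_eq: "b x y t = p + q * x" if y: "y > 0" for x y t
  proof -
    have "((\<lambda>x. b x 1 0 - q * x) has_real_derivative 0) (at x)" for x
      by (rule derivative_eq_intros dbx refl)+ (simp_all add: q1)
    then have "b x 1 0 - q * x = b 0 1 0 - q * 0"
      by (intro DERIV_isconst_all[of "\<lambda>x. b x 1 0 - q * x"]) blast
    moreover have "b x 1 t = b x 1 0"
      by (simp flip: Gb)
    ultimately show ?thesis using b1[OF y, of x t] by (simp add: p_def)
  qed
  have H_eq: "H x = p * x + q * x\<^sup>2 / 2" for x
  proof -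
    have "((\<lambda>x. H x - (p * x + q * x\<^sup>2 / 2)) has_real_derivative 0) (at x)" for x
      by (rule derivative_eq_intros dH refl)+ (simp_all add: Gb[of _ 0] b_eq)
    then have "H x - (p * x + q * x\<^sup>2 / 2) = H 0 - (p * 0 + q * 0\<^sup>2 / 2)"
      by (intro DERIV_isconst_all[of "\<lambda>x. H x - (p * x + q * x\<^sup>2 / 2)"]) blast
    then show ?thesis by (simp add: H0)
  qed
  \<comment> \<open>\<open>2 h' + y h'' = q\<close> says that \<open>y\<^sup>2 (h' - q / 2)\<close> is constant.\<close>
  define r where "r = q / 2 - h' 1"
  have h'_eq: "h' y = q / 2 - r / y\<^sup>2" if y: "y > 0" for y
  proof -
    have "((\<lambda>y. y\<^sup>2 * (h' y - q / 2)) has_real_derivative 0) (at y)" if y: "y > 0" for y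
      by (rule derivative_eq_intros dh'[OF y] refl less_imp_neq[OF y, symmetric])+
        (use y in \<open>simp_all add: algebra_simps power2_eq_square flip: q2[OF y]\<close>)
    from DERIV_zero_const_pos[OF this y] show ?thesis
      using y by (simp add: r_def field_simps)
  qed
  define d where "d = h 1 - q / 2 - r"
  have h_eq: "h y = r / y + q * y / 2 + d" if y: "y > 0" for y
  proof -
    have "((\<lambda>y. h y - (r / y + q / 2 * y)) has_real_derivative 0) (at y)" if y: "y > 0" for y
      by (rule derivative_eq_intros dh[OF y] refl less_imp_neq[OF y, symmetric])+
        (use y in \<open>simp_all add: h'_eq power2_eq_square\<close>)
    from DERIV_zero_const_pos[OF this y] show ?thesis
      by (simp add: d_def)
  qed
  show thesis
  proof (rule that[of p q r d])
    fix x y t :: real assume y: "y > 0"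
    show "a x y t = (p * x + q * x\<^sup>2 / 2 + r) / y - q * y / 2"
      using y unfolding a_eq2[OF y] bt0 H_eq h'_eq[OF y] by (simp add: field_simps power2_eq_square)
    show "b x y t = p + q * x" by (rule b_eq[OF y])
    show "c x y t = (p * x + q * x\<^sup>2 / 2 + r) / y + q * y / 2 + d"
      unfolding c_eq[OF y] H_eq h_eq[OF y] by (simp add: add_divide_distrib)
  qed
qed

lemma partial_metric_matrix_gSL:
  assumes "\<alpha> \<ge> 0" "\<beta> \<ge> 0" "p \<in> iw_dom"
  shows "partial_deriv m (\<lambda>q. metric_matrix (gSL \<alpha> \<beta>) q $ l $ c) p =
    (if m = 2 then (vector [vector [- 2 * (\<alpha> + \<beta>) / (p $ 2)^3, 0, - 2 * \<beta> / (p $ 2)\<^sup>2],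
            vector [0, - 2 * \<alpha> / (p $ 2)^3, 0],
            vector [- 2 * \<beta> / (p $ 2)\<^sup>2, 0, 0]] :: real^3^3) $ l $ c else 0)"
proof -
  have y: "p $ 2 > 0" and y2: "(p $ 2)\<^sup>2 \<noteq> 0" "p $ 2 \<noteq> 0"
    using iw_domD[OF assms(3)] by simp_all
  have d1: "((\<lambda>q. k / (q $ 2)\<^sup>2) has_derivative (\<lambda>v. - 2 * k / (p $ 2)^3 * v $ 2)) (at p)" for k
    by (rule derivative_eq_intros refl y2)+
      (use y in \<open>simp_all add: fun_eq_iff field_simps power2_eq_square power3_eq_cube\<close>)
  have d2: "((\<lambda>q. 2 * k / q $ 2) has_derivative (\<lambda>v. - 2 * k / (p $ 2)\<^sup>2 * v $ 2)) (at p)" for k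
    by (rule derivative_eq_intros refl y2)+
      (use y in \<open>simp_all add: fun_eq_iff field_simps power2_eq_square power3_eq_cube\<close>)
  have d0: "((\<lambda>q. k) has_derivative (\<lambda>v. 0 * v $ 2)) (at p)" for k :: real
    by simp
  have "\<forall>l c. frechet_derivative (\<lambda>q. metric_matrix (gSL \<alpha> \<beta>) q $ l $ c) (at p) =
    (\<lambda>v. (vector [vector [- 2 * (\<alpha> + \<beta>) / (p $ 2)^3, 0, - 2 * \<beta> / (p $ 2)\<^sup>2],
            vector [0, - 2 * \<alpha> / (p $ 2)^3, 0],
            vector [- 2 * \<beta> / (p $ 2)\<^sup>2, 0, 0]] :: real^3^3) $ l $ c * v $ 2)"
    unfolding forall_3 vector_3
    by (intro conjI; rule frechet_derivative_eq_on_open[OF _ open_iw_dom assms(3)],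
        (rule d1 d2 d0), simp add: metric_matrix_gSL[OF assms(1,2)])
  then show ?thesis
    by (simp add: partial_deriv_def axis_def)
qed

lemma smooth_on_stars:
  "smooth_on iw_dom (vstar \<alpha>)" "smooth_on iw_dom (hstar \<alpha>)" "smooth_on iw_dom (wstar \<beta>)"
  "smooth_on iw_dom (L3 \<beta>)"
  unfolding vstar_def[abs_def] hstar_def[abs_def] wstar_def[abs_def] L3_def[abs_def]
  by (intro smooth_on_intros smooth_on_vector_3 open_iw_dom)+

lemma killing_star:
  assumes "\<alpha> > 0" "\<beta> > 0"
  shows "killing_field iw_dom (gSL \<alpha> \<beta>)
    (\<lambda>p. a *\<^sub>R vstar \<alpha> p + b *\<^sub>R hstar \<alpha> p + c *\<^sub>R wstar \<beta> p + d *\<^sub>R L3 \<beta> p)"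
    (is "killing_field _ _ ?X")
  unfolding killing_field_def
proof (intro conjI ballI)
  show "smooth_on iw_dom ?X"
    by (intro smooth_on_intros smooth_on_stars open_iw_dom)
next
  fix p assume p: "p \<in> iw_dom"
  define A B C E where "A = a * sqrt \<alpha>" and "B = 4 * b * sqrt \<alpha>" and "C = c * sqrt \<beta>"
    and "E = d / (2 * sqrt \<beta>)"
  have y: "p $ 2 > 0"
    using iw_domD[OF p] .
  have X: "?X q $ 1 = (C - A) * ((q $ 1)\<^sup>2 - (q $ 2)\<^sup>2) + B * q $ 1 + (A + C)"
    "?X q $ 2 = 2 * (C - A) * (q $ 1 * q $ 2) + B * q $ 2"
    "?X q $ 3 = (C - A) * q $ 2 + E" for q
    by (simp_all add: vstar_def hstar_def wstar_def L3_def A_def B_def C_def E_def algebra_simps)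
  have D: "partial_deriv 1 (\<lambda>q. ?X q $ 1) p = 2 * (C - A) * p $ 1 + B"
    "partial_deriv 2 (\<lambda>q. ?X q $ 1) p = - (2 * (C - A) * p $ 2)"
    "partial_deriv 3 (\<lambda>q. ?X q $ 1) p = 0"
    "partial_deriv 1 (\<lambda>q. ?X q $ 2) p = 2 * (C - A) * p $ 2"
    "partial_deriv 2 (\<lambda>q. ?X q $ 2) p = 2 * (C - A) * p $ 1 + B"
    "partial_deriv 3 (\<lambda>q. ?X q $ 2) p = 0"
    "partial_deriv 1 (\<lambda>q. ?X q $ 3) p = 0"
    "partial_deriv 2 (\<lambda>q. ?X q $ 3) p = C - A"
    "partial_deriv 3 (\<lambda>q. ?X q $ 3) p = 0"
    unfolding partial_deriv_def X
    by (subst frechet_derivative_eq, (rule derivative_eq_intros refl)+, simp add: axis_def)+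
  show "\<forall>l c. (\<Sum>m\<in>UNIV. ?X p $ m * partial_deriv m (\<lambda>q. metric_matrix (gSL \<alpha> \<beta>) q $ l $ c) p
            + metric_matrix (gSL \<alpha> \<beta>) p $ m $ c * partial_deriv l (\<lambda>q. ?X q $ m) p
            + metric_matrix (gSL \<alpha> \<beta>) p $ l $ m * partial_deriv c (\<lambda>q. ?X q $ m) p) = 0"
    using assms y unfolding partial_metric_matrix_gSL[OF less_imp_le[OF assms(1)] less_imp_le[OF assms(2)] p]
      metric_matrix_gSL[OF less_imp_le[OF assms(1)] less_imp_le[OF assms(2)] p] forall_3 sum_3
    unfolding D unfolding X
    by (simp add: field_simps power2_eq_square power3_eq_cube)
qed

lemma killing_field_cong:
  assumes "open S" "\<And>p. p \<in> S \<Longrightarrow> X p = Y p" "killing_field S g X"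
  shows "killing_field S g Y"
proof -
  have s: "smooth_on S X"
    using assms(3) by (simp add: killing_field_def)
  then have "X differentiable at p" if "p \<in> S" for p
    using that by (auto simp: smooth_on_def dest!: spec[of _ 1])
  then have "(\<lambda>q. X q $ i) differentiable at p" if "p \<in> S" for p i
    using that unfolding differentiable_def by (blast intro: has_derivative_nth)
  then have "frechet_derivative (\<lambda>q. Y q $ m) (at p) = frechet_derivative (\<lambda>q. X q $ m) (at p)"
    if "p \<in> S" for p m
    using frechet_derivative_transform_within_open[of "\<lambda>q. X q $ m" p S "\<lambda>q. Y q $ m"] assms(1,2) that
    by simp
  then have "partial_deriv l (\<lambda>q. Y q $ m) p = partial_deriv l (\<lambda>q. X q $ m) p" if "p \<in> S" for p l m
    using that by (simp add: partial_deriv_def)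
  then show ?thesis
    using assms(3) smooth_on_cong[OF assms(1,2) s] by (simp add: killing_field_def assms(2)[symmetric])
qed

lemma has_real_derivative_partial:
  fixes f :: "real^3 \<Rightarrow> real"
  assumes "f differentiable at (vector [x, y, t])"
  shows "((\<lambda>x. f (vector [x, y, t])) has_real_derivative partial_deriv 1 f (vector [x, y, t])) (at x)"
    and "((\<lambda>y. f (vector [x, y, t])) has_real_derivative partial_deriv 2 f (vector [x, y, t])) (at y)"
    and "((\<lambda>t. f (vector [x, y, t])) has_real_derivative partial_deriv 3 f (vector [x, y, t])) (at t)"
proof -
  let ?p = "vector [x, y, t] :: real^3"
  have f: "(f has_derivative frechet_derivative f (at ?p)) (at ?p)"
    using assms by (simp add: frechet_derivative_works)
  interpret bounded_linear "frechet_derivative f (at ?p)"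
    using f by (rule has_derivative_bounded_linear)
  have line: "((\<lambda>s. f (g s)) has_real_derivative partial_deriv i f ?p) (at s)"
    if "g s = ?p" "\<And>j. ((\<lambda>s. g s $ j) has_derivative (\<lambda>h. if j = i then h else 0)) (at s)" for g s i
  proof -
    have "(g has_derivative (\<lambda>h. h *\<^sub>R axis i 1)) (at s)"
      using that(2) by (intro has_derivative_vecI) (simp add: axis_def if_distrib cong: if_cong)
    moreover have "(f has_derivative frechet_derivative f (at ?p)) (at (g s))"
      using f that(1) by simp
    ultimately have "((\<lambda>s. f (g s)) has_derivative (\<lambda>h. frechet_derivative f (at ?p) (h *\<^sub>R axis i 1))) (at s)"
      by (rule has_derivative_compose)
    then show ?thesis
      by (simp add: has_field_derivative_def partial_deriv_def scaleR mult.commute[of _ "partial_deriv i f ?p"] mult_commute_abs)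
  qed
  show "((\<lambda>x. f (vector [x, y, t])) has_real_derivative partial_deriv 1 f ?p) (at x)"
    "((\<lambda>y. f (vector [x, y, t])) has_real_derivative partial_deriv 2 f ?p) (at y)"
    "((\<lambda>t. f (vector [x, y, t])) has_real_derivative partial_deriv 3 f ?p) (at t)"
    by (rule line, simp, rename_tac j, case_tac j rule: exhaust_3[THEN disjE]; auto)+
qed

text \<open>
  The equations with indices 33, 22, 11, 12, 13 and 23, divided by the metric coefficients and combined
  so as to become the hypotheses of \<open>killing_system_solution\<close>: 33 removes \<open>D 3 3\<close> from 13, and then 13
  and 23 remove \<open>D 1 3\<close> and \<open>D 2 3\<close> from 11 and 12.
\<close>

lemma killing_equations:
  assumes "\<alpha> > 0" "\<beta> > 0" "killing_field iw_dom (gSL \<alpha> \<beta>) X" "p \<in> iw_dom"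
  defines "y \<equiv> p $ 2" and "k \<equiv> \<alpha> / \<beta>" and "v \<equiv> X p $ 2"
    and "D \<equiv> \<lambda>j m. partial_deriv j (\<lambda>q. X q $ m) p"
  shows "D 3 1 + 2 * y * D 3 3 = 0" "y * D 2 2 = v" "y * D 1 1 - D 3 1 / 2 = v"
    and "y * D 1 2 - D 3 2 / 2 + y * D 2 1 = 0"
    and "2 * (y * D 1 1 + 2 * y\<^sup>2 * D 1 3 - v) + k * D 3 1 = 0"
    and "2 * y * (D 2 1 + 2 * y * D 2 3) + k * D 3 2 = 0"
proof -
  have y: "y > 0" and k: "k > 0" and \<alpha>: "\<alpha> = k * \<beta>"
    using iw_domD[OF assms(4)] assms(1,2) by (simp_all add: y_def k_def)
  note ge = less_imp_le[OF assms(1)] less_imp_le[OF assms(2)]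
  have eq: "\<forall>l c. (\<Sum>m\<in>UNIV. X p $ m * partial_deriv m (\<lambda>q. metric_matrix (gSL \<alpha> \<beta>) q $ l $ c) p
            + metric_matrix (gSL \<alpha> \<beta>) p $ m $ c * D l m + metric_matrix (gSL \<alpha> \<beta>) p $ l $ m * D c m) = 0"
    using assms(3,4) by (simp add: killing_field_def D_def)
  note eq' = eq[unfolded forall_3 sum_3 partial_metric_matrix_gSL[OF ge assms(4)]
      metric_matrix_gSL[OF ge assms(4)], folded y_def v_def, simplified]
  have 33: "D 3 1 + 2 * y * D 3 3 = 0"
  proof -
    have "\<beta> * (D 3 1 + 2 * y * D 3 3) = 0"
      using eq' y by (simp add: field_simps)
    then show ?thesis using assms(2) y by simp
  qed
  have 22: "y * D 2 2 = v"
  proof -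
    have "\<alpha> * (y * D 2 2 - v) = 0"
      using eq' y by (simp add: field_simps power2_eq_square power3_eq_cube)
    then show ?thesis using assms(1) by simp
  qed
  have 11: "k * (y * D 1 1 - v) + (y * D 1 1 + 2 * y\<^sup>2 * D 1 3 - v) = 0"
  proof -
    have "2 * (\<beta> * (y * y)) * (k * (y * D 1 1 - v) + (y * D 1 1 + 2 * y\<^sup>2 * D 1 3 - v)) = 0"
      using eq' y unfolding \<alpha> by (simp add: field_simps power2_eq_square power3_eq_cube)
    then show ?thesis using assms(2) y by simp
  qed
  have 12: "k * (D 1 2 + D 2 1) + (D 2 1 + 2 * y * D 2 3) = 0"
  proof -
    have "\<beta> * (k * (D 1 2 + D 2 1) + (D 2 1 + 2 * y * D 2 3)) = 0"
      using eq' y unfolding \<alpha> by (simp add: field_simps power2_eq_square)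
    then show ?thesis using assms(2) y by simp
  qed
  have 13: "2 * (y * D 1 1 + 2 * y\<^sup>2 * D 1 3 - v) + (k + 1) * D 3 1 + 2 * y * D 3 3 = 0"
  proof -
    have "\<beta> * (y * (y * y)) * (2 * (y * D 1 1 + 2 * y\<^sup>2 * D 1 3 - v) + (k + 1) * D 3 1 + 2 * y * D 3 3) = 0"
      using eq' y unfolding \<alpha> by (simp add: field_simps power2_eq_square)
    then show ?thesis using assms(2) y by simp
  qed
  have 23: "2 * y * (D 2 1 + 2 * y * D 2 3) + k * D 3 2 = 0"
  proof -
    have "\<beta> * (2 * y * (D 2 1 + 2 * y * D 2 3) + k * D 3 2) = 0"
      using eq' y unfolding \<alpha> by (simp add: field_simps power2_eq_square)
    then show ?thesis using assms(2) y by simp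
  qed
  have e13: "2 * (y * D 1 1 + 2 * y\<^sup>2 * D 1 3 - v) + k * D 3 1 = 0"
    using 13 33 by (simp add: algebra_simps)
  have "k * (y * D 1 1 - D 3 1 / 2 - v) = 0"
    using 11 e13 by (simp add: algebra_simps)
  then show "y * D 1 1 - D 3 1 / 2 = v"
    using k by simp
  have "k * (y * D 1 2 - D 3 2 / 2 + y * D 2 1) = y * (k * (D 1 2 + D 2 1)) - k * D 3 2 / 2"
    by (simp add: algebra_simps)
  also have "\<dots> = 0"
    using 12 23 by algebra
  finally show "y * D 1 2 - D 3 2 / 2 + y * D 2 1 = 0"
    using k by simp
  show "D 3 1 + 2 * y * D 3 3 = 0" "y * D 2 2 = v"
    "2 * (y * D 1 1 + 2 * y\<^sup>2 * D 1 3 - v) + k * D 3 1 = 0"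
    "2 * y * (D 2 1 + 2 * y * D 2 3) + k * D 3 2 = 0"
    by (fact 33 22 e13 23)+
qed

text \<open>
  Besides the generators of the left translations there is only \<open>L3\<close>, which generates the right
  translations by rotations.
\<close>

lemma killing_field_gSL_iff:
  assumes "\<alpha> > 0" "\<beta> > 0"
  shows "killing_field iw_dom (gSL \<alpha> \<beta>) X \<longleftrightarrow>
    (\<exists>a b c d. \<forall>p\<in>iw_dom.
      X p = a *\<^sub>R vstar \<alpha> p + b *\<^sub>R hstar \<alpha> p + c *\<^sub>R wstar \<beta> p + d *\<^sub>R L3 \<beta> p)"
proof
  assume "\<exists>a b c d. \<forall>p\<in>iw_dom.
      X p = a *\<^sub>R vstar \<alpha> p + b *\<^sub>R hstar \<alpha> p + c *\<^sub>R wstar \<beta> p + d *\<^sub>R L3 \<beta> p"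
  then show "killing_field iw_dom (gSL \<alpha> \<beta>) X"
    using killing_field_cong[OF open_iw_dom _ killing_star[OF assms]] by metis
next
  assume K: "killing_field iw_dom (gSL \<alpha> \<beta>) X"
  define V where "V x y t = (vector [x, y, t] :: real^3)" for x y t
  define D where "D j m x y t = partial_deriv j (\<lambda>q. X q $ m) (V x y t)" for j m x y t
  have V: "V x y t \<in> iw_dom" if "y > 0" for x y t
    using that by (simp add: V_def iw_dom_def)
  have "X differentiable at p" if "p \<in> iw_dom" for p
    using K that by (auto simp: killing_field_def smooth_on_def dest!: spec[of _ 1])
  then have "(\<lambda>q. X q $ m) differentiable at p" if "p \<in> iw_dom" for p m
    using that unfolding differentiable_def by (blast intro: has_derivative_nth)
  from has_real_derivative_partial[OF this[OF V[unfolded V_def]]]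
  have d: "((\<lambda>x. X (V x y t) $ m) has_real_derivative D 1 m x y t) (at x)"
    "((\<lambda>y. X (V x y t) $ m) has_real_derivative D 2 m x y t) (at y)"
    "((\<lambda>t. X (V x y t) $ m) has_real_derivative D 3 m x y t) (at t)" if "y > 0" for x y t m
    using that by (simp_all add: D_def V_def)
  define k where "k = \<alpha> / \<beta>"
  have k: "k > 0"
    using assms by (simp add: k_def)
  have E: "D 3 1 x y t + 2 * y * D 3 3 x y t = 0" "y * D 2 2 x y t = X (V x y t) $ 2"
    "y * D 1 1 x y t - D 3 1 x y t / 2 = X (V x y t) $ 2"
    "y * D 1 2 x y t - D 3 2 x y t / 2 + y * D 2 1 x y t = 0"
    "2 * (y * D 1 1 x y t + 2 * y\<^sup>2 * D 1 3 x y t - X (V x y t) $ 2) + k * D 3 1 x y t = 0"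
    "2 * y * (D 2 1 x y t + 2 * y * D 2 3 x y t) + k * D 3 2 x y t = 0" if "y > 0" for x y t
    using killing_equations[OF assms K V[OF that, of x t]] by (simp_all add: D_def k_def V_def)
  obtain p q r d where
    a: "\<And>x y t. y > 0 \<Longrightarrow> X (V x y t) $ 1 / y = (p * x + q * x\<^sup>2 / 2 + r) / y - q * y / 2" and
    b: "\<And>x y t. y > 0 \<Longrightarrow> X (V x y t) $ 2 / y = p + q * x" and
    c: "\<And>x y t. y > 0 \<Longrightarrow> 2 * X (V x y t) $ 3 + X (V x y t) $ 1 / y
      = (p * x + q * x\<^sup>2 / 2 + r) / y + q * y / 2 + d"
  proof (rule killing_system_solution[OF k, of
        "\<lambda>x y t. X (V x y t) $ 1 / y" "\<lambda>x y t. D 1 1 x y t / y"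
        "\<lambda>x y t. D 2 1 x y t / y - X (V x y t) $ 1 / y\<^sup>2" "\<lambda>x y t. D 3 1 x y t / y"
        "\<lambda>x y t. X (V x y t) $ 2 / y" "\<lambda>x y t. D 1 2 x y t / y" "\<lambda>x y t. D 3 2 x y t / y"
        "\<lambda>x y t. 2 * X (V x y t) $ 3 + X (V x y t) $ 1 / y" "\<lambda>x y t. 2 * D 1 3 x y t + D 1 1 x y t / y"
        "\<lambda>x y t. 2 * D 2 3 x y t + D 2 1 x y t / y - X (V x y t) $ 1 / y\<^sup>2"])
    fix x y t :: real assume y: "y > 0"
    note [derivative_intros] = d[OF y] and n = less_imp_neq[OF y, symmetric]
    show "((\<lambda>x. X (V x y t) $ 1 / y) has_real_derivative D 1 1 x y t / y) (at x)"
      "((\<lambda>t. X (V x y t) $ 1 / y) has_real_derivative D 3 1 x y t / y) (at t)"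
      "((\<lambda>x. X (V x y t) $ 2 / y) has_real_derivative D 1 2 x y t / y) (at x)"
      "((\<lambda>t. X (V x y t) $ 2 / y) has_real_derivative D 3 2 x y t / y) (at t)"
      by (rule DERIV_cdivide d[OF y])+
    show "((\<lambda>y. X (V x y t) $ 1 / y) has_real_derivative D 2 1 x y t / y - X (V x y t) $ 1 / y\<^sup>2) (at y)"
      using DERIV_divide[OF d(2)[OF y, of x t 1] DERIV_ident n] y
      by (simp add: field_simps power2_eq_square)
    show "((\<lambda>y. X (V x y t) $ 2 / y) has_real_derivative 0) (at y)"
      using DERIV_divide[OF d(2)[OF y, of x t 2] DERIV_ident n] E(2)[OF y, of x t]
      by (simp add: mult.commute)
    show "((\<lambda>x. 2 * X (V x y t) $ 3 + X (V x y t) $ 1 / y) has_real_derivative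
        2 * D 1 3 x y t + D 1 1 x y t / y) (at x)"
      by (rule DERIV_add DERIV_cmult DERIV_cdivide d[OF y])+
    show "((\<lambda>t. 2 * X (V x y t) $ 3 + X (V x y t) $ 1 / y) has_real_derivative 0) (at t)"
    proof -
      have "2 * D 3 3 x y t + D 3 1 x y t / y = 0"
        using E(1)[OF y, of x t] y by (simp add: field_simps)
      moreover have "((\<lambda>t. 2 * X (V x y t) $ 3 + X (V x y t) $ 1 / y) has_real_derivative
          2 * D 3 3 x y t + D 3 1 x y t / y) (at t)"
        by (rule DERIV_add DERIV_cmult DERIV_cdivide d[OF y])+
      ultimately show ?thesis by simp
    qed
    show "((\<lambda>y. 2 * X (V x y t) $ 3 + X (V x y t) $ 1 / y) has_real_derivative
        2 * D 2 3 x y t + D 2 1 x y t / y - X (V x y t) $ 1 / y\<^sup>2) (at y)"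
      by (rule DERIV_cong[OF DERIV_add[OF DERIV_cmult[OF d(2)[OF y, of x t 3], of 2]
          DERIV_divide[OF d(2)[OF y, of x t 1] DERIV_ident n]]])
        (use y in \<open>simp add: field_simps power2_eq_square\<close>)
    show "y * (D 1 1 x y t / y) - D 3 1 x y t / y / 2 = X (V x y t) $ 2 / y"
      using E(3)[OF y, of x t] y by (simp add: field_simps)
    have "y * (D 1 2 x y t / y) - D 3 2 x y t / y / 2
        + y * (D 2 1 x y t / y - X (V x y t) $ 1 / y\<^sup>2) + X (V x y t) $ 1 / y
      = (y * D 1 2 x y t - D 3 2 x y t / 2 + y * D 2 1 x y t) / y"
      using y by (simp add: field_simps power2_eq_square)
    then show "y * (D 1 2 x y t / y) - D 3 2 x y t / y / 2
        + y * (D 2 1 x y t / y - X (V x y t) $ 1 / y\<^sup>2) + X (V x y t) $ 1 / y = 0"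
      by (simp only: E(4)[OF y, of x t] div_0)
    have "y * (2 * D 1 3 x y t + D 1 1 x y t / y) - X (V x y t) $ 2 / y + k * (D 3 1 x y t / y) / 2
      = (2 * (y * D 1 1 x y t + 2 * y\<^sup>2 * D 1 3 x y t - X (V x y t) $ 2) + k * D 3 1 x y t) / (2 * y)"
      using y by (simp add: field_simps power2_eq_square)
    then show "y * (2 * D 1 3 x y t + D 1 1 x y t / y) - X (V x y t) $ 2 / y + k * (D 3 1 x y t / y) / 2 = 0"
      by (simp only: E(5)[OF y, of x t] div_0)
    have "y * (2 * D 2 3 x y t + D 2 1 x y t / y - X (V x y t) $ 1 / y\<^sup>2) + X (V x y t) $ 1 / y
        + k * (D 3 2 x y t / y) / 2
      = (2 * y * (D 2 1 x y t + 2 * y * D 2 3 x y t) + k * D 3 2 x y t) / (2 * y)"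
      using y by (simp add: field_simps power2_eq_square)
    then show "y * (2 * D 2 3 x y t + D 2 1 x y t / y - X (V x y t) $ 1 / y\<^sup>2) + X (V x y t) $ 1 / y
        + k * (D 3 2 x y t / y) / 2 = 0"
      by (simp only: E(6)[OF y, of x t] div_0)
  qed blast
  \<comment> \<open>The coefficients are found by comparing \<open>1\<close>, \<open>x\<close> and \<open>x\<^sup>2\<close> in the \<open>\<partial>\<^sub>x\<close> component, and the constant
    in the \<open>\<partial>\<^sub>\<theta>\<close> component.\<close>
  have "X z = ((r - q / 2) / (2 * sqrt \<alpha>)) *\<^sub>R vstar \<alpha> z + (p / (4 * sqrt \<alpha>)) *\<^sub>R hstar \<alpha> z
      + ((r + q / 2) / (2 * sqrt \<beta>)) *\<^sub>R wstar \<beta> z + (d * sqrt \<beta>) *\<^sub>R L3 \<beta> z"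
    if z: "z \<in> iw_dom" for z
  proof -
    have y: "z $ 2 > 0"
      using iw_domD[OF z] .
    have Vz: "V (z $ 1) (z $ 2) (z $ 3) = z"
      by (simp add: V_def vec_eq_iff forall_3)
    have X: "X z $ 1 = p * z $ 1 + q * (z $ 1)\<^sup>2 / 2 + r - q * (z $ 2)\<^sup>2 / 2"
      "X z $ 2 = (p + q * z $ 1) * z $ 2"
      using a[OF y, of "z $ 1" "z $ 3"] b[OF y, of "z $ 1" "z $ 3"] y
      unfolding Vz by (simp_all add: field_simps power2_eq_square)
    define W where "W = (p * z $ 1 + q * (z $ 1)\<^sup>2 / 2 + r) / z $ 2"
    have X3: "X z $ 3 = (q * z $ 2 + d) / 2"
      using a[OF y, of "z $ 1" "z $ 3"] c[OF y, of "z $ 1" "z $ 3"]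
      unfolding Vz W_def[symmetric] by simp
    show ?thesis
      using assms
      by (intro vec_3_eqI)
        (simp_all add: X X3 vstar_def hstar_def wstar_def L3_def field_simps)
  qed
  then show "\<exists>a b c d. \<forall>p\<in>iw_dom.
      X p = a *\<^sub>R vstar \<alpha> p + b *\<^sub>R hstar \<alpha> p + c *\<^sub>R wstar \<beta> p + d *\<^sub>R L3 \<beta> p"
    by blast
qed

section \<open>The contact structure\<close>

lemma one_form_lam3: "one_form iw_dom (lam3 \<beta>)"
  by (simp add: one_form_def linear_lam smooth_on_lam)

lemma ext_d_lam3:
  assumes "p \<in> iw_dom"
  shows "ext_d (lam3 \<beta>) p u v = sqrt \<beta> * (u $ 1 * v $ 2 - u $ 2 * v $ 1) / (2 * (p $ 2)\<^sup>2)"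
proof -
  have y: "p $ 2 \<noteq> 0"
    using iw_domD[OF assms] by simp
  have "frechet_derivative (\<lambda>q. lam3 \<beta> q w) (at p) = (\<lambda>h. - (sqrt \<beta> * w $ 1 * h $ 2 / (p $ 2)\<^sup>2))" for w
    unfolding lam3_def
    by (rule frechet_derivative_eq) (rule derivative_eq_intros refl y | simp add: y power2_eq_square fun_eq_iff)+
  then show ?thesis
    using y by (simp add: ext_d_def field_simps)
qed

lemma tensor_field_Phi': "tensor_field_1_1 iw_dom Phi'"
proof -
  have "smooth_on iw_dom (\<lambda>p. Phi' p v)" for v
    unfolding Phi'_def
    by (intro smooth_on_intros smooth_on_vector_3 open_iw_dom; use iw_domD in force)
  moreover have "linear (Phi' p)" for p
    by (simp add: linear_iff Phi'_def scaleR_left_distrib algebra_simps)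
  ultimately show ?thesis
    by (simp add: tensor_field_1_1_def)
qed

lemma almost_contact_SL2R:
  assumes "\<beta> > 0"
  shows "almost_contact_structure iw_dom Phi' (L3 \<beta>) (lam3 \<beta>)"
  unfolding almost_contact_structure_def
proof (intro conjI ballI allI)
  show "odd DIM(real^3)" by simp
  show "tensor_field_1_1 iw_dom Phi'" by (rule tensor_field_Phi')
  show "smooth_on iw_dom (L3 \<beta>)" by (rule smooth_on_stars)
  show "one_form iw_dom (lam3 \<beta>)" by (rule one_form_lam3)
  fix p assume p: "p \<in> iw_dom"
  show "lam3 \<beta> p (L3 \<beta> p) = 1"
    using assms by (simp add: lam3_def L3_def)
  show "Phi' p (Phi' p v) = - v + lam3 \<beta> p v *\<^sub>R L3 \<beta> p" for v
    using assms iw_domD[OF p]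
    by (intro vec_3_eqI) (simp_all add: Phi'_def lam3_def L3_def field_simps)
qed

text \<open>
  The volume is evaluated on \<open>\<partial>\<^sub>\<theta>\<close> and two horizontal vectors.  Since \<open>lam3\<close> vanishes on the latter, only
  the permutations fixing \<open>0\<close> contribute, and these are the identity and one transposition.
\<close>

lemma contact_form_lam3:
  assumes "\<beta> > 0"
  shows "contact_form iw_dom (lam3 \<beta>)"
  unfolding contact_form_def
proof (intro conjI exI[of _ 1] ballI)
  show "one_form iw_dom (lam3 \<beta>)" by (rule one_form_lam3)
  show "DIM(real^3) = 2 * 1 + 1" by simp
  fix p assume p: "p \<in> iw_dom"
  define v :: "nat \<Rightarrow> real^3" where "v = (\<lambda>i. vector [if i = 1 then 1 else 0, if i = 2 then 1 else 0,
      if i = 0 then 1 else if i = 1 then - 1 / (2 * p $ 2) else 0])"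
  have y: "p $ 2 > 0" using iw_domD[OF p] .
  have lam: "lam3 \<beta> p (v i) = 0" if "i = 1 \<or> i = 2" for i
    using that y by (auto simp: lam3_def v_def)
  have perm: "{\<sigma>. \<sigma> permutes {..2 * 1::nat}} \<supseteq> {id, Transposition.transpose 1 2}"
    by (auto intro!: permutes_id permutes_swap_id)
  have z: "of_int (sign \<sigma>) * lam3 \<beta> p (v (\<sigma> 0)) *
        (\<Prod>i<1. ext_d (lam3 \<beta>) p (v (\<sigma> (2 * i + 1))) (v (\<sigma> (2 * i + 2)))) = 0"
    if "\<sigma> \<in> {\<sigma>. \<sigma> permutes {..2 * 1::nat}} - {id, Transposition.transpose 1 2}" for \<sigma>
  proof -
    have s: "\<sigma> permutes {0, 1, 2}" "\<sigma> \<noteq> id" "\<sigma> \<noteq> Transposition.transpose 1 2"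
      using that by (auto simp: atMost_nat_numeral atMost_Suc insert_commute)
    have "\<sigma> 0 \<noteq> 0"
    proof
      assume "\<sigma> 0 = 0"
      then have "\<sigma> permutes {1, 2}"
        by (intro permutes_superset[OF s(1)]) auto
      with s show False by (simp add: permutes_doubleton_iff)
    qed
    moreover have "\<sigma> 0 \<in> {0, 1, 2}"
      using permutes_in_image[OF s(1)] by blast
    ultimately show ?thesis
      using lam[of "\<sigma> 0"] by auto
  qed
  have ne: "(id :: nat \<Rightarrow> nat) \<noteq> Transposition.transpose 1 2"
    by (auto simp: fun_eq_iff Transposition.transpose_def)
  have "contact_volume 1 (lam3 \<beta>) p v = (\<Sum>\<sigma>\<in>{id, Transposition.transpose 1 2}. of_int (sign \<sigma>) * lam3 \<beta> p (v (\<sigma> 0)) *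
        (\<Prod>i<1. ext_d (lam3 \<beta>) p (v (\<sigma> (2 * i + 1))) (v (\<sigma> (2 * i + 2)))))"
    unfolding contact_volume_def
    by (rule sum.mono_neutral_right[OF _ perm]) (use z in \<open>auto intro: finite_permutations\<close>)
  also have "\<dots> = lam3 \<beta> p (v 0) * (ext_d (lam3 \<beta>) p (v 1) (v 2) - ext_d (lam3 \<beta>) p (v 2) (v 1))"
    using ne by (simp add: sign_swap_id sign_id Transposition.transpose_def algebra_simps numeral_2_eq_2)
  also have "\<dots> = 2 * \<beta> / (p $ 2)\<^sup>2"
    using assms y by (simp add: ext_d_lam3[OF p] v_def lam3_def field_simps power2_eq_square)
  also have "\<dots> \<noteq> 0" using assms y by simp
  finally show "\<exists>v. contact_volume 1 (lam3 \<beta>) p v \<noteq> 0" by blast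
qed

lemma reeb_L3:
  assumes "\<beta> > 0"
  shows "reeb_field iw_dom (lam3 \<beta>) (L3 \<beta>)"
  using assms almost_contact_SL2R[OF assms]
  by (simp add: reeb_field_def almost_contact_structure_def ext_d_lam3) (simp add: L3_def)

text \<open>
  On horizontal vectors \<open>Phi'\<close> is a rotation by a right angle, and it kills \<open>L3\<close>.
\<close>

lemma gSL_Phi':
  assumes "\<alpha> > 0" "\<beta> > 0" "p \<in> iw_dom"
  shows "gSL \<alpha> \<beta> p (L3 \<beta> p) u = lam3 \<beta> p u"
    and "gSL \<alpha> \<beta> p (Phi' p u) (Phi' p v) = gSL \<alpha> \<beta> p u v - lam3 \<beta> p u * lam3 \<beta> p v"
    and "gSL \<alpha> \<beta> p u (k *\<^sub>R Phi' p v) = k * \<alpha> * (u $ 1 * v $ 2 - u $ 2 * v $ 1) / (p $ 2)\<^sup>2"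
proof -
  note g = gSL_eq[OF less_imp_le[OF assms(1)] less_imp_le[OF assms(2)] assms(3)]
  have b: "sqrt \<beta> * (sqrt \<beta> * x) = \<beta> * x" for x
    using assms(2) by (simp flip: mult.assoc)
  show "gSL \<alpha> \<beta> p (L3 \<beta> p) u = lam3 \<beta> p u"
    by (simp add: gSL_def lam_L[OF assms])
  show "gSL \<alpha> \<beta> p (Phi' p u) (Phi' p v) = gSL \<alpha> \<beta> p u v - lam3 \<beta> p u * lam3 \<beta> p v"
    using iw_domD[OF assms(3)] unfolding g by (simp add: Phi'_def lam3_def field_simps b)
  show "gSL \<alpha> \<beta> p u (k *\<^sub>R Phi' p v) = k * \<alpha> * (u $ 1 * v $ 2 - u $ 2 * v $ 1) / (p $ 2)\<^sup>2"
    using iw_domD[OF assms(3)] unfolding g by (simp add: Phi'_def field_simps)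
qed

text \<open>
  Both \<open>d lam3\<close> and \<open>g(\<cdot>, Phi' \<cdot>)\<close> are multiples of \<open>dx \<and> dy / y\<^sup>2\<close>, so the axiom linking them is an
  equation between the two factors, decided at a single point.
\<close>

lemma rescaled_contact_metric_SL2R_iff:
  assumes "\<alpha> > 0" "\<beta> > 0"
  shows "rescaled_contact_metric_structure \<kappa> iw_dom (lam3 \<beta>) (L3 \<beta>) Phi' (gSL \<alpha> \<beta>) \<longleftrightarrow>
    2 * \<alpha> = sqrt \<beta> * \<kappa>"
proof -
  have "(\<forall>p\<in>iw_dom. \<forall>u v. ext_d (lam3 \<beta>) p u v = gSL \<alpha> \<beta> p u ((1 / \<kappa>) *\<^sub>R Phi' p v)) \<longleftrightarrow> 2 * \<alpha> = sqrt \<beta> * \<kappa>"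
  proof
    define p :: "real^3" where "p = vector [0, 1, 0]"
    assume "\<forall>p\<in>iw_dom. \<forall>u v. ext_d (lam3 \<beta>) p u v = gSL \<alpha> \<beta> p u ((1 / \<kappa>) *\<^sub>R Phi' p v)"
    moreover have p: "p \<in> iw_dom" by (simp add: p_def iw_dom_def)
    ultimately have "ext_d (lam3 \<beta>) p (vector [1, 0, 0]) (vector [0, 1, 0])
        = gSL \<alpha> \<beta> p (vector [1, 0, 0]) ((1 / \<kappa>) *\<^sub>R Phi' p (vector [0, 1, 0]))"
      by blast
    then have "sqrt \<beta> / 2 = \<alpha> / \<kappa>"
      unfolding ext_d_lam3[OF p] gSL_Phi'[OF assms p] by (simp add: p_def)
    then show "2 * \<alpha> = sqrt \<beta> * \<kappa>"
      using assms by (cases "\<kappa> = 0") (auto simp: field_simps)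
  next
    assume k: "2 * \<alpha> = sqrt \<beta> * \<kappa>"
    then have "\<kappa> \<noteq> 0" using assms by auto
    with k have "1 / \<kappa> * \<alpha> = sqrt \<beta> / 2" by (simp add: field_simps)
    then show "\<forall>p\<in>iw_dom. \<forall>u v. ext_d (lam3 \<beta>) p u v = gSL \<alpha> \<beta> p u ((1 / \<kappa>) *\<^sub>R Phi' p v)"
      by (intro ballI allI) (simp only: ext_d_lam3 gSL_Phi'[OF assms] divide_divide_eq_left
          times_divide_eq_left)
  qed
  then show ?thesis
    using contact_form_lam3[OF assms(2)] almost_contact_SL2R[OF assms(2)] riemannian_gSL[OF assms]
      gSL_Phi'(1,2)[OF assms]
    unfolding rescaled_contact_metric_structure_def by blast
qed

lemma contact_metric_SL2R_iff:
  assumes "\<alpha> > 0" "\<beta> > 0"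
  shows "contact_metric_structure iw_dom (lam3 \<beta>) (L3 \<beta>) Phi' (gSL \<alpha> \<beta>) \<longleftrightarrow> 2 * \<alpha> = sqrt \<beta>"
  using rescaled_contact_metric_SL2R_iff[OF assms, of 1]
  by (simp add: rescaled_contact_metric_structure_def contact_metric_structure_def)

section \<open>The sub-Riemannian structure\<close>

definition horizontal1 :: "real^3 \<Rightarrow> real^3" where
  "horizontal1 p = vector [1, 0, - 1 / (2 * p $ 2)]"

definition horizontal2 :: "real^3 \<Rightarrow> real^3" where
  "horizontal2 p = vector [0, 1, 0]"

lemma smooth_on_horizontal: "smooth_on iw_dom horizontal1" "smooth_on iw_dom horizontal2"
  unfolding horizontal1_def[abs_def] horizontal2_def[abs_def]
  by (intro smooth_on_vector_3 smooth_on_intros open_iw_dom; use iw_domD in force)+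

lemma lam3_eq_0_iff:
  assumes "\<beta> > 0" "p \<in> iw_dom"
  shows "lam3 \<beta> p v = 0 \<longleftrightarrow> v = v $ 1 *\<^sub>R horizontal1 p + v $ 2 *\<^sub>R horizontal2 p"
proof -
  have "lam3 \<beta> p v = 0 \<longleftrightarrow> v $ 1 / p $ 2 + 2 * v $ 3 = 0"
    using assms(1) by (simp add: lam3_def)
  also have "\<dots> \<longleftrightarrow> v = v $ 1 *\<^sub>R horizontal1 p + v $ 2 *\<^sub>R horizontal2 p"
    using iw_domD[OF assms(2)]
    by (auto simp: horizontal1_def horizontal2_def vec_eq_iff forall_3 field_simps)
  finally show ?thesis .
qed

lemma contact_distribution_lam3:
  assumes "\<beta> > 0" "p \<in> iw_dom"
  shows "contact_distribution (lam3 \<beta>) p = span {horizontal1 p, horizontal2 p}"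
proof
  show "contact_distribution (lam3 \<beta>) p \<subseteq> span {horizontal1 p, horizontal2 p}"
  proof
    fix v assume "v \<in> contact_distribution (lam3 \<beta>) p"
    then have "v = v $ 1 *\<^sub>R horizontal1 p + v $ 2 *\<^sub>R horizontal2 p"
      using lam3_eq_0_iff[OF assms] by (simp add: contact_distribution_def)
    then show "v \<in> span {horizontal1 p, horizontal2 p}"
      by (metis insertI1 insertI2 span_add span_base span_scale)
  qed
  have "subspace (contact_distribution (lam3 \<beta>) p)"
    by (simp add: contact_distribution_def linear_subspace_kernel linear_lam)
  moreover have "horizontal1 p \<in> contact_distribution (lam3 \<beta>) p" "horizontal2 p \<in> contact_distribution (lam3 \<beta>) p"
    using iw_domD[OF assms(2)] by (simp_all add: contact_distribution_def lam3_def horizontal1_def horizontal2_def)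
  ultimately show "span {horizontal1 p, horizontal2 p} \<subseteq> contact_distribution (lam3 \<beta>) p"
    by (intro span_minimal) auto
qed

lemma distribution_lam3:
  assumes "\<beta> > 0"
  shows "distribution iw_dom (contact_distribution (lam3 \<beta>))"
  unfolding distribution_def
proof (intro conjI exI[of _ 2] ballI)
  fix p assume p: "p \<in> iw_dom"
  show "subspace (contact_distribution (lam3 \<beta>) p)"
    by (simp add: contact_distribution_def linear_subspace_kernel linear_lam)
  have "horizontal1 p \<notin> span {horizontal2 p}"
    by (auto simp: span_singleton horizontal1_def horizontal2_def vec_eq_iff forall_3)
  moreover have "horizontal2 p \<noteq> 0"
    by (auto simp: horizontal2_def vec_eq_iff forall_3)
  ultimately have "independent {horizontal1 p, horizontal2 p}"
    by (auto simp: independent_insert)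
  moreover have "horizontal1 p \<noteq> horizontal2 p"
    by (auto simp: horizontal1_def horizontal2_def vec_eq_iff forall_3)
  ultimately show "dim (contact_distribution (lam3 \<beta>) p) = 2"
    by (simp add: contact_distribution_lam3[OF assms p] dim_eq_card_independent)
next
  fix p v assume p: "p \<in> iw_dom" and v: "v \<in> contact_distribution (lam3 \<beta>) p"
  let ?X = "\<lambda>q. v $ 1 *\<^sub>R horizontal1 q + v $ 2 *\<^sub>R horizontal2 q"
  have "smooth_on iw_dom ?X"
    by (intro smooth_on_intros smooth_on_horizontal open_iw_dom)
  moreover have "?X q \<in> contact_distribution (lam3 \<beta>) q" if "q \<in> iw_dom" for q
    unfolding contact_distribution_lam3[OF assms that]
    by (intro span_add span_scale span_base) auto
  moreover have "?X p = v"
    using v lam3_eq_0_iff[OF assms p, of v] by (simp add: contact_distribution_def)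
  ultimately show "\<exists>V X. open V \<and> p \<in> V \<and> V \<subseteq> iw_dom \<and> smooth_on V X \<and>
      (\<forall>q\<in>V. X q \<in> contact_distribution (lam3 \<beta>) q) \<and> X p = v"
    using p open_iw_dom by blast
qed

text \<open>
  The bracket of the two horizontal fields has only a \<open>\<partial>\<^sub>\<theta>\<close> component, and it vanishes nowhere.
\<close>

lemma lie_bracket_horizontal:
  assumes "p \<in> iw_dom"
  shows "lie_bracket horizontal1 horizontal2 p = vector [0, 0, - 1 / (2 * (p $ 2)\<^sup>2)]"
proof -
  have y: "p $ 2 \<noteq> 0" "2 * p $ 2 \<noteq> 0"
    using iw_domD[OF assms] by simp_all
  have "(horizontal1 has_derivative (\<lambda>v. vector [0, 0, v $ 2 / (2 * (p $ 2)\<^sup>2)])) (at p)"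
  proof (rule has_derivative_vecI)
    have "((\<lambda>q. - 1 / (2 * q $ 2)) has_derivative (\<lambda>v. v $ 2 / (2 * (p $ 2)\<^sup>2))) (at p)"
      by (rule derivative_eq_intros refl y)+ (simp add: y power2_eq_square fun_eq_iff field_simps)
    then show "((\<lambda>q. horizontal1 q $ i) has_derivative (\<lambda>v. (vector [0, 0, v $ 2 / (2 * (p $ 2)\<^sup>2)] :: real^3) $ i)) (at p)" for i
      using exhaust_3[of i] by (auto simp: horizontal1_def)
  qed
  then have 1: "frechet_derivative horizontal1 (at p) = (\<lambda>v. vector [0, 0, v $ 2 / (2 * (p $ 2)\<^sup>2)])"
    by (rule frechet_derivative_eq)
  have 2: "frechet_derivative horizontal2 (at p) = (\<lambda>v. 0)"
    by (simp add: horizontal2_def[abs_def])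
  show ?thesis
    unfolding lie_bracket_def 1 2 by (intro vec_3_eqI) (simp_all add: horizontal2_def)
qed

lemma bracket_generating_lam3:
  assumes "\<beta> > 0"
  shows "bracket_generating iw_dom (contact_distribution (lam3 \<beta>))"
  unfolding bracket_generating_def
proof
  fix p assume p: "p \<in> iw_dom"
  let ?B = "bracket_closure iw_dom (contact_distribution (lam3 \<beta>))"
  let ?V = "span ((\<lambda>X. X p) ` ?B)"
  have h: "horizontal1 \<in> ?B" "horizontal2 \<in> ?B"
    by (intro bracket_closure.base smooth_on_horizontal; simp add: contact_distribution_lam3[OF assms] span_base)+
  then have "lie_bracket horizontal1 horizontal2 \<in> ?B"
    by (intro bracket_closure.bracket)
  moreover have "X p \<in> ?V" if "X \<in> ?B" for X
    using that by (intro span_base) blast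
  ultimately have in_V: "horizontal1 p \<in> ?V" "horizontal2 p \<in> ?V" "lie_bracket horizontal1 horizontal2 p \<in> ?V"
    using h by blast+
  have "v \<in> ?V" for v
  proof -
    have "v = v $ 1 *\<^sub>R horizontal1 p + v $ 2 *\<^sub>R horizontal2 p
        + (- (2 * (p $ 2)\<^sup>2 * v $ 3 + p $ 2 * v $ 1)) *\<^sub>R lie_bracket horizontal1 horizontal2 p"
      using iw_domD[OF p] unfolding lie_bracket_horizontal[OF p]
      by (intro vec_3_eqI) (simp_all add: horizontal1_def horizontal2_def field_simps power2_eq_square)
    also have "\<dots> \<in> ?V"
      by (intro span_add span_scale in_V)
    finally show ?thesis .
  qed
  then show "?V = UNIV" by blast
qed

lemma sub_riemannian_SL2R:
  assumes "\<alpha> > 0" "\<beta> > 0"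
  shows "sub_riemannian iw_dom (contact_distribution (lam3 \<beta>))
    (\<lambda>p u v. lam1 \<alpha> p u * lam1 \<alpha> p v + lam2 \<alpha> p u * lam2 \<alpha> p v)"
  unfolding sub_riemannian_def
proof (intro conjI)
  show "distribution iw_dom (contact_distribution (lam3 \<beta>))"
    by (rule distribution_lam3[OF assms(2)])
  show "bracket_generating iw_dom (contact_distribution (lam3 \<beta>))"
    by (rule bracket_generating_lam3[OF assms(2)])
  let ?g = "\<lambda>p u v. lam1 \<alpha> p u * lam1 \<alpha> p v + lam2 \<alpha> p u * lam2 \<alpha> p v"
  have pos: "?g p u u > 0" if "p \<in> iw_dom" "lam3 \<beta> p u = 0" "u \<noteq> 0" for p u
  proof -
    have "gSL \<alpha> \<beta> p u u > 0"
      using riemannian_gSL[OF assms] that by (simp add: riemannian_metric_def)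
    with that(2) show ?thesis by (simp add: gSL_def)
  qed
  have lin: "?g p (a *\<^sub>R u + b *\<^sub>R v) w = a * ?g p u w + b * ?g p v w" for p u v w a b
    by (simp add: linear_add[OF linear_lam(1)] linear_add[OF linear_lam(2)]
        linear_cmul[OF linear_lam(1)] linear_cmul[OF linear_lam(2)] algebra_simps)
  show "\<forall>p\<in>iw_dom. \<forall>u\<in>contact_distribution (lam3 \<beta>) p. \<forall>v\<in>contact_distribution (lam3 \<beta>) p.
      \<forall>w\<in>contact_distribution (lam3 \<beta>) p. \<forall>a b. ?g p u v = ?g p v u \<and>
        ?g p (a *\<^sub>R u + b *\<^sub>R v) w = a * ?g p u w + b * ?g p v w \<and> (u \<noteq> 0 \<longrightarrow> ?g p u u > 0)"
    by (intro ballI allI conjI lin impI) (auto simp: mult.commute contact_distribution_def intro: pos)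
  show "\<forall>V X Y. open V \<and> V \<subseteq> iw_dom \<and> smooth_on V X \<and> smooth_on V Y \<and>
      (\<forall>q\<in>V. X q \<in> contact_distribution (lam3 \<beta>) q \<and> Y q \<in> contact_distribution (lam3 \<beta>) q) \<longrightarrow>
      smooth_on V (\<lambda>q. ?g q (X q) (Y q))"
  proof (intro allI impI, elim conjE)
    fix V and X Y :: "real^3 \<Rightarrow> real^3"
    assume V: "open V" "V \<subseteq> iw_dom" and XY: "smooth_on V X" "smooth_on V Y"
    have y: "q $ 2 \<noteq> 0" if "q \<in> V" for q
      using iw_domD V(2) that by force
    have "smooth_on V (\<lambda>q. lam1 \<alpha> q (X q))" "smooth_on V (\<lambda>q. lam2 \<alpha> q (X q))" if "smooth_on V X" for X
      unfolding lam1_def lam2_def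
      by (intro smooth_on_intros smooth_on_vec_nth[OF V(1) that] V(1) y; assumption)+
    then show "smooth_on V (\<lambda>q. ?g q (X q) (Y q))"
      using XY by (intro smooth_on_intros V(1)) auto
  qed
qed

section \<open>The Siegel upper half-plane\<close>

lemma open_X1: "open X1"
  unfolding X1_def by (intro open_Collect_less continuous_intros)

text \<open>
  This is the coordinate formula for \<open>gSL \<alpha> \<beta>\<close> with \<open>\<beta> = 0\<close>, in which \<open>lam3\<close> disappears.
\<close>

lemma gX1_eq_lam12:
  assumes "\<alpha> > 0" "p \<in> iw_dom"
  shows "gX1 \<alpha> (proj_X1 p) (proj_X1 u) (proj_X1 v) = lam1 \<alpha> p u * lam1 \<alpha> p v + lam2 \<alpha> p u * lam2 \<alpha> p v"
proof -
  have "lam3 0 p u = 0" for u by (simp add: lam3_def)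
  then show ?thesis
    using gSL_eq[of \<alpha> 0 p u v] assms by (simp add: gSL_def gX1_def proj_X1_def)
qed

lemma riemannian_gX1:
  assumes "\<alpha> > 0"
  shows "riemannian_metric X1 (gX1 \<alpha>)"
  unfolding riemannian_metric_def
proof (intro conjI ballI allI impI)
  fix z u v :: "real^2" assume z: "z \<in> X1"
  show "bilinear (gX1 \<alpha> z)"
    by (auto simp: bilinear_def linear_iff gX1_def algebra_simps add_divide_distrib)
  show "gX1 \<alpha> z u v = gX1 \<alpha> z v u"
    by (simp add: gX1_def mult.commute)
  assume "v \<noteq> 0"
  then have "v $ 1 \<noteq> 0 \<or> v $ 2 \<noteq> 0"
    by (auto simp: vec_eq_iff forall_2)
  then have "v $ 1 * v $ 1 + v $ 2 * v $ 2 > 0"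
    by (metis not_real_square_gt_zero add_pos_nonneg add_nonneg_pos zero_le_square)
  then show "gX1 \<alpha> z v v > 0"
    using assms z by (simp add: gX1_def X1_def)
next
  show "smooth_on X1 (\<lambda>z. gX1 \<alpha> z u v)" for u v
    unfolding gX1_def by (intro smooth_on_intros open_X1) (auto simp: X1_def)
qed

text \<open>
  \<open>x + i y\<close> is a global holomorphic coordinate, with \<open>DIM(real^2) div 2 = 1\<close>.
\<close>

lemma integrable_J_X1: "integrable_complex X1 J_X1"
proof -
  have "linear (J_X1 z)" for z
    by (auto simp: linear_iff J_X1_def vec_eq_iff forall_2)
  then have ac: "almost_complex X1 J_X1"
    by (auto simp: almost_complex_def tensor_field_1_1_def J_X1_def vec_eq_iff forall_2)
  define f where "f = (\<lambda>z :: real^2. Complex (z $ 1) (z $ 2))"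
  have f: "bounded_linear f"
    unfolding linear_conv_bounded_linear[symmetric]
    by (auto simp: linear_iff f_def complex_eq_iff)
  have D: "frechet_derivative f (at z) = f" for z
    by (rule frechet_derivative_eq[OF bounded_linear_imp_has_derivative[OF f]])
  have [simp]: "f (J_X1 z v) = \<i> * f v" "f v = 0 \<longleftrightarrow> v = 0" "f v = f w \<longleftrightarrow> v = w" for z v w
    by (auto simp: f_def J_X1_def complex_eq_iff vec_eq_iff forall_2)
  show ?thesis
    unfolding integrable_complex_def
  proof (intro conjI ballI ac)
    fix p assume p: "p \<in> X1"
    have m: "DIM(real^2) div 2 = Suc 0"
      by simp
    show "\<exists>V (f :: nat \<Rightarrow> real^2 \<Rightarrow> complex). let m = DIM(real^2) div 2 in
        open V \<and> p \<in> V \<and> V \<subseteq> X1 \<and> (\<forall>k<m. smooth_on V (f k)) \<and>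
        (\<forall>k<m. \<forall>q\<in>V. \<forall>v. frechet_derivative (f k) (at q) (J_X1 q v)
                           = \<i> * frechet_derivative (f k) (at q) v) \<and>
        (\<forall>q\<in>V. \<forall>v. (\<forall>k<m. frechet_derivative (f k) (at q) v = 0) \<longrightarrow> v = 0) \<and>
        (\<forall>q\<in>V. \<forall>q'\<in>V. (\<forall>k<m. f k q = f k q') \<longrightarrow> q = q')"
      unfolding m Let_def
      by (rule exI[of _ X1], rule exI[of _ "\<lambda>_. f"])
        (use p open_X1 smooth_on_linear[OF f] in \<open>simp add: D\<close>)
  qed
qed

text \<open>
  Closedness of the fundamental form is automatic in dimension two: \<open>\<rho>(y) dx \<and> dy\<close> has the derivative
  \<open>\<rho>' dy \<and> dx \<and> dy = 0\<close>.
\<close>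

lemma kaehler_X1:
  assumes "\<alpha> > 0"
  shows "kaehler_metric X1 J_X1 (gX1 \<alpha>)"
  unfolding kaehler_metric_def
proof (intro conjI integrable_J_X1 riemannian_gX1[OF assms] ballI allI)
  show "gX1 \<alpha> p (J_X1 p u) (J_X1 p v) = gX1 \<alpha> p u v" for p u v
    by (simp add: gX1_def J_X1_def add.commute)
  show "closed_two_form X1 (\<lambda>p u v. gX1 \<alpha> p u (J_X1 p v))"
    unfolding closed_two_form_def
  proof (intro ballI allI)
    fix p u v w :: "real^2" assume p: "p \<in> X1"
    then have y: "(p $ 2)\<^sup>2 \<noteq> 0" "p $ 2 \<noteq> 0" by (auto simp: X1_def)
    have D: "frechet_derivative (\<lambda>q. gX1 \<alpha> q v (J_X1 q w)) (at p)
        = (\<lambda>h. - 2 * (\<alpha> * (v $ 2 * w $ 1 - v $ 1 * w $ 2)) / (p $ 2)^3 * h $ 2)" for v w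
      unfolding gX1_def J_X1_def vector_2
      by (rule frechet_derivative_eq, (rule derivative_eq_intros refl y)+)
        (use y in \<open>simp add: fun_eq_iff field_simps power2_eq_square power3_eq_cube\<close>)
    show "frechet_derivative (\<lambda>q. gX1 \<alpha> q v (J_X1 q w)) (at p) u
        + frechet_derivative (\<lambda>q. gX1 \<alpha> q w (J_X1 q u)) (at p) v
        + frechet_derivative (\<lambda>q. gX1 \<alpha> q u (J_X1 q v)) (at p) w = 0"
      unfolding D by (simp add: algebra_simps flip: add_divide_distrib diff_divide_distrib)
  qed
qed

lemma affine_invariant_l0: "affine_invariant_field (l01 \<alpha>)" "affine_invariant_field (l02 \<alpha>)"
proof -
  have "(affine_X1 a b has_derivative (\<lambda>v. a *\<^sub>R v)) (at z)" for a b z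
  proof (rule has_derivative_vecI)
    have "((\<lambda>z. a * z $ 1 + b) has_derivative (\<lambda>v. a * v $ 1)) (at z)"
      "((\<lambda>z. a * z $ 2) has_derivative (\<lambda>v. a * v $ 2)) (at z)"
      by (auto intro!: derivative_eq_intros)
    then show "((\<lambda>z. affine_X1 a b z $ i) has_derivative (\<lambda>v. (a *\<^sub>R v) $ i)) (at z)" for i
      using exhaust_2[of i] by (auto simp: affine_X1_def)
  qed
  note D = frechet_derivative_eq[OF this]
  show "affine_invariant_field (l01 \<alpha>)" "affine_invariant_field (l02 \<alpha>)"
    by (auto simp: affine_invariant_field_def D l01_def l02_def affine_X1_def)
qed

lemma orthonormal_l0:
  assumes "\<alpha> > 0"
  shows "orthonormal_fields X1 (gX1 \<alpha>) [l01 \<alpha>, l02 \<alpha>]"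
  using assms
  by (auto simp: orthonormal_fields_def less_Suc_eq gX1_def l01_def l02_def X1_def power2_eq_square)

section \<open>The Riemannian cone\<close>

lemma open_riem_cone: "open S \<Longrightarrow> open (riem_cone S)"
  unfolding riem_cone_def by (intro open_Times) auto

lemma riem_coneD: "c \<in> riem_cone S \<Longrightarrow> fst c > 0" "c \<in> riem_cone S \<Longrightarrow> snd c \<in> S"
  by (auto simp: riem_cone_def)

lemma smooth_on_cone_snd: "open S \<Longrightarrow> smooth_on S f \<Longrightarrow> smooth_on (riem_cone S) (\<lambda>c. f (snd c))"
  by (rule smooth_on_compose_linear[OF bounded_linear_snd open_riem_cone riem_coneD(2)])

lemma riemannian_cone_metric:
  assumes "open S" "riemannian_metric S g"
  shows "riemannian_metric (riem_cone S) (cone_metric g)"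
  unfolding riemannian_metric_def
proof (intro conjI ballI allI impI)
  fix c u v assume c: "c \<in> riem_cone S"
  have g: "bilinear (g (snd c))" "g (snd c) x y = g (snd c) y x" "x \<noteq> 0 \<Longrightarrow> g (snd c) x x > 0" for x y
    using assms(2) riem_coneD(2)[OF c] by (auto simp: riemannian_metric_def)
  show "bilinear (cone_metric g c)"
    by (auto simp: bilinear_def linear_iff cone_metric_def bilinear_ladd[OF g(1)] bilinear_radd[OF g(1)]
        bilinear_lmul[OF g(1)] bilinear_rmul[OF g(1)] algebra_simps)
  show "cone_metric g c u v = cone_metric g c v u"
    using g(2) by (simp add: cone_metric_def mult.commute)
  assume "v \<noteq> 0"
  then consider "snd v \<noteq> 0" | "snd v = 0" "fst v \<noteq> 0"
    by (cases v) (auto simp: zero_prod_def)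
  then show "cone_metric g c v v > 0"
  proof cases
    case 1
    then show ?thesis
      using g(3) riem_coneD(1)[OF c] by (simp add: cone_metric_def add_nonneg_pos)
  next
    case 2
    then show ?thesis
      using bilinear_lzero[OF g(1)] by (auto simp: cone_metric_def zero_less_mult_iff linorder_neq_iff)
  qed
next
  show "smooth_on (riem_cone S) (\<lambda>c. cone_metric g c u v)" for u v
    unfolding cone_metric_def
  proof (intro smooth_on_intros open_riem_cone assms(1))
    show "smooth_on (riem_cone S) (\<lambda>c. g (snd c) (snd u) (snd v))"
      using assms by (intro smooth_on_cone_snd) (auto simp: riemannian_metric_def)
  qed
qed

lemma closed_two_form_cong:
  assumes "open S" "\<And>p u v. p \<in> S \<Longrightarrow> \<sigma> p u v = \<tau> p u v" "closed_two_form S \<sigma>"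
  shows "closed_two_form S \<tau>"
proof -
  have "frechet_derivative (\<lambda>q. \<tau> q v w) (at p) = frechet_derivative (\<lambda>q. \<sigma> q v w) (at p)" if "p \<in> S" for p v w
    by (rule frechet_derivative_cong_open[OF assms(1) that]) (simp add: assms(2))
  with assms(3) show ?thesis by (simp add: closed_two_form_def)
qed

text \<open>
  \<open>d(r\<^sup>2 \<eta>) = 2 r dr \<and> \<eta> + r\<^sup>2 d\<eta>\<close>; the factor \<open>2\<close> is absorbed by the convention for the wedge product.
\<close>

lemma cone_form_eq:
  assumes "one_form S \<eta>" "c \<in> riem_cone S"
  shows "cone_form \<eta> c u v = fst c * (fst u * \<eta> (snd c) (snd v) - fst v * \<eta> (snd c) (snd u))
    + (fst c)\<^sup>2 * ext_d \<eta> (snd c) (snd u) (snd v)"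
proof -
  have "((\<lambda>q. \<eta> q w) has_derivative frechet_derivative (\<lambda>q. \<eta> q w) (at (snd c))) (at (snd c))" for w
    using assms riem_coneD(2)[OF assms(2)]
    by (auto simp: one_form_def smooth_on_def frechet_derivative_works dest!: spec[of _ 1] spec[of _ w])
  from has_derivative_compose[OF bounded_linear_imp_has_derivative[OF bounded_linear_snd] this]
  have D: "((\<lambda>c. \<eta> (snd c) w) has_derivative (\<lambda>h. frechet_derivative (\<lambda>q. \<eta> q w) (at (snd c)) (snd h))) (at c)" for w .
  have "((\<lambda>c. (fst c)\<^sup>2 * \<eta> (snd c) w) has_derivative
      (\<lambda>h. 2 * fst c * fst h * \<eta> (snd c) w
        + (fst c)\<^sup>2 * frechet_derivative (\<lambda>q. \<eta> q w) (at (snd c)) (snd h))) (at c)" for w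
    by (rule derivative_eq_intros D refl)+ (simp add: fun_eq_iff algebra_simps)
  from frechet_derivative_eq[OF this] show ?thesis
    by (simp add: cone_form_def ext_d_def algebra_simps add_divide_distrib diff_divide_distrib)
qed

lemma cone_form_lam3_eq:
  assumes "c \<in> riem_cone iw_dom"
  shows "cone_form (lam3 \<beta>) c u v = sqrt \<beta> * (fst c * (
      fst u * (snd v $ 1 / snd c $ 2 + 2 * snd v $ 3) - fst v * (snd u $ 1 / snd c $ 2 + 2 * snd u $ 3))
    + (fst c)\<^sup>2 / (2 * (snd c $ 2)\<^sup>2) * (snd u $ 1 * snd v $ 2 - snd u $ 2 * snd v $ 1))"
  using riem_coneD[OF assms]
  by (simp add: cone_form_eq[OF one_form_lam3 assms] ext_d_lam3 lam3_def algebra_simps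
      add_divide_distrib diff_divide_distrib)

lemma closed_cone_form: "closed_two_form (riem_cone iw_dom) (cone_form (lam3 \<beta>))"
proof (rule closed_two_form_cong[OF open_riem_cone[OF open_iw_dom] cone_form_lam3_eq[symmetric]])
  show "closed_two_form (riem_cone iw_dom) (\<lambda>c u v. sqrt \<beta> * (fst c * (
      fst u * (snd v $ 1 / snd c $ 2 + 2 * snd v $ 3) - fst v * (snd u $ 1 / snd c $ 2 + 2 * snd u $ 3))
    + (fst c)\<^sup>2 / (2 * (snd c $ 2)\<^sup>2) * (snd u $ 1 * snd v $ 2 - snd u $ 2 * snd v $ 1)))"
    unfolding closed_two_form_def
  proof (intro ballI allI)
    fix c u v w assume c: "c \<in> riem_cone iw_dom"
    define i where "i = inverse (snd c $ 2)"
    have y: "snd c $ 2 \<noteq> 0"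
      using riem_coneD(2)[OF c] iw_domD by force
    have D: "frechet_derivative (\<lambda>c. sqrt \<beta> * (fst c * (
      fst u * (snd v $ 1 / snd c $ 2 + 2 * snd v $ 3) - fst v * (snd u $ 1 / snd c $ 2 + 2 * snd u $ 3))
      + (fst c)\<^sup>2 / (2 * (snd c $ 2)\<^sup>2) * (snd u $ 1 * snd v $ 2 - snd u $ 2 * snd v $ 1))) (at c)
      = (\<lambda>h. sqrt \<beta> * (fst h * (fst u * (snd v $ 1 * i + 2 * snd v $ 3) - fst v * (snd u $ 1 * i + 2 * snd u $ 3))
        - fst c * (snd h $ 2 * i\<^sup>2) * (fst u * snd v $ 1 - fst v * snd u $ 1)
        + (fst c * fst h * i\<^sup>2 - (fst c)\<^sup>2 * snd h $ 2 * i ^ 3) * (snd u $ 1 * snd v $ 2 - snd u $ 2 * snd v $ 1)))"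
      for u v :: "real \<times> (real^3)"
      unfolding i_def
      by (rule frechet_derivative_eq, (rule derivative_eq_intros refl y | simp add: y)+)
        (use y in \<open>simp add: fun_eq_iff field_simps power2_eq_square power3_eq_cube\<close>)
    show "frechet_derivative (\<lambda>c. sqrt \<beta> * (fst c * (
        fst v * (snd w $ 1 / snd c $ 2 + 2 * snd w $ 3) - fst w * (snd v $ 1 / snd c $ 2 + 2 * snd v $ 3))
      + (fst c)\<^sup>2 / (2 * (snd c $ 2)\<^sup>2) * (snd v $ 1 * snd w $ 2 - snd v $ 2 * snd w $ 1))) (at c) u
      + frechet_derivative (\<lambda>c. sqrt \<beta> * (fst c * (
        fst w * (snd u $ 1 / snd c $ 2 + 2 * snd u $ 3) - fst u * (snd w $ 1 / snd c $ 2 + 2 * snd w $ 3))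
      + (fst c)\<^sup>2 / (2 * (snd c $ 2)\<^sup>2) * (snd w $ 1 * snd u $ 2 - snd w $ 2 * snd u $ 1))) (at c) v
      + frechet_derivative (\<lambda>c. sqrt \<beta> * (fst c * (
        fst u * (snd v $ 1 / snd c $ 2 + 2 * snd v $ 3) - fst v * (snd u $ 1 / snd c $ 2 + 2 * snd u $ 3))
      + (fst c)\<^sup>2 / (2 * (snd c $ 2)\<^sup>2) * (snd u $ 1 * snd v $ 2 - snd u $ 2 * snd v $ 1))) (at c) w = 0"
      unfolding D by algebra
  qed
qed

text \<open>
  Pairing with \<open>\<partial>\<^sub>\<theta>\<close> and \<open>\<partial>\<^sub>r\<close> determines the \<open>dr\<close> and \<open>lam3\<close> components, pairing with \<open>\<partial>\<^sub>x\<close> and \<open>\<partial>\<^sub>y\<close> the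
  remaining ones.
\<close>

lemma nondegenerate_cone_form:
  assumes "\<beta> > 0"
  shows "nondegenerate (riem_cone iw_dom) (cone_form (lam3 \<beta>))"
  unfolding nondegenerate_def
proof (intro ballI allI impI)
  fix c u assume c: "c \<in> riem_cone iw_dom" and z: "\<forall>v. cone_form (lam3 \<beta>) c u v = 0"
  have r: "fst c > 0" and y: "snd c $ 2 > 0"
    using riem_coneD[OF c] iw_domD by auto
  note e = z[rule_format, unfolded cone_form_lam3_eq[OF c]]
  have 0: "fst u = 0"
    using e[of "(0, vector [0, 0, 1])"] r assms by simp
  have 3: "snd u $ 1 / snd c $ 2 + 2 * snd u $ 3 = 0"
    using e[of "(1, 0)"] r assms by simp
  have 1: "snd u $ 1 = 0"
    using e[of "(0, vector [0, 1, 0])"] r y assms 0 by simp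
  have 2: "snd u $ 2 = 0"
    using e[of "(0, vector [1, 0, 0])"] r y assms 0 by simp
  have "snd u = 0"
    using 1 2 3 by (intro vec_3_eqI) simp_all
  with 0 show "u = 0"
    by (simp add: prod_eq_iff)
qed

lemma cone_acs_eq:
  "cone_acs \<Phi> \<xi> \<eta> c u = (fst c * \<eta> (snd c) (snd u), \<Phi> (snd c) (snd u) - (fst u / fst c) *\<^sub>R \<xi> (snd c))"
  by (simp add: cone_acs_def case_prod_unfold)

lemma cone_acs_SL2R_nth:
  "fst (cone_acs Phi' (L3 \<beta>) (lam3 \<beta>) c u) = fst c * (sqrt \<beta> * (snd u $ 1 / snd c $ 2 + 2 * snd u $ 3))"
  "snd (cone_acs Phi' (L3 \<beta>) (lam3 \<beta>) c u) $ 1 = snd u $ 2"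
  "snd (cone_acs Phi' (L3 \<beta>) (lam3 \<beta>) c u) $ 2 = - snd u $ 1"
  "snd (cone_acs Phi' (L3 \<beta>) (lam3 \<beta>) c u) $ 3 = - snd u $ 2 / (2 * snd c $ 2) - fst u / fst c / (2 * sqrt \<beta>)"
  by (simp_all add: cone_acs_eq lam3_def Phi'_def L3_def)

lemma almost_complex_cone:
  assumes "\<beta> > 0"
  shows "almost_complex (riem_cone iw_dom) (cone_acs Phi' (L3 \<beta>) (lam3 \<beta>))"
  unfolding almost_complex_def tensor_field_1_1_def
proof (intro conjI ballI allI)
  let ?J = "cone_acs Phi' (L3 \<beta>) (lam3 \<beta>)"
  show "linear (?J c)" for c
    by (auto simp: linear_iff prod_eq_iff vec_eq_iff forall_3 cone_acs_SL2R_nth algebra_simps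
        add_divide_distrib diff_divide_distrib)
  show "smooth_on (riem_cone iw_dom) (\<lambda>c. ?J c v)" for v
    unfolding cone_acs_eq
  proof (intro smooth_on_intros open_riem_cone open_iw_dom)
    show "smooth_on (riem_cone iw_dom) (\<lambda>c. lam3 \<beta> (snd c) (snd v))"
      by (intro smooth_on_cone_snd smooth_on_lam open_iw_dom)
    show "smooth_on (riem_cone iw_dom) (\<lambda>c. Phi' (snd c) (snd v))"
      using tensor_field_Phi' by (intro smooth_on_cone_snd open_iw_dom)
        (auto simp: tensor_field_1_1_def)
    show "smooth_on (riem_cone iw_dom) (\<lambda>c. L3 \<beta> (snd c))"
      by (intro smooth_on_cone_snd smooth_on_stars open_iw_dom)
    show "fst c \<noteq> 0" if "c \<in> riem_cone iw_dom" for c :: "real \<times> (real^3)"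
      using riem_coneD(1)[OF that] by simp
  qed
  fix c v assume c: "c \<in> riem_cone iw_dom"
  have r: "fst c > 0" and y: "snd c $ 2 > 0"
    using riem_coneD[OF c] iw_domD by auto
  then show "?J c (?J c v) = - v"
    using assms by (simp add: prod_eq_iff vec_eq_iff forall_3 cone_acs_SL2R_nth field_simps)
qed

text \<open>
  With \<open>e\<^sub>1 = \<partial>\<^sub>x - \<partial>\<^sub>\<theta> / (2 y)\<close> and \<open>e\<^sub>2 = \<partial>\<^sub>y\<close>, the structure on the cone satisfies \<open>J e\<^sub>2 = e\<^sub>1\<close> and
  \<open>J \<xi> = r \<partial>\<^sub>r\<close>.  The differential of \<open>y + i x\<close> vanishes on \<open>\<xi>\<close> and \<open>r \<partial>\<^sub>r\<close> and is complex linear on the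
  plane of \<open>e\<^sub>1\<close> and \<open>e\<^sub>2\<close>.  A second coordinate \<open>2 sqrt \<beta> \<theta> + i ln r + \<phi>(y)\<close> is holomorphic along \<open>\<xi>\<close>, \<open>r \<partial>\<^sub>r\<close>; along
  \<open>e\<^sub>1\<close>, \<open>e\<^sub>2\<close> the condition is \<open>- sqrt \<beta> / y = i \<phi>'\<close>, whence \<open>\<phi> = i sqrt \<beta> ln y\<close>.
\<close>

lemma normal_SL2R:
  assumes "\<beta> > 0"
  shows "normal_structure iw_dom Phi' (L3 \<beta>) (lam3 \<beta>)"
  unfolding normal_structure_def integrable_complex_def
proof (intro conjI ballI almost_complex_cone[OF assms])
  fix p assume p: "p \<in> riem_cone iw_dom"
  let ?C = "riem_cone iw_dom"
  let ?J = "cone_acs Phi' (L3 \<beta>) (lam3 \<beta>)"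
  define f where "f k c = (if k = 0 then Complex (snd c $ 2) (snd c $ 1)
    else Complex (2 * sqrt \<beta> * snd c $ 3) (ln (fst c) + sqrt \<beta> * ln (snd c $ 2)))" for k :: nat and c :: "real \<times> (real^3)"
  note C = open_riem_cone[OF open_iw_dom]
  have ry: "fst c > 0" "snd c $ 2 > 0" if "c \<in> ?C" for c
    using riem_coneD[OF that] iw_domD by auto
  have nth: "smooth_on ?C (\<lambda>c. snd c $ i)" for i
    by (intro smooth_on_vec_nth smooth_on_intros C)
  have sm: "smooth_on ?C (f k)" for k
  proof (cases "k = 0")
    case True
    then show ?thesis
      unfolding f_def[abs_def] by simp (intro smooth_on_Complex nth C)
  next
    case False
    then show ?thesis
      unfolding f_def[abs_def] by simp (intro smooth_on_Complex smooth_on_intros nth C ry; assumption)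
  qed
  have D0: "frechet_derivative (f 0) (at c) = (\<lambda>h. Complex (snd h $ 2) (snd h $ 1))" for c
    unfolding f_def[abs_def]
    by (rule frechet_derivative_eq) (simp, rule has_derivative_Complex; (rule derivative_eq_intros refl)+)
  have D1: "frechet_derivative (f 1) (at c)
      = (\<lambda>h. Complex (2 * sqrt \<beta> * snd h $ 3) (fst h / fst c + sqrt \<beta> * (snd h $ 2 / snd c $ 2)))"
    if "c \<in> ?C" for c
    unfolding f_def[abs_def]
    by (rule frechet_derivative_eq)
      (simp, rule has_derivative_Complex; (rule derivative_eq_intros refl ry[OF that])+, simp add: divide_inverse mult_ac)
  have all2: "(\<forall>k<2. P k) \<longleftrightarrow> P 0 \<and> P 1" for P :: "nat \<Rightarrow> bool"
    by (auto simp: less_2_cases_iff)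
  have m: "DIM(real \<times> (real^3)) div 2 = 2" by simp
  have J: "frechet_derivative (f k) (at q) (?J q v) = \<i> * frechet_derivative (f k) (at q) v"
    if "k < 2" "q \<in> ?C" for k q v
    using less_2_cases[OF that(1)] ry[OF that(2)] assms
    by (auto simp: D0 D1[OF that(2), simplified] cone_acs_SL2R_nth complex_eq_iff field_simps)
  have ker: "v = 0" if "frechet_derivative (f 0) (at q) v = 0" "frechet_derivative (f 1) (at q) v = 0" "q \<in> ?C" for q v
    using that(1,2) ry[OF that(3)] assms unfolding D0 D1[OF that(3)]
    by (simp add: complex_eq_iff prod_eq_iff vec_eq_iff forall_3)
  have inj: "q = q'" if "f 0 q = f 0 q'" "f 1 q = f 1 q'" "q \<in> ?C" "q' \<in> ?C" for q q'
    using that(1,2) ry[OF that(3)] ry[OF that(4)] assms unfolding f_def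
    by (simp add: prod_eq_iff vec_eq_iff forall_3)
  show "\<exists>V (f :: nat \<Rightarrow> real \<times> (real^3) \<Rightarrow> complex). let m = DIM(real \<times> (real^3)) div 2 in
      open V \<and> p \<in> V \<and> V \<subseteq> ?C \<and> (\<forall>k<m. smooth_on V (f k)) \<and>
      (\<forall>k<m. \<forall>q\<in>V. \<forall>v. frechet_derivative (f k) (at q) (?J q v) = \<i> * frechet_derivative (f k) (at q) v) \<and>
      (\<forall>q\<in>V. \<forall>v. (\<forall>k<m. frechet_derivative (f k) (at q) v = 0) \<longrightarrow> v = 0) \<and>
      (\<forall>q\<in>V. \<forall>q'\<in>V. (\<forall>k<m. f k q = f k q') \<longrightarrow> q = q')"
    unfolding m Let_def
  proof (intro exI[of _ ?C] exI[of _ f] conjI ballI allI impI C p subset_refl sm J; assumption?)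
    fix q v assume "q \<in> ?C" "\<forall>k<2. frechet_derivative (f k) (at q) v = 0"
    then show "v = 0" unfolding all2 using ker by blast
  next
    fix q q' assume "q \<in> ?C" "q' \<in> ?C" "\<forall>k<2. f k q = f k q'"
    then show "q = q'" unfolding all2 using inj by blast
  qed
qed

text \<open>
  The symplectic form of the cone is the fundamental form of \<open>(cone_metric, cone_acs)\<close>: the terms with
  \<open>dr\<close> agree because \<open>\<eta> = g(\<xi>, \<cdot>)\<close>, the others because \<open>d\<eta> = g(\<cdot>, \<Phi> \<cdot>)\<close>.
\<close>

lemma cone_form_eq_cone_metric:
  assumes "contact_metric_structure S \<eta> \<xi> \<Phi> g" "c \<in> riem_cone S"
  shows "cone_form \<eta> c u v = cone_metric g c u (cone_acs \<Phi> \<xi> \<eta> c v)"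
proof -
  note S = riem_coneD(2)[OF assms(2)]
  have \<eta>: "one_form S \<eta>" and b: "bilinear (g (snd c))" and sym: "g (snd c) x y = g (snd c) y x"
    and \<xi>: "g (snd c) (\<xi> (snd c)) x = \<eta> (snd c) x"
    and d: "ext_d \<eta> (snd c) x y = g (snd c) x (\<Phi> (snd c) y)" for x y
    using assms(1) S
    by (auto simp: contact_metric_structure_def almost_contact_structure_def riemannian_metric_def)
  have "g (snd c) x (\<xi> (snd c)) = \<eta> (snd c) x" for x
    using \<xi> sym by simp
  then show ?thesis
    using riem_coneD(1)[OF assms(2)]
    by (simp add: cone_form_eq[OF \<eta> assms(2)] cone_metric_def cone_acs_eq d bilinear_rsub[OF b]
        bilinear_rmul[OF b] field_simps power2_eq_square)
qed

lemma kaehler_cone: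
  assumes "\<alpha> > 0" "\<beta> > 0" "2 * \<alpha> = sqrt \<beta>"
  shows "kaehler_metric (riem_cone iw_dom) (cone_acs Phi' (L3 \<beta>) (lam3 \<beta>)) (cone_metric (gSL \<alpha> \<beta>))"
  unfolding kaehler_metric_def
proof (intro conjI ballI allI)
  let ?J = "cone_acs Phi' (L3 \<beta>) (lam3 \<beta>)"
  note cm = contact_metric_SL2R_iff[OF assms(1,2), THEN iffD2, OF assms(3)]
  show "integrable_complex (riem_cone iw_dom) ?J"
    using normal_SL2R[OF assms(2)] by (simp add: normal_structure_def)
  show "riemannian_metric (riem_cone iw_dom) (cone_metric (gSL \<alpha> \<beta>))"
    by (intro riemannian_cone_metric open_iw_dom riemannian_gSL assms)
  show "closed_two_form (riem_cone iw_dom) (\<lambda>c u v. cone_metric (gSL \<alpha> \<beta>) c u (?J c v))"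
    by (rule closed_two_form_cong[OF open_riem_cone[OF open_iw_dom] cone_form_eq_cone_metric[OF cm] closed_cone_form])
  fix c u v assume c: "c \<in> riem_cone iw_dom"
  have r: "fst c > 0" and y: "snd c $ 2 > 0"
    using riem_coneD[OF c] iw_domD by auto
  have b: "sqrt \<beta> * (sqrt \<beta> * x) = \<beta> * x" for x
    using assms(2) by (simp flip: mult.assoc)
  show "cone_metric (gSL \<alpha> \<beta>) c (?J c u) (?J c v) = cone_metric (gSL \<alpha> \<beta>) c u v"
    unfolding cone_metric_def gSL_eq[OF less_imp_le[OF assms(1)] less_imp_le[OF assms(2)] riem_coneD(2)[OF c]]
      cone_acs_SL2R_nth
    using r y assms(2) by (simp add: field_simps power2_eq_square b)
qed

theorem proposition4p1:
  fixes \<alpha> \<beta> :: real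
  assumes "\<alpha> > 0" and "\<beta> > 0"
  shows
    "(\<comment> \<open>(1)\<close>
      riemannian_metric iw_dom (gSL \<alpha> \<beta>) \<and> left_invariant_metric (gSL \<alpha> \<beta>) \<and>
      (\<forall>p\<in>iw_dom. \<forall>v. let y = p $ 2; dx = v $ 1; dy = v $ 2; dt = v $ 3 in
         gSL \<alpha> \<beta> p v v = (lam1 \<alpha> p v)\<^sup>2 + (lam2 \<alpha> p v)\<^sup>2 + (lam3 \<beta> p v)\<^sup>2 \<and>
         gSL \<alpha> \<beta> p v v = \<alpha> * ((dx\<^sup>2 + dy\<^sup>2) / y\<^sup>2) + \<beta> * (dx / y + 2 * dt)\<^sup>2 \<and>
         gSL \<alpha> \<beta> p v v = ((\<alpha> + \<beta>) * dx\<^sup>2 + \<alpha> * dy\<^sup>2) / y\<^sup>2 + 4 * \<beta> * dt\<^sup>2 + 4 * (\<beta> / y) * dx * dt) \<and>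
      (\<forall>p\<in>iw_dom. metric_matrix (gSL \<alpha> \<beta>) p =
         vector [vector [(\<alpha> + \<beta>) / (p $ 2)\<^sup>2, 0, 2 * \<beta> / p $ 2],
                 vector [0, \<alpha> / (p $ 2)\<^sup>2, 0],
                 vector [2 * \<beta> / p $ 2, 0, 4 * \<beta>]])) \<and>
     (\<comment> \<open>(2)\<close>
      left_invariant_field (L1 \<alpha>) \<and> left_invariant_field (L2 \<alpha>) \<and> left_invariant_field (L3 \<beta>) \<and>
      orthonormal_fields iw_dom (gSL \<alpha> \<beta>) [L1 \<alpha>, L2 \<alpha>, L3 \<beta>]) \<and>
     (\<comment> \<open>(3)\<close>
      killing_field iw_dom (gSL \<alpha> \<beta>) (vstar \<alpha>) \<and>
      killing_field iw_dom (gSL \<alpha> \<beta>) (hstar \<alpha>) \<and>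
      killing_field iw_dom (gSL \<alpha> \<beta>) (wstar \<beta>) \<and>
      (\<forall>a b c. (\<forall>p\<in>iw_dom. a *\<^sub>R vstar \<alpha> p + b *\<^sub>R hstar \<alpha> p + c *\<^sub>R wstar \<beta> p = 0) \<longrightarrow>
         a = 0 \<and> b = 0 \<and> c = 0) \<and>
      (\<forall>X. (\<exists>B. trace B = 0 \<and> generated_by B X) \<longleftrightarrow>
         (\<exists>a b c. \<forall>p\<in>iw_dom. X p = a *\<^sub>R vstar \<alpha> p + b *\<^sub>R hstar \<alpha> p + c *\<^sub>R wstar \<beta> p)) \<and>
      (\<forall>X. killing_field iw_dom (gSL \<alpha> \<beta>) X \<longleftrightarrow>
         (\<exists>a b c d. \<forall>p\<in>iw_dom.
            X p = a *\<^sub>R vstar \<alpha> p + b *\<^sub>R hstar \<alpha> p + c *\<^sub>R wstar \<beta> p + d *\<^sub>R L3 \<beta> p))) \<and>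
     (\<comment> \<open>(4)\<close>
      almost_contact_structure iw_dom Phi' (L3 \<beta>) (lam3 \<beta>) \<and>
      contact_form iw_dom (lam3 \<beta>) \<and>
      reeb_field iw_dom (lam3 \<beta>) (L3 \<beta>) \<and>
      (\<forall>p\<in>iw_dom. contact_distribution (lam3 \<beta>) p =
         span {vector [1, 0, - 1 / (2 * p $ 2)], vector [0, 1, 0]}) \<and>
      sub_riemannian iw_dom (contact_distribution (lam3 \<beta>))
        (\<lambda>p u v. lam1 \<alpha> p u * lam1 \<alpha> p v + lam2 \<alpha> p u * lam2 \<alpha> p v) \<and>
      (\<forall>p\<in>iw_dom. \<forall>u v.
         gX1 \<alpha> (proj_X1 p) (proj_X1 u) (proj_X1 v)
           = lam1 \<alpha> p u * lam1 \<alpha> p v + lam2 \<alpha> p u * lam2 \<alpha> p v \<and>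
         gSL \<alpha> \<beta> p u v = gX1 \<alpha> (proj_X1 p) (proj_X1 u) (proj_X1 v) + lam3 \<beta> p u * lam3 \<beta> p v) \<and>
      (\<forall>z\<in>X1. \<forall>v. gX1 \<alpha> z v v = \<alpha> * (((v $ 1)\<^sup>2 + (v $ 2)\<^sup>2) / (z $ 2)\<^sup>2)) \<and>
      kaehler_metric X1 J_X1 (gX1 \<alpha>) \<and>
      affine_invariant_field (l01 \<alpha>) \<and> affine_invariant_field (l02 \<alpha>) \<and>
      orthonormal_fields X1 (gX1 \<alpha>) [l01 \<alpha>, l02 \<alpha>]) \<and>
     (\<comment> \<open>(5)\<close>
      (\<forall>p\<in>iw_dom. \<forall>u v. ext_d (lam3 \<beta>) p u v
         = sqrt \<beta> / (p $ 2)\<^sup>2 * wedge11 (\<lambda>w. w $ 1) (\<lambda>w. w $ 2) u v) \<and>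
      rescaled_contact_metric_structure (2 * \<alpha> / sqrt \<beta>) iw_dom (lam3 \<beta>) (L3 \<beta>) Phi' (gSL \<alpha> \<beta>) \<and>
      homogeneous_contact SL2R (**) (lam3 \<beta>) \<and>
      killing_field iw_dom (gSL \<alpha> \<beta>) (L3 \<beta>) \<and>
      normal_structure iw_dom Phi' (L3 \<beta>) (lam3 \<beta>) \<and>
      riemannian_metric (riem_cone iw_dom) (cone_metric (gSL \<alpha> \<beta>)) \<and>
      closed_two_form (riem_cone iw_dom) (cone_form (lam3 \<beta>)) \<and>
      nondegenerate (riem_cone iw_dom) (cone_form (lam3 \<beta>)) \<and>
      (contact_metric_structure iw_dom (lam3 \<beta>) (L3 \<beta>) Phi' (gSL \<alpha> \<beta>) \<longleftrightarrow> 2 * \<alpha> = sqrt \<beta>) \<and>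
      (2 * \<alpha> = sqrt \<beta> \<longrightarrow>
         K_contact iw_dom (lam3 \<beta>) (L3 \<beta>) Phi' (gSL \<alpha> \<beta>) \<and>
         sasakian iw_dom (lam3 \<beta>) (L3 \<beta>) Phi' (gSL \<alpha> \<beta>) \<and>
         kaehler_metric (riem_cone iw_dom) (cone_acs Phi' (L3 \<beta>) (lam3 \<beta>)) (cone_metric (gSL \<alpha> \<beta>)) \<and>
         (\<forall>c\<in>riem_cone iw_dom. \<forall>u v. cone_form (lam3 \<beta>) c u v
            = cone_metric (gSL \<alpha> \<beta>) c u (cone_acs Phi' (L3 \<beta>) (lam3 \<beta>) c v))))"
proof -
  have line_element: "let y = p $ 2; dx = v $ 1; dy = v $ 2; dt = v $ 3 in
         gSL \<alpha> \<beta> p v v = (lam1 \<alpha> p v)\<^sup>2 + (lam2 \<alpha> p v)\<^sup>2 + (lam3 \<beta> p v)\<^sup>2 \<and>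
         gSL \<alpha> \<beta> p v v = \<alpha> * ((dx\<^sup>2 + dy\<^sup>2) / y\<^sup>2) + \<beta> * (dx / y + 2 * dt)\<^sup>2 \<and>
         gSL \<alpha> \<beta> p v v = ((\<alpha> + \<beta>) * dx\<^sup>2 + \<alpha> * dy\<^sup>2) / y\<^sup>2 + 4 * \<beta> * dt\<^sup>2 + 4 * (\<beta> / y) * dx * dt"
    if p: "p \<in> iw_dom" for p v
    unfolding Let_def
  proof (intro conjI)
    show "gSL \<alpha> \<beta> p v v = (lam1 \<alpha> p v)\<^sup>2 + (lam2 \<alpha> p v)\<^sup>2 + (lam3 \<beta> p v)\<^sup>2"
      by (simp add: gSL_def power2_eq_square)
    show e: "gSL \<alpha> \<beta> p v v = \<alpha> * (((v $ 1)\<^sup>2 + (v $ 2)\<^sup>2) / (p $ 2)\<^sup>2) + \<beta> * (v $ 1 / p $ 2 + 2 * v $ 3)\<^sup>2"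
      using assms p by (simp add: gSL_eq power2_eq_square)
    show "gSL \<alpha> \<beta> p v v = ((\<alpha> + \<beta>) * (v $ 1)\<^sup>2 + \<alpha> * (v $ 2)\<^sup>2) / (p $ 2)\<^sup>2 + 4 * \<beta> * (v $ 3)\<^sup>2
        + 4 * (\<beta> / p $ 2) * v $ 1 * v $ 3"
      using iw_domD[OF p] unfolding e by (simp add: field_simps power2_eq_square)
  qed
  have comb: "killing_field iw_dom (gSL \<alpha> \<beta>)
      (\<lambda>p. a *\<^sub>R vstar \<alpha> p + b *\<^sub>R hstar \<alpha> p + c *\<^sub>R wstar \<beta> p + d *\<^sub>R L3 \<beta> p)" for a b c d
    by (rule killing_star[OF assms])
  have killing: "killing_field iw_dom (gSL \<alpha> \<beta>) (vstar \<alpha>)" "killing_field iw_dom (gSL \<alpha> \<beta>) (hstar \<alpha>)"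
    "killing_field iw_dom (gSL \<alpha> \<beta>) (wstar \<beta>)" "killing_field iw_dom (gSL \<alpha> \<beta>) (L3 \<beta>)"
    using comb[of 1 0 0 0] comb[of 0 1 0 0] comb[of 0 0 1 0] comb[of 0 0 0 1] by simp_all
  have indep: "a = 0" "b = 0" "c = 0"
    if "\<forall>p\<in>iw_dom. a *\<^sub>R vstar \<alpha> p + b *\<^sub>R hstar \<alpha> p + c *\<^sub>R wstar \<beta> p = 0" for a b c
  proof -
    have "vector [0, 1, 0] \<in> iw_dom" by (simp add: iw_dom_def)
    from that[rule_format, OF this] assms show "a = 0" "b = 0" "c = 0"
      by (auto simp: vstar_def hstar_def wstar_def vec_eq_iff forall_3)
  qed
  have g_split: "gSL \<alpha> \<beta> p u v = gX1 \<alpha> (proj_X1 p) (proj_X1 u) (proj_X1 v) + lam3 \<beta> p u * lam3 \<beta> p v"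
    if "p \<in> iw_dom" for p u v
    using gX1_eq_lam12[OF assms(1) that] by (simp add: gSL_def)
  have d_lam3: "ext_d (lam3 \<beta>) p u v = sqrt \<beta> / (p $ 2)\<^sup>2 * wedge11 (\<lambda>w. w $ 1) (\<lambda>w. w $ 2) u v"
    if "p \<in> iw_dom" for p u v
    by (simp add: ext_d_lam3[OF that] wedge11_def mult.commute)
  have rescaled: "rescaled_contact_metric_structure (2 * \<alpha> / sqrt \<beta>) iw_dom (lam3 \<beta>) (L3 \<beta>) Phi' (gSL \<alpha> \<beta>)"
    using assms by (simp add: rescaled_contact_metric_SL2R_iff)
  have normalized: "K_contact iw_dom (lam3 \<beta>) (L3 \<beta>) Phi' (gSL \<alpha> \<beta>)"
    "sasakian iw_dom (lam3 \<beta>) (L3 \<beta>) Phi' (gSL \<alpha> \<beta>)"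
    "c \<in> riem_cone iw_dom \<Longrightarrow> cone_form (lam3 \<beta>) c u v
      = cone_metric (gSL \<alpha> \<beta>) c u (cone_acs Phi' (L3 \<beta>) (lam3 \<beta>) c v)"
    if "2 * \<alpha> = sqrt \<beta>" for c u v
  proof -
    note cm = contact_metric_SL2R_iff[OF assms, THEN iffD2, OF that]
    show "K_contact iw_dom (lam3 \<beta>) (L3 \<beta>) Phi' (gSL \<alpha> \<beta>)"
      "sasakian iw_dom (lam3 \<beta>) (L3 \<beta>) Phi' (gSL \<alpha> \<beta>)"
      using cm killing(4) normal_SL2R[OF assms(2)] by (simp_all add: K_contact_def sasakian_def)
    show "c \<in> riem_cone iw_dom \<Longrightarrow> cone_form (lam3 \<beta>) c u v
      = cone_metric (gSL \<alpha> \<beta>) c u (cone_acs Phi' (L3 \<beta>) (lam3 \<beta>) c v)"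
      by (rule cone_form_eq_cone_metric[OF cm])
  qed
  have gX1_line_element: "gX1 \<alpha> z v v = \<alpha> * (((v $ 1)\<^sup>2 + (v $ 2)\<^sup>2) / (z $ 2)\<^sup>2)" for z v
    by (simp add: gX1_def power2_eq_square)
  note nonneg = less_imp_le[OF assms(1)] less_imp_le[OF assms(2)]
  show ?thesis
    by (intro conjI ballI allI impI;
        rule riemannian_gSL[OF assms] left_invariant_gSL line_element metric_matrix_gSL[OF nonneg]
          left_invariant_L123[OF assms] orthonormal_L123[OF assms]
          killing indep traceless_generator_iff[OF assms] killing_field_gSL_iff[OF assms]
          almost_contact_SL2R[OF assms(2)] contact_form_lam3[OF assms(2)] reeb_L3[OF assms(2)]
          contact_distribution_lam3[OF assms(2), unfolded horizontal1_def horizontal2_def]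
          sub_riemannian_SL2R[OF assms] gX1_eq_lam12[OF assms(1)] g_split gX1_line_element
          kaehler_X1[OF assms(1)] affine_invariant_l0 orthonormal_l0[OF assms(1)]
          d_lam3 rescaled homogeneous_lam3 normal_SL2R[OF assms(2)]
          riemannian_cone_metric[OF open_iw_dom riemannian_gSL[OF assms]] closed_cone_form
          nondegenerate_cone_form[OF assms(2)] contact_metric_SL2R_iff[OF assms] normalized
          kaehler_cone[OF assms]; assumption)
qed

end
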